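(* The system $\textsf{P}_0+\Pi^0_1\text{-}\textsf{TRANS}+\textsf{STP}$ proves $\textsf{ATR}_0^{\text{st}}$.
   Context: Types: $0$ is the type of natural numbers, $1=0\to0$, $2=1\to0$, and $\tau^*$ is the type of finite sequences of objects of type $\tau$. $\textsf{E-PRA}^{\omega}$ is Kohlenbach's extensional primitive recursive arithmetic in all finite types (classical logic, extensionality, combinators, the type-$0$ primitive recursor, quantifier-free induction), and $\textsf{E-PRA}^{\omega*}$ its definitional extension with types $\tau^*$. $\textsf{QF-AC}^{1,0}$ is $(\forall x^1)(\exists y^0)\varphi(x,y)\to(\exists F^{1\to0})(\forall x^1)\varphi(x,F(x))$ for quantifier-free internal $\varphi$. The language of $\textsf{P}_0$ adds a predicate $\text{st}$ ("is standard") for every type. $(\forall^{\text{st}}x)A$ abbreviates $(\forall x)(\text{st}(x)\to A)$ and $(\exists^{\text{st}}x)A$ abbreviates $(\exists x)(\text{st}(x)\wedge A)$; a formula is internal if it does not involve $\text{st}$. For internal $A$, $A^{\text{st}}$ is obtained by relativising all quantifiers (except bounded number quantifiers) to $\text{st}$. The system $\textsf{P}_0$ consists of $\textsf{E-PRA}^{\omega*}+\textsf{QF-AC}^{1,0}$ plus: (1) $\text{st}(x)\wedge x=y\to\text{st}(y)$; $\text{st}(t)$ for every closed term $t$ of the (internal) language; $\text{st}(f)\wedge\text{st}(x)\to\text{st}(f(x))$; (2) Idealisation $\textsf{I}$: $(\forall^{\text{st}}x^{\sigma^*})(\exists y^\tau)(\forall z^\sigma\in x)\varphi(z,y)\to(\exists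 y^\tau)(\forall^{\text{st}}x^\sigma)\varphi(x,y)$ for internal $\varphi$; (3) $\textsf{HAC}_{\textsf{int}}$: $(\forall^{\text{st}}x^\rho)(\exists^{\text{st}}y^\tau)\varphi(x,y)\to(\exists^{\text{st}}F^{\rho\to\tau^*})(\forall^{\text{st}}x^\rho)(\exists y^\tau\in F(x))\varphi(x,y)$ for internal $\varphi$. $\Pi^0_1\text{-}\textsf{TRANS}$: $(\forall^{\text{st}}f^1)\big[(\forall^{\text{st}}n^0)(f(n)\neq0)\to(\forall m^0)(f(m)\neq0)\big]$. $\textsf{STP}$: $(\forall\alpha^1\leq_11)(\exists^{\text{st}}\beta^1\leq_11)(\alpha\approx_1\beta)$, where $\alpha\leq_11$ means $\alpha(n)\le1$ for all $n$, and $\alpha\approx_1\beta$ means $(\forall^{\text{st}}n^0)(\alpha(n)=\beta(n))$. $\textsf{ATR}_0$ is the usual system of second-order arithmetic: $\textsf{ACA}_0$ plus, for every arithmetical $\theta$, $(\forall X^1)[\textsf{WO}(X)\to(\exists Y^1)H_\theta(X,Y)]$, where $\textsf{WO}(X)$ says that $X$ is a countable well-ordering and $H_\theta(X,Y)$ says that $Y$ results from iterating $\theta$ along $X$, i.e. $Y=\{(n,j):j\in\text{field}(X)\wedge\theta(n,Y^j)\}$ with $Y^j=\{(m,i)\in Y:i<_Xj\}$ (sets coded by characteristic functions). $\textsf{ATR}_0^{\text{st}}$ is $\textsf{ATR}_0$ relativised to $\text{st}$. *)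

theory Defs
  imports Main
begin

section \<open>Types, terms and formulas\<close>

datatype ty = N | Fun ty ty (infixr "\<Rrightarrow>" 60) | Seq ty

abbreviation T1 :: ty where "T1 \<equiv> N \<Rrightarrow> N"

text \<open>
  \<open>Comb_K\<close> and \<open>Comb_S\<close> are the combinators usually written \<open>\<Pi>\<close> and \<open>\<Sigma>\<close>, \<open>Rec0\<close> is the primitive
  recursor of type 0.  The last three constants present the definitional extension by the types
  \<open>\<tau>\<^sup>*\<close>, a finite sequence being given by its length and its entries: \<open>Len\<close> and \<open>Entry\<close> are length
  and projection (with value 0 out of range), and \<open>Tab \<sigma> n f\<close> is \<open>\<langle>f 0, \<dots>, f (n - 1)\<rangle>\<close>.  The empty sequence, prepending,
  concatenation and the list recursor with values of type 0 are definable from these, whereas a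
  list recursor with values of all types would go beyond \<open>E-PRA\<^sup>\<omega>\<close>.
\<close>

datatype con =
  Zero | Succ | Comb_K ty ty | Comb_S ty ty ty | Rec0 | Len ty | Entry ty | Tab ty

primrec con_ty :: "con \<Rightarrow> ty" where
  "con_ty Zero = N"
| "con_ty Succ = N \<Rrightarrow> N"
| "con_ty (Comb_K \<rho> \<tau>) = \<rho> \<Rrightarrow> \<tau> \<Rrightarrow> \<rho>"
| "con_ty (Comb_S \<delta> \<rho> \<tau>) = (\<delta> \<Rrightarrow> \<rho> \<Rrightarrow> \<tau>) \<Rrightarrow> (\<delta> \<Rrightarrow> \<rho>) \<Rrightarrow> \<delta> \<Rrightarrow> \<tau>"
| "con_ty Rec0 = N \<Rrightarrow> N \<Rrightarrow> (N \<Rrightarrow> N \<Rrightarrow> N) \<Rrightarrow> N"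
| "con_ty (Len \<sigma>) = Seq \<sigma> \<Rrightarrow> N"
| "con_ty (Entry \<sigma>) = Seq \<sigma> \<Rrightarrow> N \<Rrightarrow> \<sigma>"
| "con_ty (Tab \<sigma>) = N \<Rrightarrow> (N \<Rrightarrow> \<sigma>) \<Rrightarrow> Seq \<sigma>"

text \<open>
  Locally nameless syntax: free variables are typed names, bound variables are de Bruijn indices.
  The binders \<open>all x\<close>, \<open>ex x\<close>, \<dots> below bind a name.
\<close>

type_synonym var = "nat \<times> ty"

datatype tm = Free var | Bnd nat | Con con | App tm tm (infixl "\<cdot>" 90)

text \<open>The only primitive equality is that of type 0.\<close>

datatype fm = Eq tm tm | St tm | Fls | Imp fm fm (infixr "\<^bold>\<longrightarrow>" 55) | All ty fm

abbreviation Neg :: "fm \<Rightarrow> fm" where "Neg A \<equiv> A \<^bold>\<longrightarrow> Fls"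
abbreviation Conj :: "fm \<Rightarrow> fm \<Rightarrow> fm" (infixr "\<^bold>\<and>" 58) where "A \<^bold>\<and> B \<equiv> Neg (A \<^bold>\<longrightarrow> Neg B)"
abbreviation Ex :: "ty \<Rightarrow> fm \<Rightarrow> fm" where "Ex \<tau> A \<equiv> Neg (All \<tau> (Neg A))"

primrec has_ty :: "ty list \<Rightarrow> tm \<Rightarrow> ty \<Rightarrow> bool" where
  "has_ty \<Gamma> (Free x) \<tau> = (snd x = \<tau>)"
| "has_ty \<Gamma> (Bnd k) \<tau> = (k < length \<Gamma> \<and> \<Gamma> ! k = \<tau>)"
| "has_ty \<Gamma> (Con c) \<tau> = (con_ty c = \<tau>)"
| "has_ty \<Gamma> (s \<cdot> t) \<tau> = (\<exists>\<sigma>. has_ty \<Gamma> s (\<sigma> \<Rrightarrow> \<tau>) \<and> has_ty \<Gamma> t \<sigma>)"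

abbreviation of_ty :: "tm \<Rightarrow> ty \<Rightarrow> bool" (infix "\<Colon>" 50) where "t \<Colon> \<tau> \<equiv> has_ty [] t \<tau>"

primrec wf_fm :: "ty list \<Rightarrow> fm \<Rightarrow> bool" where
  "wf_fm \<Gamma> (Eq s t) = (has_ty \<Gamma> s N \<and> has_ty \<Gamma> t N)"
| "wf_fm \<Gamma> (St t) = (\<exists>\<tau>. has_ty \<Gamma> t \<tau>)"
| "wf_fm \<Gamma> Fls = True"
| "wf_fm \<Gamma> (A \<^bold>\<longrightarrow> B) = (wf_fm \<Gamma> A \<and> wf_fm \<Gamma> B)"
| "wf_fm \<Gamma> (All \<tau> A) = wf_fm (\<tau> # \<Gamma>) A"

abbreviation wff :: "fm \<Rightarrow> bool" where "wff A \<equiv> wf_fm [] A"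

primrec fv_tm :: "tm \<Rightarrow> var set" where
  "fv_tm (Free x) = {x}"
| "fv_tm (Bnd k) = {}"
| "fv_tm (Con c) = {}"
| "fv_tm (s \<cdot> t) = fv_tm s \<union> fv_tm t"

primrec fv :: "fm \<Rightarrow> var set" where
  "fv (Eq s t) = fv_tm s \<union> fv_tm t"
| "fv (St t) = fv_tm t"
| "fv Fls = {}"
| "fv (A \<^bold>\<longrightarrow> B) = fv A \<union> fv B"
| "fv (All \<tau> A) = fv A"

primrec internal :: "fm \<Rightarrow> bool" where
  "internal (Eq s t) = True"
| "internal (St t) = False"
| "internal Fls = True"
| "internal (A \<^bold>\<longrightarrow> B) = (internal A \<and> internal B)"
| "internal (All \<tau> A) = internal A"

primrec quantifier_free :: "fm \<Rightarrow> bool" where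
  "quantifier_free (Eq s t) = True"
| "quantifier_free (St t) = True"
| "quantifier_free Fls = True"
| "quantifier_free (A \<^bold>\<longrightarrow> B) = (quantifier_free A \<and> quantifier_free B)"
| "quantifier_free (All \<tau> A) = False"

text \<open>Substitution of a term for a free variable, for a dangling index, and of an index for a free
  variable.  The first two are only used with terms without dangling indices.\<close>

primrec subst_tm :: "var \<Rightarrow> tm \<Rightarrow> tm \<Rightarrow> tm" where
  "subst_tm x u (Free y) = (if y = x then u else Free y)"
| "subst_tm x u (Bnd k) = Bnd k"
| "subst_tm x u (Con c) = Con c"
| "subst_tm x u (s \<cdot> t) = subst_tm x u s \<cdot> subst_tm x u t"

primrec subst :: "var \<Rightarrow> tm \<Rightarrow> fm \<Rightarrow> fm" where
  "subst x u (Eq s t) = Eq (subst_tm x u s) (subst_tm x u t)"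
| "subst x u (St t) = St (subst_tm x u t)"
| "subst x u Fls = Fls"
| "subst x u (A \<^bold>\<longrightarrow> B) = subst x u A \<^bold>\<longrightarrow> subst x u B"
| "subst x u (All \<tau> A) = All \<tau> (subst x u A)"

primrec inst_tm :: "nat \<Rightarrow> tm \<Rightarrow> tm \<Rightarrow> tm" where
  "inst_tm k u (Free x) = Free x"
| "inst_tm k u (Bnd j) = (if j = k then u else Bnd j)"
| "inst_tm k u (Con c) = Con c"
| "inst_tm k u (s \<cdot> t) = inst_tm k u s \<cdot> inst_tm k u t"

primrec inst :: "nat \<Rightarrow> tm \<Rightarrow> fm \<Rightarrow> fm" where
  "inst k u (Eq s t) = Eq (inst_tm k u s) (inst_tm k u t)"
| "inst k u (St t) = St (inst_tm k u t)"
| "inst k u Fls = Fls"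
| "inst k u (A \<^bold>\<longrightarrow> B) = inst k u A \<^bold>\<longrightarrow> inst k u B"
| "inst k u (All \<tau> A) = All \<tau> (inst (Suc k) u A)"

primrec close_tm :: "nat \<Rightarrow> var \<Rightarrow> tm \<Rightarrow> tm" where
  "close_tm k x (Free y) = (if y = x then Bnd k else Free y)"
| "close_tm k x (Bnd j) = Bnd j"
| "close_tm k x (Con c) = Con c"
| "close_tm k x (s \<cdot> t) = close_tm k x s \<cdot> close_tm k x t"

primrec close :: "nat \<Rightarrow> var \<Rightarrow> fm \<Rightarrow> fm" where
  "close k x (Eq s t) = Eq (close_tm k x s) (close_tm k x t)"
| "close k x (St t) = St (close_tm k x t)"
| "close k x Fls = Fls"
| "close k x (A \<^bold>\<longrightarrow> B) = close k x A \<^bold>\<longrightarrow> close k x B"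
| "close k x (All \<tau> A) = All \<tau> (close (Suc k) x A)"

definition all :: "var \<Rightarrow> fm \<Rightarrow> fm" where "all x A = All (snd x) (close 0 x A)"
definition ex :: "var \<Rightarrow> fm \<Rightarrow> fm" where "ex x A = Ex (snd x) (close 0 x A)"
definition all_st :: "var \<Rightarrow> fm \<Rightarrow> fm" where "all_st x A = all x (St (Free x) \<^bold>\<longrightarrow> A)"
definition ex_st :: "var \<Rightarrow> fm \<Rightarrow> fm" where "ex_st x A = ex x (St (Free x) \<^bold>\<and> A)"


section \<open>Derivability in many-sorted classical logic\<close>

text \<open>
  \<open>derives Ax H A\<close>: natural deduction of \<open>A\<close> from the axioms \<open>Ax\<close> under the assumptions \<open>H\<close>.  Free
  variables of axioms are read universally, so the eigenvariable condition concerns \<open>H\<close> only.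
\<close>

inductive derives :: "fm set \<Rightarrow> fm set \<Rightarrow> fm \<Rightarrow> bool" for Ax :: "fm set" where
  ax: "A \<in> Ax \<Longrightarrow> wff A \<Longrightarrow> derives Ax H A"
| assm: "A \<in> H \<Longrightarrow> wff A \<Longrightarrow> derives Ax H A"
| impI: "wff A \<Longrightarrow> derives Ax (insert A H) B \<Longrightarrow> derives Ax H (A \<^bold>\<longrightarrow> B)"
| impE: "derives Ax H (A \<^bold>\<longrightarrow> B) \<Longrightarrow> derives Ax H A \<Longrightarrow> derives Ax H B"
| raa: "wff A \<Longrightarrow> derives Ax (insert (Neg A) H) Fls \<Longrightarrow> derives Ax H A"
| allI: "derives Ax H A \<Longrightarrow> (\<And>B. B \<in> H \<Longrightarrow> x \<notin> fv B) \<Longrightarrow> derives Ax H (all x A)"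
| allE: "derives Ax H (All \<tau> A) \<Longrightarrow> t \<Colon> \<tau> \<Longrightarrow> derives Ax H (inst 0 t A)"

definition proves :: "fm set \<Rightarrow> fm \<Rightarrow> bool" (infix "\<turnstile>" 30) where
  "Ax \<turnstile> A \<longleftrightarrow> derives Ax {} A"


section \<open>Terms and defined relations\<close>

abbreviation zero :: tm where "zero \<equiv> Con Zero"
abbreviation suc :: "tm \<Rightarrow> tm" where "suc t \<equiv> Con Succ \<cdot> t"
abbreviation one :: tm where "one \<equiv> suc zero"
abbreviation rec0 :: "tm \<Rightarrow> tm \<Rightarrow> tm \<Rightarrow> tm" where "rec0 n s t \<equiv> Con Rec0 \<cdot> n \<cdot> s \<cdot> t"
abbreviation len :: "ty \<Rightarrow> tm \<Rightarrow> tm" where "len \<sigma> t \<equiv> Con (Len \<sigma>) \<cdot> t"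
abbreviation entry :: "ty \<Rightarrow> tm \<Rightarrow> tm \<Rightarrow> tm" where "entry \<sigma> t i \<equiv> Con (Entry \<sigma>) \<cdot> t \<cdot> i"
abbreviation tab :: "ty \<Rightarrow> tm \<Rightarrow> tm \<Rightarrow> tm" where "tab \<sigma> n f \<equiv> Con (Tab \<sigma>) \<cdot> n \<cdot> f"

text \<open>Abstraction by combinators; \<open>ty_of\<close> is only meaningful on typable terms without dangling
  indices.\<close>

primrec ty_of :: "tm \<Rightarrow> ty" where
  "ty_of (Free x) = snd x"
| "ty_of (Bnd k) = N"
| "ty_of (Con c) = con_ty c"
| "ty_of (s \<cdot> t) = (case ty_of s of \<sigma> \<Rrightarrow> \<tau> \<Rightarrow> \<tau> | _ \<Rightarrow> N)"

definition comb_I :: "ty \<Rightarrow> tm" where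
  "comb_I \<sigma> = Con (Comb_S \<sigma> (\<sigma> \<Rrightarrow> \<sigma>) \<sigma>) \<cdot> Con (Comb_K \<sigma> (\<sigma> \<Rrightarrow> \<sigma>)) \<cdot> Con (Comb_K \<sigma> \<sigma>)"

primrec lam :: "var \<Rightarrow> tm \<Rightarrow> tm" where
  "lam x (Free y) =
    (if y = x then comb_I (snd x) else Con (Comb_K (snd y) (snd x)) \<cdot> Free y)"
| "lam x (Bnd k) = Con (Comb_K N (snd x)) \<cdot> Bnd k"
| "lam x (Con c) = Con (Comb_K (con_ty c) (snd x)) \<cdot> Con c"
| "lam x (s \<cdot> t) = Con (Comb_S (snd x) (ty_of t) (ty_of (s \<cdot> t))) \<cdot> lam x s \<cdot> lam x t"

definition plus_tm :: tm where
  "plus_tm = (let x = (0, N); y = (1, N); v = (2, N); i = (3, N) in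
     lam x (lam y (rec0 (Free y) (Free x) (lam v (lam i (suc (Free v)))))))"

definition times_tm :: tm where
  "times_tm = (let x = (0, N); y = (1, N); v = (2, N); i = (3, N) in
     lam x (lam y (rec0 (Free y) zero (lam v (lam i (plus_tm \<cdot> Free v \<cdot> Free x))))))"

definition pred_tm :: tm where
  "pred_tm = (let x = (0, N); v = (2, N); i = (3, N) in
     lam x (rec0 (Free x) zero (lam v (lam i (Free i)))))"

definition monus_tm :: tm where
  "monus_tm = (let x = (0, N); y = (1, N); v = (2, N); i = (3, N) in
     lam x (lam y (rec0 (Free y) (Free x) (lam v (lam i (pred_tm \<cdot> Free v))))))"

definition le :: "tm \<Rightarrow> tm \<Rightarrow> fm" where "le s t = Eq (monus_tm \<cdot> s \<cdot> t) zero"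
definition lt :: "tm \<Rightarrow> tm \<Rightarrow> fm" where "lt s t = le (suc s) t"

primrec zero_tm :: "ty \<Rightarrow> tm" where
  "zero_tm N = zero"
| "zero_tm (\<sigma> \<Rrightarrow> \<tau>) = Con (Comb_K \<tau> \<sigma>) \<cdot> zero_tm \<tau>"
| "zero_tm (Seq \<sigma>) = tab \<sigma> zero (Con (Comb_K \<sigma> N) \<cdot> zero_tm \<sigma>)"

primrec lift :: "tm \<Rightarrow> tm" where
  "lift (Free x) = Free x"
| "lift (Bnd k) = Bnd (Suc k)"
| "lift (Con c) = Con c"
| "lift (s \<cdot> t) = lift s \<cdot> lift t"

text \<open>Equality of all types, defined extensionally from equality of type 0.\<close>

primrec eq :: "ty \<Rightarrow> tm \<Rightarrow> tm \<Rightarrow> fm" where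
  "eq N s t = Eq s t"
| "eq (\<sigma> \<Rrightarrow> \<tau>) s t = All \<sigma> (eq \<tau> (lift s \<cdot> Bnd 0) (lift t \<cdot> Bnd 0))"
| "eq (Seq \<sigma>) s t = Eq (len \<sigma> s) (len \<sigma> t) \<^bold>\<and>
     All N (lt (Bnd 0) (len \<sigma> (lift s)) \<^bold>\<longrightarrow>
       eq \<sigma> (entry \<sigma> (lift s) (Bnd 0)) (entry \<sigma> (lift t) (Bnd 0)))"

text \<open>\<open>mem \<sigma> t s\<close> is \<open>t \<in> s\<close> for \<open>t\<close> of type \<open>\<sigma>\<close> and \<open>s\<close> of type \<open>\<sigma>\<^sup>*\<close>.\<close>

definition mem :: "ty \<Rightarrow> tm \<Rightarrow> tm \<Rightarrow> fm" where
  "mem \<sigma> t s = Ex N (lt (Bnd 0) (len \<sigma> (lift s)) \<^bold>\<and> eq \<sigma> (lift t) (entry \<sigma> (lift s) (Bnd 0)))"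

definition le1 :: "tm \<Rightarrow> fm" where "le1 s = All N (le (lift s \<cdot> Bnd 0) one)"


section \<open>The systems\<close>

inductive_set E_PRA :: "fm set" where
  refl: "t \<Colon> N \<Longrightarrow> Eq t t \<in> E_PRA"
| sym: "s \<Colon> N \<Longrightarrow> t \<Colon> N \<Longrightarrow> (Eq s t \<^bold>\<longrightarrow> Eq t s) \<in> E_PRA"
| trans: "r \<Colon> N \<Longrightarrow> s \<Colon> N \<Longrightarrow> t \<Colon> N \<Longrightarrow> (Eq r s \<^bold>\<longrightarrow> Eq s t \<^bold>\<longrightarrow> Eq r t) \<in> E_PRA"
| ext: "r \<Colon> \<sigma> \<Rrightarrow> \<tau> \<Longrightarrow> s \<Colon> \<sigma> \<Longrightarrow> t \<Colon> \<sigma> \<Longrightarrow> (eq \<sigma> s t \<^bold>\<longrightarrow> eq \<tau> (r \<cdot> s) (r \<cdot> t)) \<in> E_PRA"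
| suc_nonzero: "t \<Colon> N \<Longrightarrow> Neg (Eq (suc t) zero) \<in> E_PRA"
| suc_inject: "s \<Colon> N \<Longrightarrow> t \<Colon> N \<Longrightarrow> (Eq (suc s) (suc t) \<^bold>\<longrightarrow> Eq s t) \<in> E_PRA"
| comb_K: "s \<Colon> \<rho> \<Longrightarrow> t \<Colon> \<tau> \<Longrightarrow> eq \<rho> (Con (Comb_K \<rho> \<tau>) \<cdot> s \<cdot> t) s \<in> E_PRA"
| comb_S: "r \<Colon> \<delta> \<Rrightarrow> \<rho> \<Rrightarrow> \<tau> \<Longrightarrow> s \<Colon> \<delta> \<Rrightarrow> \<rho> \<Longrightarrow> t \<Colon> \<delta> \<Longrightarrow>
    eq \<tau> (Con (Comb_S \<delta> \<rho> \<tau>) \<cdot> r \<cdot> s \<cdot> t) (r \<cdot> t \<cdot> (s \<cdot> t)) \<in> E_PRA"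
| rec0_zero: "s \<Colon> N \<Longrightarrow> t \<Colon> N \<Rrightarrow> N \<Rrightarrow> N \<Longrightarrow> Eq (rec0 zero s t) s \<in> E_PRA"
| rec0_suc: "n \<Colon> N \<Longrightarrow> s \<Colon> N \<Longrightarrow> t \<Colon> N \<Rrightarrow> N \<Rrightarrow> N \<Longrightarrow>
    Eq (rec0 (suc n) s t) (t \<cdot> rec0 n s t \<cdot> n) \<in> E_PRA"
| qf_induction: "wff A \<Longrightarrow> internal A \<Longrightarrow> quantifier_free A \<Longrightarrow> snd x = N \<Longrightarrow>
    (subst x zero A \<^bold>\<and> all x (A \<^bold>\<longrightarrow> subst x (suc (Free x)) A) \<^bold>\<longrightarrow> all x A) \<in> E_PRA"
| len_tab: "n \<Colon> N \<Longrightarrow> f \<Colon> N \<Rrightarrow> \<sigma> \<Longrightarrow> Eq (len \<sigma> (tab \<sigma> n f)) n \<in> E_PRA"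
| entry_tab: "n \<Colon> N \<Longrightarrow> f \<Colon> N \<Rrightarrow> \<sigma> \<Longrightarrow> i \<Colon> N \<Longrightarrow>
    (lt i n \<^bold>\<longrightarrow> eq \<sigma> (entry \<sigma> (tab \<sigma> n f) i) (f \<cdot> i)) \<in> E_PRA"
| entry_default: "s \<Colon> Seq \<sigma> \<Longrightarrow> i \<Colon> N \<Longrightarrow>
    (le (len \<sigma> s) i \<^bold>\<longrightarrow> eq \<sigma> (entry \<sigma> s i) (zero_tm \<sigma>)) \<in> E_PRA"

inductive_set P0 :: "fm set" where
  e_pra: "A \<in> E_PRA \<Longrightarrow> A \<in> P0"
| qf_ac: "wff A \<Longrightarrow> internal A \<Longrightarrow> quantifier_free A \<Longrightarrow>
    snd x = T1 \<Longrightarrow> snd y = N \<Longrightarrow> snd F = T1 \<Rrightarrow> N \<Longrightarrow> F \<notin> fv A \<Longrightarrow>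
    (all x (ex y A) \<^bold>\<longrightarrow> ex F (all x (subst y (Free F \<cdot> Free x) A))) \<in> P0"
| st_eq: "s \<Colon> \<tau> \<Longrightarrow> t \<Colon> \<tau> \<Longrightarrow> (St s \<^bold>\<and> eq \<tau> s t \<^bold>\<longrightarrow> St t) \<in> P0"
| st_closed: "t \<Colon> \<tau> \<Longrightarrow> fv_tm t = {} \<Longrightarrow> St t \<in> P0"
| st_app: "s \<Colon> \<sigma> \<Rrightarrow> \<tau> \<Longrightarrow> t \<Colon> \<sigma> \<Longrightarrow> (St s \<^bold>\<and> St t \<^bold>\<longrightarrow> St (s \<cdot> t)) \<in> P0"
| idealisation: "wff A \<Longrightarrow> internal A \<Longrightarrow>
    snd z = \<sigma> \<Longrightarrow> snd x = Seq \<sigma> \<Longrightarrow> y \<noteq> z \<Longrightarrow> y \<noteq> x \<Longrightarrow> x \<notin> fv A \<Longrightarrow>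
    (all_st x (ex y (all z (mem \<sigma> (Free z) (Free x) \<^bold>\<longrightarrow> A))) \<^bold>\<longrightarrow> ex y (all_st z A)) \<in> P0"
| hac_int: "wff A \<Longrightarrow> internal A \<Longrightarrow>
    snd x = \<rho> \<Longrightarrow> snd y = \<tau> \<Longrightarrow> x \<noteq> y \<Longrightarrow> snd F = \<rho> \<Rrightarrow> Seq \<tau> \<Longrightarrow> F \<notin> fv A \<Longrightarrow>
    (all_st x (ex_st y A) \<^bold>\<longrightarrow>
      ex_st F (all_st x (ex y (mem \<tau> (Free y) (Free F \<cdot> Free x) \<^bold>\<and> A)))) \<in> P0"

definition Pi01_TRANS :: fm where
  "Pi01_TRANS = (let f = (0, T1); n = (0, N); m = (1, N) in
     all_st f (all_st n (Neg (Eq (Free f \<cdot> Free n) zero)) \<^bold>\<longrightarrow>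
               all m (Neg (Eq (Free f \<cdot> Free m) zero))))"

definition STP :: fm where
  "STP = (let \<alpha> = (0, T1); \<beta> = (1, T1); n = (0, N) in
     all \<alpha> (le1 (Free \<alpha>) \<^bold>\<longrightarrow>
       ex_st \<beta> (le1 (Free \<beta>) \<^bold>\<and> all_st n (Eq (Free \<alpha> \<cdot> Free n) (Free \<beta> \<cdot> Free n)))))"


section \<open>Second-order arithmetic\<close>

text \<open>
  Number and set variables are named by natural numbers, in separate name spaces.  The bounded
  quantifier \<open>LBAll x t A\<close>, i.e.\ \<open>\<forall>x<t. A\<close>, binds \<open>x\<close> in \<open>A\<close> only; it is primitive because
  relativisation to \<open>st\<close> treats it differently from \<open>\<forall>x (x < t \<longrightarrow> A)\<close>.
\<close>

datatype nt = NVar nat | NZero | NOne | NAdd nt nt | NMul nt nt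

datatype l2 = LEq nt nt | LLt nt nt | LMem nt nat | LFls | LImp l2 l2
  | LBAll nat nt l2 | LAllN nat l2 | LAllS nat l2

abbreviation LNot :: "l2 \<Rightarrow> l2" where "LNot A \<equiv> LImp A LFls"
abbreviation LAnd :: "l2 \<Rightarrow> l2 \<Rightarrow> l2" where "LAnd A B \<equiv> LNot (LImp A (LNot B))"
abbreviation LOr :: "l2 \<Rightarrow> l2 \<Rightarrow> l2" where "LOr A B \<equiv> LImp (LNot A) B"
abbreviation LIff :: "l2 \<Rightarrow> l2 \<Rightarrow> l2" where "LIff A B \<equiv> LAnd (LImp A B) (LImp B A)"
abbreviation LExN :: "nat \<Rightarrow> l2 \<Rightarrow> l2" where "LExN x A \<equiv> LNot (LAllN x (LNot A))"
abbreviation LExS :: "nat \<Rightarrow> l2 \<Rightarrow> l2" where "LExS X A \<equiv> LNot (LAllS X (LNot A))"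

primrec vars_nt :: "nt \<Rightarrow> nat set" where
  "vars_nt (NVar x) = {x}"
| "vars_nt NZero = {}"
| "vars_nt NOne = {}"
| "vars_nt (NAdd s t) = vars_nt s \<union> vars_nt t"
| "vars_nt (NMul s t) = vars_nt s \<union> vars_nt t"

primrec num_vars :: "l2 \<Rightarrow> nat set" where \<comment> \<open>free or bound\<close>
  "num_vars (LEq s t) = vars_nt s \<union> vars_nt t"
| "num_vars (LLt s t) = vars_nt s \<union> vars_nt t"
| "num_vars (LMem t X) = vars_nt t"
| "num_vars LFls = {}"
| "num_vars (LImp A B) = num_vars A \<union> num_vars B"
| "num_vars (LBAll x t A) = insert x (vars_nt t \<union> num_vars A)"
| "num_vars (LAllN x A) = insert x (num_vars A)"
| "num_vars (LAllS X A) = num_vars A"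

primrec free_num :: "l2 \<Rightarrow> nat set" where
  "free_num (LEq s t) = vars_nt s \<union> vars_nt t"
| "free_num (LLt s t) = vars_nt s \<union> vars_nt t"
| "free_num (LMem t X) = vars_nt t"
| "free_num LFls = {}"
| "free_num (LImp A B) = free_num A \<union> free_num B"
| "free_num (LBAll x t A) = vars_nt t \<union> (free_num A - {x})"
| "free_num (LAllN x A) = free_num A - {x}"
| "free_num (LAllS X A) = free_num A"

primrec free_set :: "l2 \<Rightarrow> nat set" where
  "free_set (LEq s t) = {}"
| "free_set (LLt s t) = {}"
| "free_set (LMem t X) = {X}"
| "free_set LFls = {}"
| "free_set (LImp A B) = free_set A \<union> free_set B"
| "free_set (LBAll x t A) = free_set A"
| "free_set (LAllN x A) = free_set A"
| "free_set (LAllS X A) = free_set A - {X}"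

primrec arithmetical :: "l2 \<Rightarrow> bool" where
  "arithmetical (LEq s t) = True"
| "arithmetical (LLt s t) = True"
| "arithmetical (LMem t X) = True"
| "arithmetical LFls = True"
| "arithmetical (LImp A B) = (arithmetical A \<and> arithmetical B)"
| "arithmetical (LBAll x t A) = arithmetical A"
| "arithmetical (LAllN x A) = arithmetical A"
| "arithmetical (LAllS X A) = False"

text \<open>\<open>subst_set Z P A\<close> replaces the atoms \<open>t \<in> Z\<close>, with \<open>Z\<close> free, by \<open>P t\<close>.\<close>

primrec subst_set :: "nat \<Rightarrow> (nt \<Rightarrow> l2) \<Rightarrow> l2 \<Rightarrow> l2" where
  "subst_set Z P (LEq s t) = LEq s t"
| "subst_set Z P (LLt s t) = LLt s t"
| "subst_set Z P (LMem t X) = (if X = Z then P t else LMem t X)"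
| "subst_set Z P LFls = LFls"
| "subst_set Z P (LImp A B) = LImp (subst_set Z P A) (subst_set Z P B)"
| "subst_set Z P (LBAll x t A) = LBAll x t (subst_set Z P A)"
| "subst_set Z P (LAllN x A) = LAllN x (subst_set Z P A)"
| "subst_set Z P (LAllS X A) = (if X = Z then LAllS X A else LAllS X (subst_set Z P A))"

definition npair :: "nt \<Rightarrow> nt \<Rightarrow> nt" where
  "npair s t = NAdd (NMul (NAdd s t) (NAdd s t)) s"

text \<open>A set \<open>X\<close> of pairs is read as the relation \<open>i \<le>\<^sub>X j \<longleftrightarrow> (i, j) \<in> X\<close>, with field
  \<open>{i. (i, i) \<in> X}\<close>.\<close>

definition le_rel :: "nat \<Rightarrow> nt \<Rightarrow> nt \<Rightarrow> l2" where
  "le_rel X i j = LMem (npair i j) X"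

definition lt_rel :: "nat \<Rightarrow> nt \<Rightarrow> nt \<Rightarrow> l2" where
  "lt_rel X i j = LAnd (le_rel X i j) (LNot (le_rel X j i))"

definition in_field :: "nat \<Rightarrow> nt \<Rightarrow> l2" where
  "in_field X i = le_rel X i i"

definition LO :: "nat \<Rightarrow> l2" where
  "LO X = (let i = NVar 0; j = NVar 1; k = NVar 2 in
     LAllN 0 (LAllN 1 (LAllN 2 (
       LAnd (LImp (le_rel X i j) (LAnd (in_field X i) (in_field X j)))
      (LAnd (LImp (LAnd (le_rel X i j) (le_rel X j k)) (le_rel X i k))
      (LAnd (LImp (LAnd (le_rel X i j) (le_rel X j i)) (LEq i j))
            (LImp (LAnd (in_field X i) (in_field X j)) (LOr (le_rel X i j) (le_rel X j i)))))))))"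

text \<open>\<open>F\<close> is (the graph of) a function from the natural numbers to the field of \<open>X\<close>.\<close>

definition fun_into_field :: "nat \<Rightarrow> nat \<Rightarrow> l2" where
  "fun_into_field F X = (let k = NVar 0; n = NVar 1; a = NVar 2; b = NVar 3 in
     LAnd (LAllN 0 (LImp (LMem k F) (LExN 1 (LExN 2 (LAnd (LEq k (npair n a)) (in_field X a))))))
    (LAnd (LAllN 1 (LExN 2 (LMem (npair n a) F)))
          (LAllN 1 (LAllN 2 (LAllN 3
            (LImp (LAnd (LMem (npair n a) F) (LMem (npair n b) F)) (LEq a b)))))))"

definition WO :: "nat \<Rightarrow> l2" where
  "WO X = (let F = Suc X; n = NVar 1; a = NVar 2; b = NVar 3 in
     LAnd (LO X)
       (LNot (LExS F (LAnd (fun_into_field F X)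
          (LAllN 1 (LAllN 2 (LAllN 3
            (LImp (LAnd (LMem (npair n a) F) (LMem (npair (NAdd n NOne) b) F))
                  (lt_rel X b a)))))))))"

text \<open>\<open>t \<in> Y\<^sup>j\<close>, where \<open>Y\<^sup>j = {(m, i) \<in> Y. i <\<^sub>X j}\<close>; the variables \<open>m\<close> and \<open>i\<close> must not occur in \<open>t\<close>.\<close>

definition mem_below :: "nat \<Rightarrow> nat \<Rightarrow> nat \<Rightarrow> nat \<Rightarrow> nat \<Rightarrow> nt \<Rightarrow> l2" where
  "mem_below X Y j m i t = LAnd (LMem t Y)
     (LExN m (LExN i (LAnd (LEq t (npair (NVar m) (NVar i))) (lt_rel X (NVar i) (NVar j)))))"

text \<open>\<open>H\<^sub>\<theta>(X, Y)\<close> for \<open>\<theta> = \<theta>(n, Z)\<close>; the variables \<open>k\<close>, \<open>j\<close>, \<open>m\<close> and \<open>i\<close> are auxiliary.\<close>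

definition H :: "l2 \<Rightarrow> nat \<Rightarrow> nat \<Rightarrow> nat \<Rightarrow> nat \<Rightarrow> nat \<Rightarrow> nat \<Rightarrow> nat \<Rightarrow> nat \<Rightarrow> l2" where
  "H \<theta> n Z k j m i X Y =
     LAllN k (LIff (LMem (NVar k) Y)
       (LExN n (LExN j (LAnd (LEq (NVar k) (npair (NVar n) (NVar j)))
         (LAnd (in_field X (NVar j)) (subst_set Z (mem_below X Y j m i) \<theta>))))))"

inductive_set ACA0_axioms :: "l2 set" where
  "LNot (LEq (NAdd (NVar 0) NOne) NZero) \<in> ACA0_axioms"
| "LImp (LEq (NAdd (NVar 0) NOne) (NAdd (NVar 1) NOne)) (LEq (NVar 0) (NVar 1)) \<in> ACA0_axioms"
| "LEq (NAdd (NVar 0) NZero) (NVar 0) \<in> ACA0_axioms"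
| "LEq (NAdd (NVar 0) (NAdd (NVar 1) NOne)) (NAdd (NAdd (NVar 0) (NVar 1)) NOne) \<in> ACA0_axioms"
| "LEq (NMul (NVar 0) NZero) NZero \<in> ACA0_axioms"
| "LEq (NMul (NVar 0) (NAdd (NVar 1) NOne)) (NAdd (NMul (NVar 0) (NVar 1)) (NVar 0))
    \<in> ACA0_axioms"
| "LNot (LLt (NVar 0) NZero) \<in> ACA0_axioms"
| "LIff (LLt (NVar 0) (NAdd (NVar 1) NOne)) (LOr (LLt (NVar 0) (NVar 1)) (LEq (NVar 0) (NVar 1)))
    \<in> ACA0_axioms"
| induction: "LImp (LAnd (LMem NZero 0)
      (LAllN 0 (LImp (LMem (NVar 0) 0) (LMem (NAdd (NVar 0) NOne) 0))))
    (LAllN 0 (LMem (NVar 0) 0)) \<in> ACA0_axioms"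
| comprehension: "arithmetical A \<Longrightarrow> X \<notin> free_set A \<Longrightarrow>
    LExS X (LAllN n (LIff (LMem (NVar n) X) A)) \<in> ACA0_axioms"

inductive_set ATR0_axioms :: "l2 set" where
  aca0: "A \<in> ACA0_axioms \<Longrightarrow> A \<in> ATR0_axioms"
| recursion: "arithmetical \<theta> \<Longrightarrow> X \<noteq> Y \<Longrightarrow> Y \<notin> free_set \<theta> \<Longrightarrow>
    distinct [n, k, j, m, i] \<Longrightarrow> {k, j, m, i} \<inter> num_vars \<theta> = {} \<Longrightarrow>
    LAllS X (LImp (WO X) (LExS Y (H \<theta> n Z k j m i X Y))) \<in> ATR0_axioms"

text \<open>The axioms are sentences, namely universal closures over all parameters.\<close>

definition ATR0 :: "l2 set" where
  "ATR0 = {foldr LAllN ns (foldr LAllS Xs A) | ns Xs A.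
     A \<in> ATR0_axioms \<and> free_num A \<subseteq> set ns \<and> free_set A \<subseteq> set Xs}"


section \<open>Relativisation of second-order arithmetic to the standard objects\<close>

primrec nt_tm :: "nt \<Rightarrow> tm" where
  "nt_tm (NVar x) = Free (x, N)"
| "nt_tm NZero = zero"
| "nt_tm NOne = one"
| "nt_tm (NAdd s t) = plus_tm \<cdot> nt_tm s \<cdot> nt_tm t"
| "nt_tm (NMul s t) = times_tm \<cdot> nt_tm s \<cdot> nt_tm t"

definition le1_st :: "tm \<Rightarrow> fm" where
  "le1_st s = All N (St (Bnd 0) \<^bold>\<longrightarrow> le (lift s \<cdot> Bnd 0) one)"

text \<open>Sets are represented by characteristic functions, i.e.\ by type 1 objects bounded by 1.\<close>

primrec rel_st :: "l2 \<Rightarrow> fm" where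
  "rel_st (LEq s t) = Eq (nt_tm s) (nt_tm t)"
| "rel_st (LLt s t) = lt (nt_tm s) (nt_tm t)"
| "rel_st (LMem t X) = Eq (Free (X, T1) \<cdot> nt_tm t) one"
| "rel_st LFls = Fls"
| "rel_st (LImp A B) = rel_st A \<^bold>\<longrightarrow> rel_st B"
| "rel_st (LBAll x t A) = All N (lt (Bnd 0) (nt_tm t) \<^bold>\<longrightarrow> close 0 (x, N) (rel_st A))"
| "rel_st (LAllN x A) = all_st (x, N) (rel_st A)"
| "rel_st (LAllS X A) = all_st (X, T1) (le1_st (Free (X, T1)) \<^bold>\<longrightarrow> rel_st A)"

definition ATR0_st :: "fm set" where
  "ATR0_st = rel_st ` ATR0"

end

theory Submission
  imports Defs "HOL-Library.Countable"
begin

text \<open>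
  By Henkin's construction it suffices to argue in models in which the defined equality of every
  type is identity.  There \<open>HAC\<close>, applied to the instances of \<open>\<Pi>\<^sup>0\<^sub>1\<close>-transfer, yields a standard
  search functional \<open>\<mu>\<close>, so that every arithmetical formula relativised to the standard objects has
  a characteristic term; this gives arithmetical comprehension.  \<open>STP\<close> gives more: call \<open>Y\<close> a
  hierarchy up to \<open>j\<close> if it iterates \<open>\<theta>\<close> correctly along all \<open>i \<le>\<^sub>X j\<close>.  Along a well-ordering, any
  two standard hierarchies agree, so for every standard finite list of them some set agrees with
  all of them; by idealisation and \<open>STP\<close> one standard set \<open>W\<close> agrees with all standard hierarchies.
  The set of \<open>j\<close> up to which \<open>W\<close> itself is a hierarchy is then arithmetical in \<open>W\<close>, and it contains
  every \<open>j\<close> up to which some standard hierarchy exists.  Hence it has no least gap, and \<open>W\<close> is a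
  hierarchy along the whole well-ordering.
\<close>

text \<open>A least gap cannot be sought among the \<open>j\<close> that lack a hierarchy: the
  existence of a hierarchy up to \<open>j\<close> is a Sigma^1_1 condition, and only arithmetical
  comprehension is at hand. What \<open>STP\<close> and idealisation supply is in effect Sigma^1_1
  separation, a known equivalent of ATR_0. The two classes are the pairs that some standard
  hierarchy accepts and those that some standard hierarchy rejects; uniqueness makes them disjoint.
  A set that merely separates them suffices, since whether that one set is a hierarchy up to
  \<open>j\<close> can be tested without a set quantifier. Two obstacles shape the rest. Induction
  is quantifier-free, so even elementary arithmetic in a model is restricted to functions given by
  objects of the model, and induction along the standard numbers goes through transfer. Moreover, a
  list that is standard and finite in the sense of the model may be infinite from outside, so lists
  are traversed by the recursor of the system, and their entries must be shown to be
  standard.\<close>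

instance ty :: countable by countable_datatype
instance con :: countable by countable_datatype
instance tm :: countable by countable_datatype
instance fm :: countable by countable_datatype

section \<open>Typing and substitution\<close>

lemma has_ty_unique: "has_ty \<Gamma> t \<sigma> \<Longrightarrow> has_ty \<Gamma> t \<tau> \<Longrightarrow> \<sigma> = \<tau>"
  by (induction t arbitrary: \<sigma> \<tau>) auto

lemma has_ty_append: "has_ty \<Gamma> t \<tau> \<Longrightarrow> has_ty (\<Gamma> @ \<Delta>) t \<tau>"
  by (induction t arbitrary: \<tau>) (auto simp: nth_append)

text \<open>Indices count binders from the inside, so below the binders of \<open>\<Gamma>\<close>
  the dangling index has number \<open>length \<Gamma>\<close> and its type stands last in the
  context.\<close>

lemma has_ty_inst:
  assumes "u \<Colon> \<sigma>"
  shows "has_ty (\<Gamma> @ [\<sigma>]) t \<tau> \<Longrightarrow> has_ty \<Gamma> (inst_tm (length \<Gamma>) u t) \<tau>"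
  using assms has_ty_append[of "[]" u \<sigma> \<Gamma>]
  by (induction t arbitrary: \<tau>) (auto simp: nth_append less_Suc_eq split: if_splits)

lemma wf_inst:
  assumes "u \<Colon> \<sigma>"
  shows "wf_fm (\<Gamma> @ [\<sigma>]) A \<Longrightarrow> wf_fm \<Gamma> (inst (length \<Gamma>) u A)"
proof (induction A arbitrary: \<Gamma>)
  case (All \<tau> A)
  then show ?case using All.IH[of "\<tau> # \<Gamma>"] by simp
qed (auto intro: has_ty_inst[OF assms])

lemma has_ty_close:
  "has_ty \<Gamma> t \<tau> \<Longrightarrow> has_ty (\<Gamma> @ [snd x]) (close_tm (length \<Gamma>) x t) \<tau>"
  by (induction t arbitrary: \<tau>) (auto simp: nth_append)

lemma wf_close: "wf_fm \<Gamma> A \<Longrightarrow> wf_fm (\<Gamma> @ [snd x]) (close (length \<Gamma>) x A)"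
proof (induction A arbitrary: \<Gamma>)
  case (All \<tau> A)
  then show ?case using All.IH[of "\<tau> # \<Gamma>"] by simp
qed (auto intro: has_ty_close)

lemma wff_all [simp]: "wff A \<Longrightarrow> wff (all x A)"
  using wf_close[of "[]" A x] by (simp add: all_def)

lemma wff_ex [simp]: "wff A \<Longrightarrow> wff (ex x A)"
  using wf_close[of "[]" A x] by (simp add: ex_def)

lemma wff_all_st [simp]: "wff A \<Longrightarrow> wff (all_st x A)"
  by (simp add: all_st_def)

lemma wff_ex_st [simp]: "wff A \<Longrightarrow> wff (ex_st x A)"
  by (simp add: ex_st_def)

lemma inst_tm_close:
  "has_ty \<Gamma> t \<tau> \<Longrightarrow> inst_tm (length \<Gamma>) u (close_tm (length \<Gamma>) x t) = subst_tm x u t"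
  by (induction t arbitrary: \<tau>) auto

lemma inst_close: "wf_fm \<Gamma> A \<Longrightarrow> inst (length \<Gamma>) u (close (length \<Gamma>) x A) = subst x u A"
proof (induction A arbitrary: \<Gamma>)
  case (All \<tau> A)
  then show ?case using All.IH[of "\<tau> # \<Gamma>"] by simp
qed (auto simp: inst_tm_close)

lemma subst_tm_self: "subst_tm x (Free x) t = t"
  by (induction t) auto

lemma subst_self: "subst x (Free x) A = A"
  by (induction A) (auto simp: subst_tm_self)

lemma close_inst_tm: "x \<notin> fv_tm t \<Longrightarrow> close_tm k x (inst_tm k (Free x) t) = t"
  by (induction t) auto

lemma close_inst: "x \<notin> fv A \<Longrightarrow> close k x (inst k (Free x) A) = A"
  by (induction A arbitrary: k) (auto simp: close_inst_tm)

lemma fv_close_tm: "fv_tm (close_tm k x t) = fv_tm t - {x}"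
  by (induction t) auto

lemma fv_close: "fv (close k x A) = fv A - {x}"
  by (induction A arbitrary: k) (auto simp: fv_close_tm)

lemma fv_all: "fv (all x A) = fv A - {x}"
  by (simp add: all_def fv_close)

lemma finite_fv_tm: "finite (fv_tm t)"
  by (induction t) auto

lemma finite_fv: "finite (fv A)"
  by (induction A) (auto simp: finite_fv_tm)

section \<open>Maximal consistent sets\<close>

lemma derives_wff: "derives Ax \<Gamma> A \<Longrightarrow> wff A"
proof (induction rule: derives.induct)
  case (allE H \<tau> A t)
  then show ?case using wf_inst[of t \<tau> "[]" A] by simp
qed auto

lemma proves_mp: "Ax \<turnstile> A \<^bold>\<longrightarrow> B \<Longrightarrow> Ax \<turnstile> A \<Longrightarrow> Ax \<turnstile> B"
  unfolding proves_def by (rule derives.impE)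

text \<open>With modus ponens, this formula and \<open>proves_S\<close> carry all propositional
  reasoning under a list of antecedents.\<close>

lemma proves_K: "wff A \<Longrightarrow> wff B \<Longrightarrow> Ax \<turnstile> A \<^bold>\<longrightarrow> B \<^bold>\<longrightarrow> A"
  unfolding proves_def by (intro derives.impI derives.assm) simp_all

lemma proves_S:
  assumes "wff A" "wff B" "wff C"
  shows "Ax \<turnstile> (A \<^bold>\<longrightarrow> B \<^bold>\<longrightarrow> C) \<^bold>\<longrightarrow> (A \<^bold>\<longrightarrow> B) \<^bold>\<longrightarrow> A \<^bold>\<longrightarrow> C"
proof -
  let ?H = "{A, A \<^bold>\<longrightarrow> B, A \<^bold>\<longrightarrow> B \<^bold>\<longrightarrow> C}"
  have "derives Ax ?H A" "derives Ax ?H (A \<^bold>\<longrightarrow> B)" "derives Ax ?H (A \<^bold>\<longrightarrow> B \<^bold>\<longrightarrow> C)"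
    by (rule derives.assm; simp add: assms)+
  then have "derives Ax ?H C" by (meson derives.impE)
  then show ?thesis unfolding proves_def using assms by (intro derives.impI) simp_all
qed

lemma proves_I: "wff A \<Longrightarrow> Ax \<turnstile> A \<^bold>\<longrightarrow> A"
  unfolding proves_def by (intro derives.impI derives.assm) simp_all

lemma proves_efq: "wff A \<Longrightarrow> Ax \<turnstile> Fls \<^bold>\<longrightarrow> A"
  unfolding proves_def by (rule derives.impI, simp, rule derives.raa, simp, rule derives.assm) simp_all

lemma proves_dne:
  assumes "wff A"
  shows "Ax \<turnstile> Neg (Neg A) \<^bold>\<longrightarrow> A"
proof -
  have "derives Ax {Neg A, Neg (Neg A)} Fls"
    by (rule derives.impE[of _ _ "Neg A"]; rule derives.assm; simp add: assms)
  then show ?thesis unfolding proves_def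
    using assms by (intro derives.impI derives.raa[of A]) simp_all
qed

lemma proves_spec:
  assumes "wff (All \<tau> A)" "t \<Colon> \<tau>"
  shows "Ax \<turnstile> All \<tau> A \<^bold>\<longrightarrow> inst 0 t A"
  unfolding proves_def by (rule derives.impI, fact, rule derives.allE[of _ _ \<tau>], rule derives.assm) (use assms in auto)

lemma proves_all: "Ax \<turnstile> A \<Longrightarrow> Ax \<turnstile> all x A"
  unfolding proves_def by (rule derives.allI) auto

lemma proves_all_imp:
  assumes "wff C" "wff A" "x \<notin> fv C"
  shows "Ax \<turnstile> all x (C \<^bold>\<longrightarrow> A) \<^bold>\<longrightarrow> C \<^bold>\<longrightarrow> all x A"
  unfolding proves_def
proof (rule derives.impI; (rule derives.impI)?)
  let ?P = "all x (C \<^bold>\<longrightarrow> A)"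
  have P: "wff ?P" using assms by simp
  have "inst 0 (Free x) (close 0 x (C \<^bold>\<longrightarrow> A)) = C \<^bold>\<longrightarrow> A"
    using inst_close[of "[]" "C \<^bold>\<longrightarrow> A" "Free x" x] assms by (simp add: subst_self)
  moreover have "derives Ax {C, ?P} (inst 0 (Free x) (close 0 x (C \<^bold>\<longrightarrow> A)))"
    by (rule derives.allE[of _ _ "snd x"]) (use P in \<open>auto intro: derives.assm simp: all_def\<close>)
  ultimately have "derives Ax {C, ?P} (C \<^bold>\<longrightarrow> A)" by simp
  then have "derives Ax {C, ?P} A"
    by (rule derives.impE) (auto intro: derives.assm simp: assms)
  then show "derives Ax {C, ?P} (all x A)"
    by (rule derives.allI) (use assms in \<open>auto simp: fv_all\<close>)
qed (use assms in auto)

text \<open>Hypotheses are kept as antecedents of a formula derivable from no assumptions: this gives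
  weakening at once, whereas weakening of \<open>derives\<close> itself would require renaming of
  eigenvariables.\<close>

primrec imps :: "fm list \<Rightarrow> fm \<Rightarrow> fm" where
  "imps [] A = A"
| "imps (B # \<Gamma>) A = imps \<Gamma> (B \<^bold>\<longrightarrow> A)"

lemma wff_imps: "wff (imps \<Gamma> A) \<longleftrightarrow> (\<forall>B \<in> set \<Gamma>. wff B) \<and> wff A"
  by (induction \<Gamma> arbitrary: A) auto

lemma imps_thm:
  assumes "\<forall>B \<in> set \<Gamma>. wff B"
  shows "Ax \<turnstile> A \<Longrightarrow> Ax \<turnstile> imps \<Gamma> A"
  using assms
proof (induction \<Gamma> arbitrary: A)
  case (Cons B \<Gamma>)
  have "wff A" using Cons.prems(1) derives_wff unfolding proves_def by blast
  then have "Ax \<turnstile> B \<^bold>\<longrightarrow> A" using Cons.prems proves_mp[OF proves_K] by simp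
  then show ?case using Cons by simp
qed auto

lemma imps_wffs: "Ax \<turnstile> imps \<Gamma> A \<Longrightarrow> (\<forall>B \<in> set \<Gamma>. wff B) \<and> wff A"
  using derives_wff wff_imps unfolding proves_def by blast

text \<open>The head of the list is the innermost antecedent, so the deduction theorem holds by
  definition; \<open>proves_S\<close> distributes one antecedent over the implication at each step
  of the induction.\<close>

lemma imps_mp: "Ax \<turnstile> imps \<Gamma> (A \<^bold>\<longrightarrow> B) \<Longrightarrow> Ax \<turnstile> imps \<Gamma> A \<Longrightarrow> Ax \<turnstile> imps \<Gamma> B"
proof (induction \<Gamma> arbitrary: A B)
  case (Cons C \<Gamma>)
  have w: "\<forall>B \<in> set \<Gamma>. wff B" "wff A" "wff B" "wff C"
    using imps_wffs[OF Cons.prems(1)] by simp_all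
  have "Ax \<turnstile> imps \<Gamma> ((C \<^bold>\<longrightarrow> A) \<^bold>\<longrightarrow> C \<^bold>\<longrightarrow> B)"
    using Cons.IH[OF imps_thm[OF w(1) proves_S]] Cons.prems(1) w by simp
  then show ?case using Cons.IH Cons.prems(2) by simp
qed (auto intro: proves_mp)

lemma imps_thm_mp:
  "Ax \<turnstile> A \<^bold>\<longrightarrow> B \<Longrightarrow> Ax \<turnstile> imps \<Gamma> A \<Longrightarrow> Ax \<turnstile> imps \<Gamma> B"
  using imps_mp imps_thm imps_wffs by blast

lemma imps_hyp:
  "A \<in> set \<Gamma> \<Longrightarrow> \<forall>B \<in> set \<Gamma>. wff B \<Longrightarrow> Ax \<turnstile> imps \<Gamma> A"
proof (induction \<Gamma>)
  case (Cons B \<Gamma>)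
  show ?case
  proof (cases "A = B")
    case True
    then show ?thesis using imps_thm[of \<Gamma> Ax "A \<^bold>\<longrightarrow> A"] proves_I Cons.prems by simp
  next
    case False
    then have "Ax \<turnstile> imps \<Gamma> A" using Cons by simp
    then show ?thesis
      using imps_thm_mp[OF proves_K[of A B]] Cons.prems imps_wffs by simp
  qed
qed auto

text \<open>Only the underlying sets are compared, so this is weakening, exchange and contraction at
  once.\<close>

lemma imps_mono:
  "Ax \<turnstile> imps \<Gamma> A \<Longrightarrow> set \<Gamma> \<subseteq> set \<Delta> \<Longrightarrow> \<forall>B \<in> set \<Delta>. wff B \<Longrightarrow> Ax \<turnstile> imps \<Delta> A"
proof (induction \<Gamma> arbitrary: A)
  case (Cons B \<Gamma>)
  then show ?case using imps_mp[of Ax \<Delta> B A] imps_hyp[of B \<Delta>] by simp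
qed (auto intro: imps_thm)

lemma imps_gen:
  "Ax \<turnstile> imps \<Gamma> A \<Longrightarrow> \<forall>B \<in> set \<Gamma>. x \<notin> fv B \<Longrightarrow> Ax \<turnstile> imps \<Gamma> (all x A)"
proof (induction \<Gamma> arbitrary: A)
  case (Cons B \<Gamma>)
  then have "Ax \<turnstile> imps \<Gamma> (all x (B \<^bold>\<longrightarrow> A))" by simp
  moreover have "Ax \<turnstile> all x (B \<^bold>\<longrightarrow> A) \<^bold>\<longrightarrow> B \<^bold>\<longrightarrow> all x A"
    using proves_all_imp Cons.prems imps_wffs[of Ax "B # \<Gamma>" A] by simp
  ultimately show ?case using imps_thm_mp by simp
qed (auto intro: proves_all)

section \<open>Consistent lists and their extension\<close>

definition consistent :: "fm set \<Rightarrow> fm list \<Rightarrow> bool" where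
  "consistent Ax \<Gamma> \<longleftrightarrow> (\<forall>B \<in> set \<Gamma>. wff B) \<and> \<not> (Ax \<turnstile> imps \<Gamma> Fls)"

text \<open>The second conjunct is the Henkin property. Witnesses are variables and not new
  constants, which is possible because every stage is a finite list and leaves fresh variables of
  each type.\<close>

definition decides :: "fm set \<Rightarrow> fm list \<Rightarrow> fm \<Rightarrow> bool" where
  "decides Ax \<Gamma> A \<longleftrightarrow> (A \<in> set \<Gamma> \<or> \<not> consistent Ax (A # \<Gamma>)) \<and>
     (\<forall>\<tau> B. A \<in> set \<Gamma> \<longrightarrow> A = Neg (All \<tau> B) \<longrightarrow> (\<exists>x. snd x = \<tau> \<and> Neg (inst 0 (Free x) B) \<in> set \<Gamma>))"

lemma fresh_var: "finite V \<Longrightarrow> \<exists>x :: var. snd x = \<tau> \<and> x \<notin> V"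
proof -
  assume "finite V"
  then have "finite (fst ` V)" by simp
  then obtain n where "n \<notin> fst ` V" using ex_new_if_finite infinite_UNIV_nat by metis
  then show ?thesis by (intro exI[of _ "(n, \<tau>)"]) force
qed

text \<open>If the added formula were refutable, the instance itself would follow from
  \<open>\<Gamma>\<close>; as \<open>x\<close> is fresh, it could be generalised to
  \<open>All \<tau> B\<close>, which \<open>\<Gamma>\<close> denies.\<close>

lemma consistent_witness:
  assumes "consistent Ax \<Gamma>" "Neg (All \<tau> B) \<in> set \<Gamma>" "\<forall>C \<in> set \<Gamma>. x \<notin> fv C" "snd x = \<tau>"
  shows "consistent Ax (Neg (inst 0 (Free x) B) # \<Gamma>)"
proof -
  have w: "\<forall>C \<in> set \<Gamma>. wff C" using assms(1) consistent_def by blast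
  with assms(2) have wB: "wff (All \<tau> B)" by fastforce
  then have wi: "wff (inst 0 (Free x) B)" using wf_inst[of "Free x" \<tau> "[]" B] assms(4) by simp
  have "Ax \<turnstile> imps \<Gamma> Fls" if "Ax \<turnstile> imps \<Gamma> (Neg (Neg (inst 0 (Free x) B)))"
  proof -
    have "Ax \<turnstile> imps \<Gamma> (all x (inst 0 (Free x) B))"
      using imps_gen imps_thm_mp[OF proves_dne[OF wi] that] assms(3) by blast
    moreover have "all x (inst 0 (Free x) B) = All \<tau> B"
      using assms by (auto simp: all_def intro!: close_inst)
    ultimately show ?thesis using imps_mp[OF imps_hyp[OF assms(2) w]] by simp
  qed
  then show ?thesis using assms(1) w wi by (auto simp: consistent_def)
qed

lemma decide_step:
  assumes "consistent Ax \<Gamma>"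
  shows "\<exists>\<Gamma>'. consistent Ax \<Gamma>' \<and> set \<Gamma> \<subseteq> set \<Gamma>' \<and> decides Ax \<Gamma>' A"
proof (cases "consistent Ax (A # \<Gamma>)")
  case False
  show ?thesis
  proof (cases "A \<in> set \<Gamma>")
    case True
    then have "set (A # \<Gamma>) = set \<Gamma>" "\<forall>B \<in> set \<Gamma>. wff B"
      using assms unfolding consistent_def by auto
    then have "consistent Ax (A # \<Gamma>)"
      using assms imps_mono[of Ax "A # \<Gamma>" Fls \<Gamma>] unfolding consistent_def by auto
    then show ?thesis using False by blast
  next
    case False2: False
    then show ?thesis using assms False by (auto simp: decides_def)
  qed
next
  case True
  show ?thesis
  proof (cases "\<exists>\<tau> B. A = Neg (All \<tau> B)")
    case False
    then show ?thesis using True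
      by (intro exI[of _ "A # \<Gamma>"]) (auto simp: decides_def)
  next
    case T: True
    then obtain \<tau> B where A: "A = Neg (All \<tau> B)" by blast
    obtain x where x: "snd x = \<tau>" "x \<notin> (\<Union>C \<in> set (A # \<Gamma>). fv C)"
      using fresh_var[of "\<Union>C \<in> set (A # \<Gamma>). fv C" \<tau>] finite_fv by auto
    let ?\<Delta> = "Neg (inst 0 (Free x) B) # A # \<Gamma>"
    have "consistent Ax ?\<Delta>"
      using consistent_witness[OF True, of \<tau> B x] A x by auto
    moreover have "\<exists>y. snd y = \<tau> \<and> Neg (inst 0 (Free y) B) \<in> set ?\<Delta>"
      using x(1) by (intro exI[of _ x]) simp
    then have "decides Ax ?\<Delta> A"
      unfolding decides_def using A by simp
    ultimately show ?thesis by (intro exI[of _ ?\<Delta>]) auto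
  qed
qed

text \<open>Exactly the clauses that the truth lemma for the term model consumes. The terms in
  \<open>All_iff\<close> may contain free variables, which are the Henkin witnesses.\<close>

locale henkin_set =
  fixes Ax M :: "fm set"
  assumes proved: "Ax \<turnstile> A \<Longrightarrow> A \<in> M"
    and imp_iff: "wff A \<Longrightarrow> wff B \<Longrightarrow> A \<^bold>\<longrightarrow> B \<in> M \<longleftrightarrow> (A \<in> M \<longrightarrow> B \<in> M)"
    and Fls: "Fls \<notin> M"
    and All_iff: "wff (All \<tau> A) \<Longrightarrow> All \<tau> A \<in> M \<longleftrightarrow> (\<forall>t. t \<Colon> \<tau> \<longrightarrow> inst 0 t A \<in> M)"

theorem henkin:
  assumes "\<not> (Ax \<turnstile> A)" "wff A"
  obtains M where "henkin_set Ax M" "A \<notin> M"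
proof -
  have start: "consistent Ax [Neg A]"
    using assms proves_mp[OF proves_dne] by (auto simp: consistent_def)
  \<comment> \<open>Stage \<open>Suc n\<close> decides the formula with code \<open>n\<close>; the
    clause for \<open>n = 0\<close> only fixes the starting list.\<close>
  have "\<exists>G. \<forall>n. (consistent Ax (G n) \<and> (n = 0 \<longrightarrow> set [Neg A] \<subseteq> set (G n))) \<and>
      (set (G n) \<subseteq> set (G (Suc n)) \<and> decides Ax (G (Suc n)) (from_nat n))"
    using start decide_step by (intro dependent_nat_choice) auto
  then obtain G where G: "\<And>n. consistent Ax (G n)" "Neg A \<in> set (G 0)"
    "\<And>n. set (G n) \<subseteq> set (G (Suc n))" "\<And>n. decides Ax (G (Suc n)) (from_nat n)"
    by (metis list.set_intros(1) subsetD)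
  have mono: "m \<le> n \<Longrightarrow> set (G m) \<subseteq> set (G n)" for m n
    using lift_Suc_mono_le[of "\<lambda>n. set (G n)"] G(3) by blast
  define M where "M = (\<Union>n. set (G n))"
  have wff: "\<forall>B \<in> set (G n). wff B" for n using G(1) consistent_def by blast
  have incons: "False" if "Ax \<turnstile> imps (G m) B" "Ax \<turnstile> imps (G n) (Neg B)" for m n B
  proof -
    have "Ax \<turnstile> imps (G (max m n)) B" "Ax \<turnstile> imps (G (max m n)) (Neg B)"
      using that imps_mono mono wff by (meson max.cobounded1 max.cobounded2)+
    then show False using imps_mp G(1) consistent_def by blast
  qed
  have refuted: "\<exists>n. Ax \<turnstile> imps (G n) (Neg B)" if "B \<notin> M" "wff B" for B
  proof -
    obtain n where "B = from_nat n" by (metis from_nat_to_nat)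
    then have "\<not> consistent Ax (B # G (Suc n))"
      using that G(4)[of n] unfolding M_def decides_def by auto
    then show ?thesis using wff that by (auto simp: consistent_def)
  qed
  have closed: "B \<in> M" if "Ax \<turnstile> imps (G n) B" for B n
    using that incons refuted imps_wffs by blast
  have hyp: "\<exists>n. Ax \<turnstile> imps (G n) B" if "B \<in> M" for B
    using that imps_hyp wff unfolding M_def by blast
  have closed1: "C \<in> M" if "B \<in> M" "Ax \<turnstile> B \<^bold>\<longrightarrow> C" for B C
    using that hyp closed imps_thm_mp by blast
  have mp: "C \<in> M" if BC: "B \<^bold>\<longrightarrow> C \<in> M" and B: "B \<in> M" for B C
  proof -
    obtain m n where mn: "B \<^bold>\<longrightarrow> C \<in> set (G m)" "B \<in> set (G n)" using BC B M_def by blast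
    then have "B \<^bold>\<longrightarrow> C \<in> set (G (max m n))" "B \<in> set (G (max m n))"
      using mono by (meson max.cobounded1 max.cobounded2 subsetD)+
    then show ?thesis using closed imps_mp imps_hyp wff by blast
  qed
  have neg: "Neg B \<in> M" if "B \<notin> M" "wff B" for B using that refuted closed by blast
  have Fls: "Fls \<notin> M"
    using hyp[of Fls] G(1) unfolding consistent_def by blast
  have "henkin_set Ax M"
  proof
    show "B \<in> M" if "Ax \<turnstile> B" for B
      using that closed imps_thm wff by blast
    show "Fls \<notin> M" by fact
    show "B \<^bold>\<longrightarrow> C \<in> M \<longleftrightarrow> (B \<in> M \<longrightarrow> C \<in> M)" if w: "wff B" "wff C" for B C
    proof (intro iffI)
      assume a: "B \<in> M \<longrightarrow> C \<in> M"
      show "B \<^bold>\<longrightarrow> C \<in> M"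
      proof (cases "B \<in> M")
        case True
        then show ?thesis using a closed1 proves_K w by blast
      next
        case False
        have "Ax \<turnstile> Neg B \<^bold>\<longrightarrow> B \<^bold>\<longrightarrow> C"
          using imps_thm_mp[OF proves_efq[of C Ax], of "[B, Neg B]"] imps_mp[of Ax "[B, Neg B]" B Fls]
            imps_hyp[of B "[B, Neg B]"] imps_hyp[of "Neg B" "[B, Neg B]"] w by simp
        then show ?thesis using closed1 neg False w by blast
      qed
    qed (use mp in blast)
    show "All \<tau> B \<in> M \<longleftrightarrow> (\<forall>t. t \<Colon> \<tau> \<longrightarrow> inst 0 t B \<in> M)" if w: "wff (All \<tau> B)" for \<tau> B
    proof (intro iffI)
      assume a: "\<forall>t. t \<Colon> \<tau> \<longrightarrow> inst 0 t B \<in> M"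
      show "All \<tau> B \<in> M"
      proof (rule ccontr)
        let ?N = "Neg (All \<tau> B)"
        assume "All \<tau> B \<notin> M"
        then have N: "?N \<in> M" using neg w by blast
        obtain n where n: "?N = from_nat n" by (metis from_nat_to_nat)
        \<comment> \<open>A witness is promised only at the stage that decides \<open>?N\<close>, so
          it is not enough that \<open>?N\<close> enters \<open>M\<close> at some stage: it has to
          be present at this one.\<close>
        have "?N \<in> set (G (Suc n))"
        proof (rule ccontr)
          assume "?N \<notin> set (G (Suc n))"
          then have "Ax \<turnstile> imps (G (Suc n)) (Neg ?N)"
            using G(4)[of n] n[symmetric] wff w unfolding decides_def consistent_def by auto
          then show False using hyp[OF N] incons by blast
        qed
        then obtain x where x: "snd x = \<tau>" "Neg (inst 0 (Free x) B) \<in> set (G (Suc n))"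
          using G(4)[of n] n unfolding decides_def by metis
        then have "Neg (inst 0 (Free x) B) \<in> M" unfolding M_def by blast
        moreover have "inst 0 (Free x) B \<in> M" using a x by simp
        ultimately show False using mp Fls by blast
      qed
    qed (use closed1 proves_spec w in blast)
  qed
  moreover have "A \<notin> M" using G(2) mp Fls unfolding M_def by blast
  ultimately show ?thesis using that by blast
qed

section \<open>Combinatory abstraction\<close>

lemma ty_of_eq: "t \<Colon> \<tau> \<Longrightarrow> ty_of t = \<tau>"
  by (induction t arbitrary: \<tau>) (fastforce split: ty.splits)+

lemma has_ty_lam [simp]: "lam x t \<Colon> \<rho> \<longleftrightarrow> (\<exists>\<tau>. \<rho> = snd x \<Rrightarrow> \<tau> \<and> t \<Colon> \<tau>)"
proof (induction t arbitrary: \<rho>)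
  case (App s t)
  then show ?case using ty_of_eq[of t] ty_of_eq[of "s \<cdot> t"] ty_of_eq[of s] by auto
qed (auto simp: comb_I_def)

lemma fv_lam [simp]: "fv_tm (lam x t) = fv_tm t - {x}"
  by (induction t) (auto simp: comb_I_def)

declare lam.simps [simp del]

lemma arith_terms_typed [simp]:
  "plus_tm \<Colon> \<tau> \<longleftrightarrow> \<tau> = N \<Rrightarrow> N \<Rrightarrow> N" "times_tm \<Colon> \<tau> \<longleftrightarrow> \<tau> = N \<Rrightarrow> N \<Rrightarrow> N"
  "pred_tm \<Colon> \<tau> \<longleftrightarrow> \<tau> = N \<Rrightarrow> N" "monus_tm \<Colon> \<tau> \<longleftrightarrow> \<tau> = N \<Rrightarrow> N \<Rrightarrow> N"
  unfolding plus_tm_def times_tm_def pred_tm_def monus_tm_def Let_def by auto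

lemma arith_terms_closed [simp]:
  "fv_tm plus_tm = {}" "fv_tm times_tm = {}" "fv_tm pred_tm = {}" "fv_tm monus_tm = {}"
  unfolding plus_tm_def times_tm_def pred_tm_def monus_tm_def Let_def by auto

section \<open>Lifting and instantiation of the defined formulas\<close>

lemma zero_tm_typed: "zero_tm \<tau> \<Colon> \<tau>"
  by (induction \<tau>) auto

lemma lift_closed: "t \<Colon> \<tau> \<Longrightarrow> lift t = t"
  by (induction t arbitrary: \<tau>) auto

lemma inst_tm_closed: "t \<Colon> \<tau> \<Longrightarrow> inst_tm k u t = t"
  by (induction t arbitrary: \<tau>) auto

lemma has_ty_lift: "has_ty \<Gamma> t \<tau> \<Longrightarrow> has_ty (\<sigma> # \<Gamma>) (lift t) \<tau>"
  by (induction t arbitrary: \<tau>) auto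

lemma has_ty_closed: "t \<Colon> \<tau> \<Longrightarrow> has_ty \<Gamma> t \<tau>"
  using has_ty_append[of "[]"] by simp

lemma has_ty_App: "s \<Colon> \<sigma> \<Rrightarrow> \<tau> \<Longrightarrow> t \<Colon> \<sigma> \<Longrightarrow> s \<cdot> t \<Colon> \<tau>"
  by auto

lemma wf_lt [simp]: "has_ty \<Gamma> s N \<Longrightarrow> has_ty \<Gamma> t N \<Longrightarrow> wf_fm \<Gamma> (lt s t)"
  using has_ty_closed[of monus_tm "N \<Rrightarrow> N \<Rrightarrow> N" \<Gamma>] by (auto simp: lt_def le_def)

lemma wf_le [simp]: "has_ty \<Gamma> s N \<Longrightarrow> has_ty \<Gamma> t N \<Longrightarrow> wf_fm \<Gamma> (le s t)"
  using has_ty_closed[of monus_tm "N \<Rrightarrow> N \<Rrightarrow> N" \<Gamma>] by (auto simp: lt_def le_def)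

lemma wf_eq [simp]: "has_ty \<Gamma> s \<tau> \<Longrightarrow> has_ty \<Gamma> t \<tau> \<Longrightarrow> wf_fm \<Gamma> (eq \<tau> s t)"
  by (induction \<tau> arbitrary: \<Gamma> s t) (auto simp: has_ty_lift intro!: wf_lt)

lemma inst_tm_lift: "a \<Colon> \<sigma> \<Longrightarrow> inst_tm (Suc k) a (lift t) = lift (inst_tm k a t)"
  by (induction t) (auto simp: lift_closed)

lemma inst_lt: "a \<Colon> \<sigma> \<Longrightarrow> inst k a (lt s t) = lt (inst_tm k a s) (inst_tm k a t)"
  using inst_tm_closed[of monus_tm] by (simp add: lt_def le_def)

lemma inst_eq: "a \<Colon> \<sigma> \<Longrightarrow> inst k a (eq \<tau> s t) = eq \<tau> (inst_tm k a s) (inst_tm k a t)"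
  by (induction \<tau> arbitrary: k s t) (auto simp: inst_tm_lift inst_lt)

section \<open>Semantics\<close>

text \<open>A general structure in Henkin's sense: function types need not contain all functions,
  and one carrier holds the objects of all types because the types are syntax.\<close>

locale frame =
  fixes U :: "ty \<Rightarrow> 'd set" and ap :: "'d \<Rightarrow> 'd \<Rightarrow> 'd" (infixl "\<odot>" 90)
    and cst :: "con \<Rightarrow> 'd" and st :: "'d \<Rightarrow> bool"
begin

primrec val :: "'d list \<Rightarrow> (var \<Rightarrow> 'd) \<Rightarrow> tm \<Rightarrow> 'd" where
  "val bs e (Free x) = e x"
| "val bs e (Bnd k) = bs ! k"
| "val bs e (Con c) = cst c"
| "val bs e (s \<cdot> t) = val bs e s \<odot> val bs e t"

primrec sem :: "'d list \<Rightarrow> (var \<Rightarrow> 'd) \<Rightarrow> fm \<Rightarrow> bool" where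
  "sem bs e (Eq s t) \<longleftrightarrow> val bs e s = val bs e t"
| "sem bs e (St t) \<longleftrightarrow> st (val bs e t)"
| "sem bs e Fls \<longleftrightarrow> False"
| "sem bs e (A \<^bold>\<longrightarrow> B) \<longleftrightarrow> (sem bs e A \<longrightarrow> sem bs e B)"
| "sem bs e (All \<tau> A) \<longleftrightarrow> (\<forall>d \<in> U \<tau>. sem (d # bs) e A)"

definition env :: "(var \<Rightarrow> 'd) \<Rightarrow> bool" where "env e \<longleftrightarrow> (\<forall>x. e x \<in> U (snd x))"

lemma env_upd [simp]: "env e \<Longrightarrow> d \<in> U (snd x) \<Longrightarrow> env (e(x := d))"
  unfolding env_def by auto

lemma val_cong: "(\<And>x. x \<in> fv_tm t \<Longrightarrow> e x = e' x) \<Longrightarrow> val bs e t = val bs e' t"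
  by (induction t) auto

lemma sem_cong: "(\<And>x. x \<in> fv A \<Longrightarrow> e x = e' x) \<Longrightarrow> sem bs e A = sem bs e' A"
proof (induction A arbitrary: bs)
  case (Eq s t)
  then show ?case using val_cong[of s e e' bs] val_cong[of t e e' bs] by simp
next
  case (St t)
  then show ?case using val_cong[of t e e' bs] by simp
qed auto

lemma val_append: "has_ty \<Gamma> t \<tau> \<Longrightarrow> length bs = length \<Gamma> \<Longrightarrow> val (bs @ cs) e t = val bs e t"
  by (induction t arbitrary: \<tau>) (auto simp: nth_append)

lemma val_closed: "t \<Colon> \<tau> \<Longrightarrow> val bs e t = val [] e t"
  using val_append[of "[]" t \<tau> "[]" bs] by simp

lemma val_lift: "val (d # bs) e (lift t) = val bs e t"
  by (induction t) auto

lemma val_close: "has_ty \<Gamma> t \<tau> \<Longrightarrow> length bs = length \<Gamma> \<Longrightarrow>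
  val (bs @ [d]) e (close_tm (length \<Gamma>) x t) = val bs (e(x := d)) t"
  by (induction t arbitrary: \<tau>) (auto simp: nth_append)

lemma sem_close: "wf_fm \<Gamma> A \<Longrightarrow> length bs = length \<Gamma> \<Longrightarrow>
  sem (bs @ [d]) e (close (length \<Gamma>) x A) = sem bs (e(x := d)) A"
proof (induction A arbitrary: \<Gamma> bs)
  case (All \<tau> A)
  then show ?case using All.IH[of "\<tau> # \<Gamma>" "_ # bs"] by simp
qed (auto simp: val_close)

lemma sem_all [simp]:
  "wff A \<Longrightarrow> sem [] e (all x A) \<longleftrightarrow> (\<forall>d \<in> U (snd x). sem [] (e(x := d)) A)"
  using sem_close[of "[]" A "[]"] by (simp add: all_def)

lemma sem_ex [simp]:
  "wff A \<Longrightarrow> sem [] e (ex x A) \<longleftrightarrow> (\<exists>d \<in> U (snd x). sem [] (e(x := d)) A)"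
  using sem_close[of "[]" A "[]"] by (simp add: ex_def)

lemma sem_all_st [simp]: "wff A \<Longrightarrow>
  sem [] e (all_st x A) \<longleftrightarrow> (\<forall>d \<in> U (snd x). st d \<longrightarrow> sem [] (e(x := d)) A)"
  by (simp add: all_st_def)

lemma sem_ex_st [simp]: "wff A \<Longrightarrow>
  sem [] e (ex_st x A) \<longleftrightarrow> (\<exists>d \<in> U (snd x). st d \<and> sem [] (e(x := d)) A)"
  by (simp add: ex_st_def)

lemma val_inst:
  assumes "has_ty (\<Gamma> @ [\<sigma>]) t \<tau>" "length bs = length \<Gamma>" "u \<Colon> \<sigma>"
  shows "val bs e (inst_tm (length \<Gamma>) u t) = val (bs @ [val [] e u]) e t"
proof -
  have "val bs e u = val [] e u" using val_closed assms(3) by blast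
  then show ?thesis using assms(1,2) by (induction t arbitrary: \<tau>) (auto simp: nth_append)
qed

lemma sem_inst: "wf_fm (\<Gamma> @ [\<sigma>]) A \<Longrightarrow> length bs = length \<Gamma> \<Longrightarrow> u \<Colon> \<sigma> \<Longrightarrow>
  sem bs e (inst (length \<Gamma>) u A) = sem (bs @ [val [] e u]) e A"
proof (induction A arbitrary: \<Gamma> bs)
  case (All \<tau> A)
  then show ?case using All.IH[of "\<tau> # \<Gamma>" "_ # bs"] by simp
qed (auto simp: val_inst)

lemma sem_lt_cong:
  assumes "val bs e s = val bs' e' s'" "val bs e t = val bs' e' t'"
  shows "sem bs e (lt s t) = sem bs' e' (lt s' t')"
  using assms val_cong[of monus_tm e e' bs] val_closed[of monus_tm "N \<Rrightarrow> N \<Rrightarrow> N" bs e']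
    val_closed[of monus_tm "N \<Rrightarrow> N \<Rrightarrow> N" bs' e'] by (simp add: lt_def le_def)

text \<open>The defined equality is a formula about terms. Knowing that only the values of the two
  terms matter allows them to be exchanged for variables or for representatives.\<close>

lemma sem_eq_cong:
  "val bs e s = val bs' e' s' \<Longrightarrow> val bs e t = val bs' e' t' \<Longrightarrow>
   sem bs e (eq \<tau> s t) = sem bs' e' (eq \<tau> s' t')"
proof (induction \<tau> arbitrary: bs bs' s s' t t')
  case (Fun \<sigma> \<tau>)
  show ?case unfolding eq.simps sem.simps
    by (intro ball_cong refl Fun.IH(2)) (simp_all add: val_lift Fun.prems)
next
  case (Seq \<sigma>)
  have "sem (d # bs) e (eq \<sigma> (entry \<sigma> (lift s) (Bnd 0)) (entry \<sigma> (lift t) (Bnd 0))) =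
    sem (d # bs') e' (eq \<sigma> (entry \<sigma> (lift s') (Bnd 0)) (entry \<sigma> (lift t') (Bnd 0)))" for d
    by (rule Seq.IH) (simp_all add: val_lift Seq.prems)
  moreover have "sem (d # bs) e (lt (Bnd 0) (len \<sigma> (lift s))) =
    sem (d # bs') e' (lt (Bnd 0) (len \<sigma> (lift s')))" for d
    by (rule sem_lt_cong) (simp_all add: val_lift Seq.prems)
  ultimately show ?case by (simp add: Seq.prems)
qed simp

end

locale typed_frame = frame +
  assumes ap_in: "f \<in> U (\<sigma> \<Rrightarrow> \<tau>) \<Longrightarrow> a \<in> U \<sigma> \<Longrightarrow> f \<odot> a \<in> U \<tau>"
    and cst_in: "cst c \<in> U (con_ty c)"
begin

lemma val_in: "t \<Colon> \<tau> \<Longrightarrow> env e \<Longrightarrow> val [] e t \<in> U \<tau>"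
  by (induction t arbitrary: \<tau>) (auto simp: env_def cst_in intro: ap_in)

end

locale model = typed_frame U ap cst st
  for U :: "ty \<Rightarrow> 'd set" and ap (infixl "\<odot>" 90) and cst and st +
  fixes Ax :: "fm set"
  assumes eq_val: "env e \<Longrightarrow> s \<Colon> \<tau> \<Longrightarrow> t \<Colon> \<tau> \<Longrightarrow> sem [] e (eq \<tau> s t) \<Longrightarrow> val [] e s = val [] e t"
    and valid: "A \<in> Ax \<Longrightarrow> wff A \<Longrightarrow> env e \<Longrightarrow> sem [] e A"

section \<open>The term model\<close>

text \<open>Measure for the truth lemma: an instance of the body of a quantifier is no subformula,
  but instantiation leaves this number unchanged.\<close>

primrec depth :: "fm \<Rightarrow> nat" where
  "depth (Eq s t) = 0"
| "depth (St t) = 0"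
| "depth Fls = 0"
| "depth (A \<^bold>\<longrightarrow> B) = Suc (max (depth A) (depth B))"
| "depth (All \<tau> A) = Suc (depth A)"

lemma depth_inst: "depth (inst k u A) = depth A"
  by (induction A arbitrary: k) auto

locale term_model = henkin_set +
  assumes P0: "P0 \<subseteq> Ax"
begin

lemma axiom: "A \<in> Ax \<Longrightarrow> wff A \<Longrightarrow> A \<in> M"
  using proved derives.ax unfolding proves_def by blast

lemma e_pra_axiom: "A \<in> E_PRA \<Longrightarrow> wff A \<Longrightarrow> A \<in> M"
  using axiom P0 P0.e_pra by blast

lemma mp: "A \<^bold>\<longrightarrow> B \<in> M \<Longrightarrow> A \<in> M \<Longrightarrow> wff A \<Longrightarrow> wff B \<Longrightarrow> B \<in> M"
  using imp_iff by blast

lemma conj_iff: "wff A \<Longrightarrow> wff B \<Longrightarrow> A \<^bold>\<and> B \<in> M \<longleftrightarrow> A \<in> M \<and> B \<in> M"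
  using imp_iff Fls by simp

lemma eq_Fun_iff:
  assumes "s \<Colon> \<sigma> \<Rrightarrow> \<tau>" "t \<Colon> \<sigma> \<Rrightarrow> \<tau>"
  shows "eq (\<sigma> \<Rrightarrow> \<tau>) s t \<in> M \<longleftrightarrow> (\<forall>a. a \<Colon> \<sigma> \<longrightarrow> eq \<tau> (s \<cdot> a) (t \<cdot> a) \<in> M)"
proof -
  have "wff (eq (\<sigma> \<Rrightarrow> \<tau>) s t)" using assms by (rule wf_eq)
  then show ?thesis using assms
    by (simp add: All_iff inst_eq lift_closed[OF assms(1)] lift_closed[OF assms(2)]
        inst_tm_closed[OF assms(1)] inst_tm_closed[OF assms(2)])
qed

lemma eq_Seq_iff:
  assumes "s \<Colon> Seq \<sigma>" "t \<Colon> Seq \<sigma>"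
  shows "eq (Seq \<sigma>) s t \<in> M \<longleftrightarrow> Eq (len \<sigma> s) (len \<sigma> t) \<in> M \<and>
    (\<forall>i. i \<Colon> N \<longrightarrow> lt i (len \<sigma> s) \<in> M \<longrightarrow> eq \<sigma> (entry \<sigma> s i) (entry \<sigma> t i) \<in> M)"
proof -
  let ?B = "All N (lt (Bnd 0) (len \<sigma> s) \<^bold>\<longrightarrow> eq \<sigma> (entry \<sigma> s (Bnd 0)) (entry \<sigma> t (Bnd 0)))"
  have w: "wff ?B" "wff (Eq (len \<sigma> s) (len \<sigma> t))"
    using assms has_ty_closed[OF assms(1)] has_ty_closed[OF assms(2)] by (auto intro!: wf_lt wf_eq)
  have "?B \<in> M \<longleftrightarrow>
    (\<forall>i. i \<Colon> N \<longrightarrow> lt i (len \<sigma> s) \<in> M \<longrightarrow> eq \<sigma> (entry \<sigma> s i) (entry \<sigma> t i) \<in> M)"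
    using assms by (simp add: All_iff[OF w(1)] inst_eq inst_lt inst_tm_closed[OF assms(1)]
        inst_tm_closed[OF assms(2)] imp_iff)
  then show ?thesis
    using conj_iff[OF w(2,1)] by (simp add: lift_closed[OF assms(1)] lift_closed[OF assms(2)])
qed

lemma Eq_trans: "Eq r s \<in> M \<Longrightarrow> Eq s t \<in> M \<Longrightarrow> r \<Colon> N \<Longrightarrow> s \<Colon> N \<Longrightarrow> t \<Colon> N \<Longrightarrow> Eq r t \<in> M"
  using e_pra_axiom[OF E_PRA.trans[of r s t]] by (simp add: imp_iff)

lemma Eq_sym: "Eq s t \<in> M \<Longrightarrow> s \<Colon> N \<Longrightarrow> t \<Colon> N \<Longrightarrow> Eq t s \<in> M"
  using e_pra_axiom[OF E_PRA.sym[of s t]] by (simp add: imp_iff)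

text \<open>The extensionality axiom for the function \<open>monus_tm \<cdot> suc i\<close> replaces
  the bound by an equal one. Symmetry and transitivity at sequence types need this to carry an index
  from one list to another of equal length.\<close>

lemma lt_cong:
  assumes "Eq s t \<in> M" "lt i s \<in> M" "s \<Colon> N" "t \<Colon> N" "i \<Colon> N"
  shows "lt i t \<in> M"
proof -
  let ?r = "monus_tm \<cdot> suc i"
  have "(eq N s t \<^bold>\<longrightarrow> eq N (?r \<cdot> s) (?r \<cdot> t)) \<in> M"
    using assms by (intro e_pra_axiom E_PRA.ext) auto
  then have r: "Eq (?r \<cdot> s) (?r \<cdot> t) \<in> M" using assms by (simp add: imp_iff)
  have ty: "?r \<cdot> s \<Colon> N" "?r \<cdot> t \<Colon> N" "zero \<Colon> N" using assms by auto
  from Eq_trans[OF Eq_sym[OF r ty(1,2)] _ ty(2,1,3)] show ?thesis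
    using assms(2) unfolding lt_def le_def by blast
qed

text \<open>The axioms give the laws of equality at type 0 only. At other types they are obtained by
  induction on the type, since membership of an equation in \<open>M\<close> unfolds pointwise
  (\<open>eq_Fun_iff\<close>, \<open>eq_Seq_iff\<close>).\<close>

lemma eq_refl: "t \<Colon> \<tau> \<Longrightarrow> eq \<tau> t t \<in> M"
proof (induction \<tau> arbitrary: t)
  case N
  then show ?case using e_pra_axiom[OF E_PRA.refl[of t]] by simp
next
  case (Fun \<sigma> \<tau>)
  then have "eq \<tau> (t \<cdot> a) (t \<cdot> a) \<in> M" if "a \<Colon> \<sigma>" for a using that has_ty_App by blast
  then show ?case using eq_Fun_iff Fun.prems by blast
next
  case (Seq \<sigma>)
  have "Eq (len \<sigma> t) (len \<sigma> t) \<in> M"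
    using e_pra_axiom[OF E_PRA.refl[of "len \<sigma> t"]] Seq.prems by simp
  then show ?case using eq_Seq_iff[OF Seq.prems Seq.prems] Seq by simp
qed

lemma eq_sym: "eq \<tau> s t \<in> M \<Longrightarrow> s \<Colon> \<tau> \<Longrightarrow> t \<Colon> \<tau> \<Longrightarrow> eq \<tau> t s \<in> M"
proof (induction \<tau> arbitrary: s t)
  case (Fun \<sigma> \<tau>)
  then have "eq \<tau> (t \<cdot> a) (s \<cdot> a) \<in> M" if "a \<Colon> \<sigma>" for a
    using that eq_Fun_iff has_ty_App by meson
  then show ?case using eq_Fun_iff Fun.prems by blast
next
  case (Seq \<sigma>)
  then have l: "Eq (len \<sigma> s) (len \<sigma> t) \<in> M" using eq_Seq_iff by blast
  then have l': "Eq (len \<sigma> t) (len \<sigma> s) \<in> M" using Eq_sym Seq.prems by simp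
  have "eq \<sigma> (entry \<sigma> t i) (entry \<sigma> s i) \<in> M" if "i \<Colon> N" "lt i (len \<sigma> t) \<in> M" for i
    using that Seq lt_cong[OF l'] eq_Seq_iff[of s \<sigma> t] by simp
  then show ?case using eq_Seq_iff Seq.prems l' by blast
qed (use Eq_sym in auto)

lemma eq_trans: "eq \<tau> r s \<in> M \<Longrightarrow> eq \<tau> s t \<in> M \<Longrightarrow> r \<Colon> \<tau> \<Longrightarrow> s \<Colon> \<tau> \<Longrightarrow> t \<Colon> \<tau> \<Longrightarrow> eq \<tau> r t \<in> M"
proof (induction \<tau> arbitrary: r s t)
  case (Fun \<sigma> \<tau>)
  have "eq \<tau> (r \<cdot> a) (t \<cdot> a) \<in> M" if "a \<Colon> \<sigma>" for a
    by (rule Fun.IH(2)[of _ "s \<cdot> a"])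
      (use that Fun.prems eq_Fun_iff[of r \<sigma> \<tau> s] eq_Fun_iff[of s \<sigma> \<tau> t] in auto)
  then show ?case using eq_Fun_iff Fun.prems by blast
next
  case (Seq \<sigma>)
  have l: "Eq (len \<sigma> r) (len \<sigma> s) \<in> M" "Eq (len \<sigma> s) (len \<sigma> t) \<in> M"
    using Seq.prems eq_Seq_iff by blast+
  then have l': "Eq (len \<sigma> r) (len \<sigma> t) \<in> M"
    using Eq_trans[of "len \<sigma> r" "len \<sigma> s" "len \<sigma> t"] Seq.prems by simp
  have "eq \<sigma> (entry \<sigma> r i) (entry \<sigma> t i) \<in> M" if i: "i \<Colon> N" "lt i (len \<sigma> r) \<in> M" for i
    by (rule Seq.IH[of _ "entry \<sigma> s i"])
      (use i Seq.prems lt_cong[OF l(1)] eq_Seq_iff[of r \<sigma> s] eq_Seq_iff[of s \<sigma> t] in simp_all)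
  then show ?case using eq_Seq_iff Seq.prems l' by blast
qed (use Eq_trans in auto)

definition cls :: "tm \<Rightarrow> tm set" where
  "cls t = {s. \<exists>\<tau>. t \<Colon> \<tau> \<and> s \<Colon> \<tau> \<and> eq \<tau> t s \<in> M}"

definition rep :: "tm set \<Rightarrow> tm" where "rep c = (SOME t. t \<in> c)"

lemma cls_eq_iff: "s \<Colon> \<tau> \<Longrightarrow> t \<Colon> \<tau> \<Longrightarrow> cls s = cls t \<longleftrightarrow> eq \<tau> s t \<in> M"
proof
  assume a: "cls s = cls t" "s \<Colon> \<tau>" "t \<Colon> \<tau>"
  have "t \<in> cls t" unfolding cls_def using a eq_refl by blast
  then have "t \<in> cls s" using a(1) by simp
  then show "eq \<tau> s t \<in> M" unfolding cls_def using a has_ty_unique by blast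
next
  assume a: "s \<Colon> \<tau>" "t \<Colon> \<tau>" "eq \<tau> s t \<in> M"
  have "cls s = {r. r \<Colon> \<tau> \<and> eq \<tau> s r \<in> M}" "cls t = {r. r \<Colon> \<tau> \<and> eq \<tau> t r \<in> M}"
    unfolding cls_def using a has_ty_unique by blast+
  then show "cls s = cls t" using a eq_sym eq_trans by blast
qed

lemma rep_cls: "t \<Colon> \<tau> \<Longrightarrow> rep (cls t) \<Colon> \<tau> \<and> eq \<tau> t (rep (cls t)) \<in> M"
proof -
  assume t: "t \<Colon> \<tau>"
  then have "t \<in> cls t" unfolding cls_def using eq_refl by blast
  then have "rep (cls t) \<in> cls t" unfolding rep_def by (rule someI)
  then show ?thesis unfolding cls_def using t has_ty_unique by blast
qed

abbreviation "tU \<equiv> \<lambda>\<tau>. cls ` {t. t \<Colon> \<tau>}"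
abbreviation "tap \<equiv> \<lambda>c d. cls (rep c \<cdot> rep d)"
abbreviation "tcst \<equiv> \<lambda>c. cls (Con c)"
abbreviation "tst \<equiv> \<lambda>c. St (rep c) \<in> M"

text \<open>Two different reasons make application well defined on classes: changing the function is
  harmless by the definition of equality at function types, changing the argument by the
  extensionality axiom.\<close>

lemma tap_cls:
  assumes "s \<Colon> \<sigma> \<Rrightarrow> \<tau>" "t \<Colon> \<sigma>"
  shows "tap (cls s) (cls t) = cls (s \<cdot> t)"
proof -
  let ?s = "rep (cls s)" and ?t = "rep (cls t)"
  have r: "?s \<Colon> \<sigma> \<Rrightarrow> \<tau>" "?t \<Colon> \<sigma>" "eq (\<sigma> \<Rrightarrow> \<tau>) s ?s \<in> M" "eq \<sigma> t ?t \<in> M"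
    using rep_cls assms by blast+
  have ty: "s \<cdot> t \<Colon> \<tau>" "?s \<cdot> t \<Colon> \<tau>" "?s \<cdot> ?t \<Colon> \<tau>" using r assms by auto
  have "(eq \<sigma> t ?t \<^bold>\<longrightarrow> eq \<tau> (?s \<cdot> t) (?s \<cdot> ?t)) \<in> M"
    using r assms ty by (intro e_pra_axiom E_PRA.ext) auto
  then have "eq \<tau> (?s \<cdot> t) (?s \<cdot> ?t) \<in> M" using mp r ty assms wf_eq by blast
  moreover have "eq \<tau> (s \<cdot> t) (?s \<cdot> t) \<in> M" using eq_Fun_iff r assms by blast
  ultimately have "eq \<tau> (s \<cdot> t) (?s \<cdot> ?t) \<in> M" using eq_trans ty by blast
  then show ?thesis using cls_eq_iff ty by blast
qed

text \<open>Axiom \<open>st_eq\<close> makes standardness independent of the representative.\<close>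

lemma tst_cls:
  assumes "t \<Colon> \<tau>"
  shows "tst (cls t) \<longleftrightarrow> St t \<in> M"
proof -
  have "St s' \<in> M" if "St s \<in> M" "eq \<tau> s s' \<in> M" "s \<Colon> \<tau>" "s' \<Colon> \<tau>" for s s'
  proof -
    have w: "wff (St s)" "wff (St s')" "wff (eq \<tau> s s')" using that by (auto intro: wf_eq)
    have "(St s \<^bold>\<and> eq \<tau> s s' \<^bold>\<longrightarrow> St s') \<in> M"
      using P0.st_eq[of s \<tau> s'] that P0 w by (intro axiom) auto
    moreover have "St s \<^bold>\<and> eq \<tau> s s' \<in> M" using conj_iff w that by blast
    ultimately show ?thesis using mp w by simp
  qed
  then show ?thesis using rep_cls[OF assms] eq_sym assms by blast
qed

sublocale typed_frame tU tap tcst tst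
proof
  fix f \<sigma> \<tau> a assume "f \<in> tU (\<sigma> \<Rrightarrow> \<tau>)" "a \<in> tU \<sigma>"
  then obtain s t where "f = cls s" "a = cls t" "s \<Colon> \<sigma> \<Rrightarrow> \<tau>" "t \<Colon> \<sigma>" by blast
  then have "tap f a = cls (s \<cdot> t)" "s \<cdot> t \<Colon> \<tau>" using tap_cls has_ty_App by blast+
  then show "tap f a \<in> tU \<tau>" by blast
qed auto

lemma val_Free: "t \<Colon> \<tau> \<Longrightarrow> val [] (cls \<circ> Free) t = cls t"
  by (induction t arbitrary: \<tau>) (auto simp: tap_cls)

lemma truth: "wff A \<Longrightarrow> sem [] (cls \<circ> Free) A \<longleftrightarrow> A \<in> M"
proof (induction "depth A" arbitrary: A rule: less_induct)
  case less
  show ?case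
  proof (cases A)
    case (Eq s t)
    then have "s \<Colon> N" "t \<Colon> N" using less.prems by simp_all
    then show ?thesis using Eq cls_eq_iff[of s N t] by (simp add: val_Free)
  next
    case (St t)
    then obtain \<tau> where "t \<Colon> \<tau>" using less.prems by auto
    then show ?thesis using St tst_cls by (simp add: val_Free)
  next
    case Fls
    then show ?thesis using Fls by (simp add: henkin_set.Fls[OF henkin_set_axioms])
  next
    case (Imp B C)
    then show ?thesis using less imp_iff by simp
  next
    case (All \<tau> B)
    have "sem [cls t] (cls \<circ> Free) B \<longleftrightarrow> inst 0 t B \<in> M" if "t \<Colon> \<tau>" for t
    proof -
      have "sem [] (cls \<circ> Free) (inst 0 t B) \<longleftrightarrow> inst 0 t B \<in> M"
        using less All that wf_inst[of t \<tau> "[]" B] by (simp add: depth_inst)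
      then show ?thesis
        using sem_inst[of "[]" \<tau> B "[]" t] that less.prems All val_Free by simp
    qed
    then show ?thesis using All_iff less.prems All by auto
  qed
qed

lemma sem_foldr_all:
  "sem [] e (foldr all xs A) \<Longrightarrow> wff A \<Longrightarrow> env e' \<Longrightarrow> (\<And>x. x \<notin> set xs \<Longrightarrow> e' x = e x) \<Longrightarrow>
   sem [] e' A"
proof (induction xs arbitrary: e)
  case Nil
  then have "e' = e" by auto
  then show ?case using Nil by simp
next
  case (Cons x xs)
  have "wff (foldr all xs A)" using Cons.prems(2) by (induction xs) auto
  moreover have "e' x \<in> tU (snd x)" using Cons.prems(3) unfolding env_def by blast
  moreover have "sem [] e (all x (foldr all xs A))" using Cons.prems(1) by simp
  ultimately have "sem [] (e(x := e' x)) (foldr all xs A)" using sem_all by blast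
  then show ?case by (rule Cons.IH[OF _ Cons.prems(2,3)]) (use Cons.prems(4) in auto)
qed

text \<open>No induction on derivations is needed: the universal closure of a theorem is again a
  theorem, hence in \<open>M\<close>, hence true under the canonical valuation, and its quantifiers
  reach every class.\<close>

lemma sound:
  assumes "Ax \<turnstile> A" "env e"
  shows "sem [] e A"
proof -
  obtain xs where xs: "set xs = fv A" using finite_fv finite_list by blast
  have w: "wff A" using assms derives_wff unfolding proves_def by blast
  have all: "Ax \<turnstile> foldr all ys A" for ys using assms proves_all by (induction ys) auto
  then have "wff (foldr all xs A)" using derives_wff unfolding proves_def by blast
  then have "sem [] (cls \<circ> Free) (foldr all xs A)" using truth all proved by blast
  \<comment> \<open>Outside the free variables of \<open>A\<close> the valuation is reset to the
    canonical one, because the closure quantifies over those variables only.\<close>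
  moreover define e' where "e' = (\<lambda>x. if x \<in> set xs then e x else cls (Free x))"
  have "env e'" unfolding env_def e'_def using assms(2) unfolding env_def by auto
  ultimately have "sem [] e' A"
    using sem_foldr_all[of "cls \<circ> Free" xs A e'] w by (auto simp: e'_def)
  then show ?thesis using sem_cong[of A e e'] xs e'_def by simp
qed

sublocale model tU tap tcst tst Ax
proof
  fix e s t \<tau> assume a: "env e" "s \<Colon> \<tau>" "t \<Colon> \<tau>" "sem [] e (eq \<tau> s t)"
  have "val [] e s \<in> tU \<tau>" "val [] e t \<in> tU \<tau>" using val_in a by blast+
  then obtain s' t' where v: "val [] e s = cls s'" "val [] e t = cls t'" "s' \<Colon> \<tau>" "t' \<Colon> \<tau>"
    by blast
  have "sem [] (cls \<circ> Free) (eq \<tau> s' t')"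
    using sem_eq_cong[of "[]" e s "[]" "cls \<circ> Free" s' t t' \<tau>] a(4) v val_Free[OF v(3)]
      val_Free[OF v(4)] by metis
  then have "eq \<tau> s' t' \<in> M" using truth wf_eq v(3,4) by blast
  then show "val [] e s = val [] e t" using v cls_eq_iff by simp
next
  fix A e assume "A \<in> Ax" "wff A" "env e"
  then show "sem [] e A" using sound derives.ax unfolding proves_def by blast
qed

end

text \<open>The quotient of the terms by provable equality in \<open>M\<close> has carrier
  \<open>tm set\<close>, so only models of that kind need be considered; \<open>P0\<close> in the
  axioms provides the congruence laws for the quotient.\<close>

theorem completeness:
  assumes "P0 \<subseteq> Ax" "wff A"
    and "\<And>U ap cst (st :: tm set \<Rightarrow> bool) e. model U ap cst st Ax \<Longrightarrow> frame.env U e \<Longrightarrow>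
      frame.sem U ap cst st [] e A"
  shows "Ax \<turnstile> A"
proof (rule ccontr)
  assume "\<not> (Ax \<turnstile> A)"
  then obtain M where M: "henkin_set Ax M" "A \<notin> M" using henkin assms(2) by blast
  then interpret term_model Ax M by (simp add: term_model_def term_model_axioms_def assms)
  have "env (cls \<circ> Free)" by (simp add: env_def)
  then show False using assms(3)[OF model_axioms] truth assms(2) M by blast
qed

section \<open>Arithmetic in the model\<close>

locale nonstd_model = model U ap cst st "P0 \<union> {Pi01_TRANS, STP}"
  for U :: "ty \<Rightarrow> 'd set" and ap (infixl "\<odot>" 90) and cst and st
begin

lemma sem_subst:
  assumes "wff A" "u \<Colon> snd x"
  shows "sem [] e (subst x u A) = sem [] (e(x := val [] e u)) A"
  using sem_inst[of "[]" "snd x" "close 0 x A" "[]" u e] sem_close[of "[]" A "[]" _ e x]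
    wf_close[of "[]" A x] inst_close[of "[]" A u x] assms by simp

lemma P0_valid: "A \<in> P0 \<Longrightarrow> wff A \<Longrightarrow> env e \<Longrightarrow> sem [] e A"
  using valid by blast

lemma E_PRA_valid: "A \<in> E_PRA \<Longrightarrow> wff A \<Longrightarrow> env e \<Longrightarrow> sem [] e A"
  using P0_valid P0.e_pra by blast

text \<open>The zero functionals inhabit every type, so this valuation serves as a base that is
  updated at the few variables of interest.\<close>

definition e0 :: "var \<Rightarrow> 'd" where "e0 x = val [] (\<lambda>_. cst Zero) (zero_tm (snd x))"

lemma env_e0 [simp]: "env e0"
proof -
  have "val [] e (zero_tm \<tau>) \<in> U \<tau>" for e \<tau>
  proof (induction \<tau>)
    case N
    then show ?case using cst_in[of Zero] by simp
  next
    case (Fun \<sigma> \<tau>)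
    then show ?case using cst_in[of "Comb_K \<tau> \<sigma>"] by (auto intro: ap_in)
  next
    case (Seq \<sigma>)
    then show ?case using cst_in[of "Comb_K \<sigma> N"] cst_in[of "Tab \<sigma>"] cst_in[of Zero]
      by (auto intro!: ap_in[of _ "N \<Rrightarrow> \<sigma>" "Seq \<sigma>"] ap_in[of _ N "(N \<Rrightarrow> \<sigma>) \<Rrightarrow> Seq \<sigma>"]
          ap_in[of _ \<sigma> "N \<Rrightarrow> \<sigma>"])
  qed
  then show ?thesis by (simp add: env_def e0_def)
qed

lemma K_eq: "a \<in> U \<rho> \<Longrightarrow> b \<in> U \<tau> \<Longrightarrow> cst (Comb_K \<rho> \<tau>) \<odot> a \<odot> b = a"
  using eq_val[of "e0((0, \<rho>) := a, (1, \<tau>) := b)" "Con (Comb_K \<rho> \<tau>) \<cdot> Free (0, \<rho>) \<cdot> Free (1, \<tau>)"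
      \<rho> "Free (0, \<rho>)"] E_PRA_valid[OF E_PRA.comb_K[of "Free (0, \<rho>)" \<rho> "Free (1, \<tau>)" \<tau>]]
  by simp

lemma S_eq:
  assumes "a \<in> U (\<delta> \<Rrightarrow> \<rho> \<Rrightarrow> \<tau>)" "b \<in> U (\<delta> \<Rrightarrow> \<rho>)" "c \<in> U \<delta>"
  shows "cst (Comb_S \<delta> \<rho> \<tau>) \<odot> a \<odot> b \<odot> c = a \<odot> c \<odot> (b \<odot> c)"
proof -
  let ?x = "(0, \<delta> \<Rrightarrow> \<rho> \<Rrightarrow> \<tau>)" and ?y = "(1, \<delta> \<Rrightarrow> \<rho>)" and ?z = "(2, \<delta>)"
  show ?thesis
    using eq_val[of "e0(?x := a, ?y := b, ?z := c)"
        "Con (Comb_S \<delta> \<rho> \<tau>) \<cdot> Free ?x \<cdot> Free ?y \<cdot> Free ?z" \<tau> "Free ?x \<cdot> Free ?z \<cdot> (Free ?y \<cdot> Free ?z)"]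
      E_PRA_valid[OF E_PRA.comb_S[of "Free ?x" \<delta> \<rho> \<tau> "Free ?y" "Free ?z"],
        of "e0(?x := a, ?y := b, ?z := c)"] assms
    by simp
qed

lemma val_lam [simp]:
  "t \<Colon> \<tau> \<Longrightarrow> env e \<Longrightarrow> a \<in> U (snd x) \<Longrightarrow> val [] e (lam x t) \<odot> a = val [] (e(x := a)) t"
proof (induction t arbitrary: \<tau>)
  case (Free y)
  then have ey: "e y \<in> U (snd y)" unfolding env_def by blast
  show ?case
  proof (cases "y = x")
    case True
    let ?\<sigma> = "snd x"
    have "cst (Comb_K ?\<sigma> ?\<sigma>) \<odot> a \<in> U (?\<sigma> \<Rrightarrow> ?\<sigma>)"
      using ap_in[OF cst_in[of "Comb_K ?\<sigma> ?\<sigma>", simplified]] Free by blast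
    then show ?thesis
      using True Free cst_in[of "Comb_K ?\<sigma> ?\<sigma>"] cst_in[of "Comb_K ?\<sigma> (?\<sigma> \<Rrightarrow> ?\<sigma>)"]
      by (simp add: lam.simps comb_I_def S_eq K_eq)
  qed (use Free ey in \<open>simp add: lam.simps K_eq\<close>)
next
  case (Con c)
  then show ?case using cst_in[of c] by (simp add: lam.simps val.simps K_eq)
next
  case (App s t)
  then obtain \<sigma> where st: "s \<Colon> \<sigma> \<Rrightarrow> \<tau>" "t \<Colon> \<sigma>" by auto
  have "val [] e (lam x s) \<in> U (snd x \<Rrightarrow> \<sigma> \<Rrightarrow> \<tau>)" "val [] e (lam x t) \<in> U (snd x \<Rrightarrow> \<sigma>)"
    using st App.prems by (auto intro!: val_in)
  then show ?case using App.IH st App.prems ty_of_eq[OF st(1)] ty_of_eq[OF st(2)]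
    by (simp add: lam.simps S_eq)
qed simp

text \<open>Induction in the model is an axiom about formulas, so a function on the domain can enter
  an induction only if some object of the model takes its values.\<close>

definition rep :: "ty \<Rightarrow> ty \<Rightarrow> ('d \<Rightarrow> 'd) \<Rightarrow> bool" where
  "rep \<sigma> \<tau> g \<longleftrightarrow> (\<exists>f \<in> U (\<sigma> \<Rrightarrow> \<tau>). \<forall>a \<in> U \<sigma>. f \<odot> a = g a)"

lemma rep_id [intro]: "rep \<sigma> \<sigma> (\<lambda>a. a)"
proof -
  have "val [] e0 (lam (0, \<sigma>) (Free (0, \<sigma>))) \<in> U (\<sigma> \<Rrightarrow> \<sigma>)" by (rule val_in) auto
  then show ?thesis unfolding rep_def by (rule bexI[rotated]) simp
qed

lemma rep_const [intro]: "c \<in> U \<tau> \<Longrightarrow> rep \<sigma> \<tau> (\<lambda>a. c)"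
  unfolding rep_def using K_eq[of c \<tau>] ap_in[OF cst_in[of "Comb_K \<tau> \<sigma>", simplified]] by blast

lemma rep_app:
  assumes "rep \<sigma> (\<rho> \<Rrightarrow> \<tau>) g" "rep \<sigma> \<rho> h"
  shows "rep \<sigma> \<tau> (\<lambda>a. g a \<odot> h a)"
proof -
  obtain f f' where f: "f \<in> U (\<sigma> \<Rrightarrow> \<rho> \<Rrightarrow> \<tau>)" "f' \<in> U (\<sigma> \<Rrightarrow> \<rho>)"
    "\<forall>a \<in> U \<sigma>. f \<odot> a = g a" "\<forall>a \<in> U \<sigma>. f' \<odot> a = h a"
    using assms unfolding rep_def by blast
  then have "cst (Comb_S \<sigma> \<rho> \<tau>) \<odot> f \<odot> f' \<in> U (\<sigma> \<Rrightarrow> \<tau>)"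
    using ap_in[OF ap_in[OF cst_in[of "Comb_S \<sigma> \<rho> \<tau>", simplified] f(1)] f(2)] by blast
  then show ?thesis unfolding rep_def by (rule bexI[rotated]) (use f in \<open>simp add: S_eq\<close>)
qed

section \<open>Numbers and the operations defined by the recursor\<close>

abbreviation NN :: "'d set" where "NN \<equiv> U N"
definition Z :: 'd ("\<zero>") where "\<zero> = cst Zero"
definition S :: "'d \<Rightarrow> 'd" where "S a = cst Succ \<odot> a"
abbreviation One :: 'd ("\<one>") where "\<one> \<equiv> S \<zero>"
definition plus :: "'d \<Rightarrow> 'd \<Rightarrow> 'd" (infixl "\<oplus>" 65) where "a \<oplus> b = val [] e0 plus_tm \<odot> a \<odot> b"
definition times :: "'d \<Rightarrow> 'd \<Rightarrow> 'd" (infixl "\<otimes>" 70) where "a \<otimes> b = val [] e0 times_tm \<odot> a \<odot> b"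
definition monus :: "'d \<Rightarrow> 'd \<Rightarrow> 'd" (infixl "\<ominus>" 65) where "a \<ominus> b = val [] e0 monus_tm \<odot> a \<odot> b"
definition pred :: "'d \<Rightarrow> 'd" where "pred a = val [] e0 pred_tm \<odot> a"
definition less :: "'d \<Rightarrow> 'd \<Rightarrow> bool" (infix "\<prec>" 50) where "a \<prec> b \<longleftrightarrow> S a \<ominus> b = \<zero>"

lemma val_arith [simp]:
  "val bs e zero = \<zero>" "val bs e (suc t) = S (val bs e t)"
  "val bs e (plus_tm \<cdot> s \<cdot> t) = val bs e s \<oplus> val bs e t"
  "val bs e (times_tm \<cdot> s \<cdot> t) = val bs e s \<otimes> val bs e t"
  "val bs e (monus_tm \<cdot> s \<cdot> t) = val bs e s \<ominus> val bs e t"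
  "val bs e (pred_tm \<cdot> t) = pred (val bs e t)"
proof -
  have "val bs e t = val [] e0 t" if "t \<Colon> \<tau>" "fv_tm t = {}" for t \<tau>
    using val_closed[OF that(1), of bs e] val_cong[of t e e0 "[]"] that(2) by simp
  from this[of plus_tm] this[of times_tm] this[of monus_tm] this[of pred_tm]
  show "val bs e zero = \<zero>" "val bs e (suc t) = S (val bs e t)"
  "val bs e (plus_tm \<cdot> s \<cdot> t) = val bs e s \<oplus> val bs e t"
  "val bs e (times_tm \<cdot> s \<cdot> t) = val bs e s \<otimes> val bs e t"
  "val bs e (monus_tm \<cdot> s \<cdot> t) = val bs e s \<ominus> val bs e t"
  "val bs e (pred_tm \<cdot> t) = pred (val bs e t)"
    by (simp_all add: Z_def S_def plus_def times_def monus_def pred_def)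
qed

declare val.simps(3,4) [simp del]

lemma val_App: "(\<And>c. s \<noteq> Con c) \<Longrightarrow> val bs e (s \<cdot> t) = val bs e s \<odot> val bs e t"
  by (simp add: val.simps)

lemma val_App_Free [simp]: "val bs e (Free x \<cdot> t) = e x \<odot> val bs e t"
  "val bs e (Free x \<cdot> t \<cdot> s) = e x \<odot> val bs e t \<odot> val bs e s"
  "val bs e (lam x r \<cdot> t) = val bs e (lam x r) \<odot> val bs e t"
  by (simp_all add: val.simps)

lemma val_lt [simp]: "sem bs e (lt s t) \<longleftrightarrow> val bs e s \<prec> val bs e t"
  by (simp add: lt_def le_def less_def)

lemma Z_in [simp]: "\<zero> \<in> NN" using cst_in[of Zero] by (simp add: Z_def)

lemma S_in [simp]: "a \<in> NN \<Longrightarrow> S a \<in> NN"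
  unfolding S_def by (rule ap_in[OF cst_in[of Succ, simplified]])

lemma arith_in [simp]:
  assumes "a \<in> NN"
  shows "pred a \<in> NN" "b \<in> NN \<Longrightarrow> a \<oplus> b \<in> NN" "b \<in> NN \<Longrightarrow> a \<otimes> b \<in> NN" "b \<in> NN \<Longrightarrow> a \<ominus> b \<in> NN"
  unfolding pred_def plus_def times_def monus_def
  by (rule ap_in[of _ N] val_in assms env_e0 | simp)+

lemma rep_arith [intro]:
  assumes "rep \<sigma> N g"
  shows "rep \<sigma> N (\<lambda>a. S (g a))" "rep \<sigma> N (\<lambda>a. pred (g a))"
    "rep \<sigma> N h \<Longrightarrow> rep \<sigma> N (\<lambda>a. g a \<oplus> h a)" "rep \<sigma> N h \<Longrightarrow> rep \<sigma> N (\<lambda>a. g a \<otimes> h a)"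
    "rep \<sigma> N h \<Longrightarrow> rep \<sigma> N (\<lambda>a. g a \<ominus> h a)"
  unfolding S_def pred_def plus_def times_def monus_def using cst_in[of Succ]
  by (auto intro!: rep_app[of \<sigma> N N] rep_app[of \<sigma> N "N \<Rrightarrow> N"] rep_const val_in assms)

lemma rep_fun [intro]: "f \<in> U (\<sigma> \<Rrightarrow> \<tau>) \<Longrightarrow> rep \<rho> \<sigma> g \<Longrightarrow> rep \<rho> \<tau> (\<lambda>a. f \<odot> g a)"
  by (rule rep_app[of \<rho> \<sigma>]) auto

definition recur :: "'d \<Rightarrow> 'd \<Rightarrow> 'd \<Rightarrow> 'd" where "recur n a f = cst Rec0 \<odot> n \<odot> a \<odot> f"

lemma val_rec0 [simp]: "val bs e (rec0 n s t) = recur (val bs e n) (val bs e s) (val bs e t)"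
  by (simp add: recur_def val.simps)

lemma recur_eqs [simp]:
  assumes "a \<in> NN" "f \<in> U (N \<Rrightarrow> N \<Rrightarrow> N)"
  shows "recur \<zero> a f = a" "n \<in> NN \<Longrightarrow> recur (S n) a f = f \<odot> recur n a f \<odot> n"
proof -
  let ?n = "(0, N)" and ?a = "(1, N)" and ?f = "(2, N \<Rrightarrow> N \<Rrightarrow> N)"
  show "recur \<zero> a f = a"
    using E_PRA_valid[OF E_PRA.rec0_zero[of "Free ?a" "Free ?f"], of "e0(?a := a, ?f := f)"] assms
    by simp
  show "recur (S n) a f = f \<odot> recur n a f \<odot> n" if "n \<in> NN"
    using E_PRA_valid[OF E_PRA.rec0_suc[of "Free ?n" "Free ?a" "Free ?f"],
        of "e0(?n := n, ?a := a, ?f := f)"] assms that by simp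
qed

lemma recur_in [simp]: "n \<in> NN \<Longrightarrow> a \<in> NN \<Longrightarrow> f \<in> U (N \<Rrightarrow> N \<Rrightarrow> N) \<Longrightarrow> recur n a f \<in> NN"
  unfolding recur_def by (rule ap_in ap_in[OF cst_in[of Rec0, simplified]] | assumption)+

lemma plus_rec [simp]:
  assumes "a \<in> NN"
  shows "a \<oplus> \<zero> = a" "b \<in> NN \<Longrightarrow> a \<oplus> S b = S (a \<oplus> b)"
proof -
  let ?t = "lam (2, N) (lam (3, N) (suc (Free (2, N))))"
  have p: "b \<in> NN \<Longrightarrow> a \<oplus> b = recur b a (val [] (e0((0, N) := a, (1, N) := b)) ?t)" for b
    unfolding plus_def plus_tm_def Let_def using assms by (simp add: val_App)
  have t: "env e \<Longrightarrow> val [] e ?t \<in> U (N \<Rrightarrow> N \<Rrightarrow> N)" for e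
    by (rule val_in) auto
  \<comment> \<open>The step function is closed, so the values that the outer abstractions put into
    the valuation can be forgotten.\<close>
  have c: "val [] e ?t = val [] e0 ?t" for e by (rule val_cong) simp
  show "a \<oplus> \<zero> = a" using assms t by (simp add: p)
  show "a \<oplus> S b = S (a \<oplus> b)" if "b \<in> NN"
    using assms that t by (simp add: p c[of "e0(x := y, z := w)" for x y z w])
qed

lemma times_rec [simp]:
  assumes "a \<in> NN"
  shows "a \<otimes> \<zero> = \<zero>" "b \<in> NN \<Longrightarrow> a \<otimes> S b = a \<otimes> b \<oplus> a"
proof -
  let ?t = "lam (2, N) (lam (3, N) (plus_tm \<cdot> Free (2, N) \<cdot> Free (0, N)))"
  have p: "b \<in> NN \<Longrightarrow> a \<otimes> b = recur b \<zero> (val [] (e0((0, N) := a)) ?t)" for b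
  proof -
    assume "b \<in> NN"
    moreover have "val [] (e0((0, N) := a, (1, N) := b)) ?t = val [] (e0((0, N) := a)) ?t"
      by (rule val_cong) auto
    ultimately show ?thesis
      unfolding times_def times_tm_def Let_def using assms by (simp add: val_App)
  qed
  have t: "env e \<Longrightarrow> val [] e ?t \<in> U (N \<Rrightarrow> N \<Rrightarrow> N)" for e
    by (rule val_in) auto
  show "a \<otimes> \<zero> = \<zero>" using assms t by (simp add: p)
  show "a \<otimes> S b = a \<otimes> b \<oplus> a" if "b \<in> NN"
    using assms that t[of "e0((0, N) := a)"] by (simp add: p)
qed

lemma pred_rec [simp]: "pred \<zero> = \<zero>" "b \<in> NN \<Longrightarrow> pred (S b) = b"
proof -
  let ?t = "lam (2, N) (lam (3, N) (Free (3, N)))"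
  have p: "b \<in> NN \<Longrightarrow> pred b = recur b \<zero> (val [] e0 ?t)" for b
  proof -
    assume "b \<in> NN"
    moreover have "val [] (e0((0, N) := b)) ?t = val [] e0 ?t" by (rule val_cong) simp
    ultimately show ?thesis unfolding pred_def pred_tm_def Let_def by (simp add: val_App)
  qed
  have t: "val [] e0 ?t \<in> U (N \<Rrightarrow> N \<Rrightarrow> N)" by (rule val_in) auto
  then show "pred \<zero> = \<zero>" by (simp add: p)
  show "pred (S b) = b" if "b \<in> NN" using that t by (simp add: p)
qed

lemma monus_rec [simp]:
  assumes "a \<in> NN"
  shows "a \<ominus> \<zero> = a" "b \<in> NN \<Longrightarrow> a \<ominus> S b = pred (a \<ominus> b)"
proof -
  let ?t = "lam (2, N) (lam (3, N) (pred_tm \<cdot> Free (2, N)))"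
  have p: "b \<in> NN \<Longrightarrow> a \<ominus> b = recur b a (val [] e0 ?t)" for b
  proof -
    assume "b \<in> NN"
    moreover have "val [] (e0((0, N) := a, (1, N) := b)) ?t = val [] e0 ?t"
      by (rule val_cong) simp
    ultimately show ?thesis
      unfolding monus_def monus_tm_def Let_def using assms by (simp add: val_App)
  qed
  have t: "val [] e0 ?t \<in> U (N \<Rrightarrow> N \<Rrightarrow> N)" by (rule val_in) auto
  then show "a \<ominus> \<zero> = a" using assms by (simp add: p)
  show "a \<ominus> S b = pred (a \<ominus> b)" if "b \<in> NN" using assms that t by (simp add: p)
qed

lemma S_nonzero [simp]: "a \<in> NN \<Longrightarrow> S a \<noteq> \<zero>" "a \<in> NN \<Longrightarrow> \<zero> \<noteq> S a"
  using E_PRA_valid[OF E_PRA.suc_nonzero[of "Free (0, N)"], of "e0((0, N) := a)"] by auto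

lemma S_inject [simp]: "a \<in> NN \<Longrightarrow> b \<in> NN \<Longrightarrow> S a = S b \<longleftrightarrow> a = b"
  using E_PRA_valid[OF E_PRA.suc_inject[of "Free (0, N)" "Free (1, N)"],
      of "e0((0, N) := a, (1, N) := b)"] by auto

section \<open>Quantifier-free induction and its consequences\<close>

lemma qf_induct_fm:
  assumes A: "wff A" "internal A" "quantifier_free A" and x: "snd x = N" and e: "env e"
    and zero: "sem [] (e(x := \<zero>)) A"
    and step: "\<And>n. n \<in> NN \<Longrightarrow> sem [] (e(x := n)) A \<Longrightarrow> sem [] (e(x := S n)) A" and n: "n \<in> NN"
  shows "sem [] (e(x := n)) A"
proof -
  have ty: "zero \<Colon> snd x" "suc (Free x) \<Colon> snd x" using x by simp_all
  have w: "u \<Colon> snd x \<Longrightarrow> wff (subst x u A)" for u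
    using wf_inst[of u "snd x" "[]" "close 0 x A"] wf_close[of "[]" A x] inst_close[of "[]" A u x] A
    by simp
  note s = sem_subst[OF A(1) ty(1)] sem_subst[OF A(1) ty(2)]
  have "sem [] e (subst x zero A \<^bold>\<and> all x (A \<^bold>\<longrightarrow> subst x (suc (Free x)) A) \<^bold>\<longrightarrow> all x A)"
    using E_PRA_valid[OF E_PRA.qf_induction[OF A x] _ e] w[OF ty(1)] w[OF ty(2)] A(1) by simp
  then show ?thesis using w[OF ty(1)] w[OF ty(2)] A(1) x zero step n by (auto simp: s)
qed

text \<open>One shape covers everything used below: an equation, an equation under an equation, and
  an equation under an inequation. The three derived rules specialise it, with constants in the
  remaining places.\<close>

lemma qf_induct:
  assumes "rep N N g1" "rep N N h1" "rep N N g2" "rep N N h2" "rep N N g3" "rep N N h3"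
    and P: "\<And>n. n \<in> NN \<Longrightarrow> P n \<longleftrightarrow> (g1 n = h1 n \<longrightarrow> g2 n \<noteq> h2 n \<longrightarrow> g3 n = h3 n)"
    and zero: "P \<zero>" and step: "\<And>n. n \<in> NN \<Longrightarrow> P n \<Longrightarrow> P (S n)" and n: "n \<in> NN"
  shows "P n"
proof -
  obtain f1 where f1: "f1 \<in> U T1" "\<And>n. n \<in> NN \<Longrightarrow> f1 \<odot> n = g1 n"
    using assms(1) unfolding rep_def by blast
  obtain k1 where k1: "k1 \<in> U T1" "\<And>n. n \<in> NN \<Longrightarrow> k1 \<odot> n = h1 n"
    using assms(2) unfolding rep_def by blast
  obtain f2 where f2: "f2 \<in> U T1" "\<And>n. n \<in> NN \<Longrightarrow> f2 \<odot> n = g2 n"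
    using assms(3) unfolding rep_def by blast
  obtain k2 where k2: "k2 \<in> U T1" "\<And>n. n \<in> NN \<Longrightarrow> k2 \<odot> n = h2 n"
    using assms(4) unfolding rep_def by blast
  obtain f3 where f3: "f3 \<in> U T1" "\<And>n. n \<in> NN \<Longrightarrow> f3 \<odot> n = g3 n"
    using assms(5) unfolding rep_def by blast
  obtain k3 where k3: "k3 \<in> U T1" "\<And>n. n \<in> NN \<Longrightarrow> k3 \<odot> n = h3 n"
    using assms(6) unfolding rep_def by blast
  note f = f1 k1 f2 k2 f3 k3
  define e where "e = e0((1, T1) := f1, (2, T1) := k1, (3, T1) := f2, (4, T1) := k2,
    (5, T1) := f3, (6, T1) := k3)"
  have e: "env e" using f by (simp add: e_def)
  let ?x = "(0, N)"
  let ?A = "Eq (Free (1, T1) \<cdot> Free ?x) (Free (2, T1) \<cdot> Free ?x) \<^bold>\<longrightarrow>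
    Neg (Eq (Free (3, T1) \<cdot> Free ?x) (Free (4, T1) \<cdot> Free ?x)) \<^bold>\<longrightarrow>
    Eq (Free (5, T1) \<cdot> Free ?x) (Free (6, T1) \<cdot> Free ?x)"
  have A: "wff ?A" by simp
  have P': "m \<in> NN \<Longrightarrow> sem [] (e(?x := m)) ?A \<longleftrightarrow> P m" for m
    using f by (simp add: P e_def)
  show ?thesis
    using qf_induct_fm[OF A _ _ _ e, of ?x n] P' zero step n Z_in S_in by simp
qed

lemma eq_induct:
  assumes "rep N N g" "rep N N h" "g \<zero> = h \<zero>"
    and "\<And>n. n \<in> NN \<Longrightarrow> g n = h n \<Longrightarrow> g (S n) = h (S n)" "n \<in> NN"
  shows "g n = h n"
  by (rule qf_induct[where P = "\<lambda>n. g n = h n", OF _ _ rep_const[of \<zero>] rep_const[of \<one>] assms(1,2)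
        _ assms(3,4,5)]) (use rep_const[of \<zero>] in auto)

lemma cond_induct:
  assumes "rep N N g" "rep N N h" "rep N N g'" "rep N N h'" "g \<zero> = h \<zero> \<Longrightarrow> g' \<zero> = h' \<zero>"
    and "\<And>n. n \<in> NN \<Longrightarrow> (g n = h n \<Longrightarrow> g' n = h' n) \<Longrightarrow> g (S n) = h (S n) \<Longrightarrow> g' (S n) = h' (S n)"
    and "n \<in> NN" "g n = h n"
  shows "g' n = h' n"
  using qf_induct[where P = "\<lambda>n. g n = h n \<longrightarrow> g' n = h' n", OF assms(1,2)
      rep_const[of \<zero>] rep_const[of \<one>] assms(3,4)] assms by auto

lemma neq_induct:
  assumes "rep N N g" "rep N N h" "rep N N g'" "rep N N h'" "g \<zero> \<noteq> h \<zero> \<Longrightarrow> g' \<zero> = h' \<zero>"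
    and "\<And>n. n \<in> NN \<Longrightarrow> (g n \<noteq> h n \<Longrightarrow> g' n = h' n) \<Longrightarrow> g (S n) \<noteq> h (S n) \<Longrightarrow> g' (S n) = h' (S n)"
    and "n \<in> NN" "g n \<noteq> h n"
  shows "g' n = h' n"
  using qf_induct[where P = "\<lambda>n. g n \<noteq> h n \<longrightarrow> g' n = h' n", OF rep_const[of \<zero>] rep_const[of \<zero>]
      assms(1-4)] assms by auto

lemma nat_cases:
  assumes "a \<in> NN"
  obtains "a = \<zero>" | b where "b \<in> NN" "a = S b"
proof -
  have "a = \<zero> \<or> a = S (pred a)"
    using neq_induct[where g = "\<lambda>n. n" and h = "\<lambda>n. \<zero>" and g' = "\<lambda>n. S (pred n)" and h' = "\<lambda>n. n",
        OF _ _ _ _ _ _ assms] by (force intro: rep_const rep_arith)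
  then show ?thesis using that assms arith_in(1) by blast
qed

lemma plus_zero_left [simp]: "a \<in> NN \<Longrightarrow> \<zero> \<oplus> a = a"
  by (rule eq_induct[where g = "\<lambda>a. \<zero> \<oplus> a" and h = "\<lambda>a. a"]) (auto intro!: rep_const rep_arith)

lemma plus_S_left [simp]: "a \<in> NN \<Longrightarrow> b \<in> NN \<Longrightarrow> S a \<oplus> b = S (a \<oplus> b)"
  by (rule eq_induct[where g = "\<lambda>b. S a \<oplus> b" and h = "\<lambda>b. S (a \<oplus> b)"])
    (auto intro!: rep_const rep_arith)

lemma plus_comm: "a \<in> NN \<Longrightarrow> b \<in> NN \<Longrightarrow> a \<oplus> b = b \<oplus> a"
  by (rule eq_induct[where g = "\<lambda>b. a \<oplus> b" and h = "\<lambda>b. b \<oplus> a"]) (auto intro!: rep_const rep_arith)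

lemma plus_assoc: "a \<in> NN \<Longrightarrow> b \<in> NN \<Longrightarrow> c \<in> NN \<Longrightarrow> a \<oplus> b \<oplus> c = a \<oplus> (b \<oplus> c)"
  by (rule eq_induct[where g = "\<lambda>c. a \<oplus> b \<oplus> c" and h = "\<lambda>c. a \<oplus> (b \<oplus> c)"])
    (auto intro!: rep_const rep_arith)

lemma plus_left_comm: "a \<in> NN \<Longrightarrow> b \<in> NN \<Longrightarrow> c \<in> NN \<Longrightarrow> a \<oplus> (b \<oplus> c) = b \<oplus> (a \<oplus> c)"
  using plus_assoc plus_comm by metis

lemma plus_right_cancel: "a \<in> NN \<Longrightarrow> b \<in> NN \<Longrightarrow> c \<in> NN \<Longrightarrow> a \<oplus> c = b \<oplus> c \<Longrightarrow> a = b"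
  by (rule cond_induct[where g = "\<lambda>c. a \<oplus> c" and h = "\<lambda>c. b \<oplus> c" and g' = "\<lambda>c. a" and h' = "\<lambda>c. b"])
    (auto intro!: rep_const rep_arith)

lemma plus_left_cancel [simp]: "a \<in> NN \<Longrightarrow> b \<in> NN \<Longrightarrow> c \<in> NN \<Longrightarrow> c \<oplus> a = c \<oplus> b \<longleftrightarrow> a = b"
  using plus_right_cancel plus_comm by metis

lemma plus_eq_zero: "a \<in> NN \<Longrightarrow> b \<in> NN \<Longrightarrow> a \<oplus> b = \<zero> \<longleftrightarrow> a = \<zero> \<and> b = \<zero>"
  by (rule nat_cases[of b]) auto

lemma times_zero_left [simp]: "a \<in> NN \<Longrightarrow> \<zero> \<otimes> a = \<zero>"
  by (rule eq_induct[where g = "\<lambda>a. \<zero> \<otimes> a" and h = "\<lambda>a. \<zero>"]) (auto intro!: rep_const rep_arith)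

lemma times_S_left [simp]: "a \<in> NN \<Longrightarrow> b \<in> NN \<Longrightarrow> S a \<otimes> b = a \<otimes> b \<oplus> b"
  by (rule eq_induct[where g = "\<lambda>b. S a \<otimes> b" and h = "\<lambda>b. a \<otimes> b \<oplus> b"])
    (auto intro!: rep_const rep_arith simp: plus_assoc, simp add: plus_comm)

lemma times_comm: "a \<in> NN \<Longrightarrow> b \<in> NN \<Longrightarrow> a \<otimes> b = b \<otimes> a"
  by (rule eq_induct[where g = "\<lambda>b. a \<otimes> b" and h = "\<lambda>b. b \<otimes> a"]) (auto intro!: rep_const rep_arith)

lemma times_distrib: "a \<in> NN \<Longrightarrow> b \<in> NN \<Longrightarrow> c \<in> NN \<Longrightarrow> a \<otimes> (b \<oplus> c) = a \<otimes> b \<oplus> a \<otimes> c"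
  by (rule eq_induct[where g = "\<lambda>c. a \<otimes> (b \<oplus> c)" and h = "\<lambda>c. a \<otimes> b \<oplus> a \<otimes> c"])
    (auto intro!: rep_const rep_arith simp: plus_assoc)

lemma times_distrib_right: "a \<in> NN \<Longrightarrow> b \<in> NN \<Longrightarrow> c \<in> NN \<Longrightarrow> (b \<oplus> c) \<otimes> a = b \<otimes> a \<oplus> c \<otimes> a"
  using times_distrib times_comm by simp

lemma S_monus_S [simp]: "a \<in> NN \<Longrightarrow> b \<in> NN \<Longrightarrow> S a \<ominus> S b = a \<ominus> b"
  by (rule eq_induct[where g = "\<lambda>b. S a \<ominus> S b" and h = "\<lambda>b. a \<ominus> b"]) (auto intro!: rep_const rep_arith)

lemma plus_monus [simp]: "a \<in> NN \<Longrightarrow> b \<in> NN \<Longrightarrow> (a \<oplus> b) \<ominus> a = b"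
  by (rule eq_induct[where g = "\<lambda>a. (a \<oplus> b) \<ominus> a" and h = "\<lambda>a. b"])
    (auto intro!: rep_const rep_arith simp del: monus_rec(2))

text \<open>With \<open>monus_plus2\<close> this shows that truncated subtraction yields genuine
  differences. The order, defined by an equation between differences, then becomes the existence of
  a summand and is handled by the laws of addition.\<close>

lemma monus_plus: "a \<in> NN \<Longrightarrow> b \<in> NN \<Longrightarrow> b \<ominus> a \<noteq> \<zero> \<Longrightarrow> a \<oplus> (b \<ominus> a) = b"
proof (rule neq_induct[where g = "\<lambda>a. b \<ominus> a" and h = "\<lambda>a. \<zero>" and g' = "\<lambda>a. a \<oplus> (b \<ominus> a)" and h' = "\<lambda>a. b"])
  fix n assume n: "n \<in> NN" "b \<in> NN" "b \<ominus> n \<noteq> \<zero> \<Longrightarrow> n \<oplus> (b \<ominus> n) = b" "b \<ominus> S n \<noteq> \<zero>"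
  show "S n \<oplus> (b \<ominus> S n) = b"
    by (rule nat_cases[of "b \<ominus> n"]) (use n in auto)
qed (auto intro!: rep_const rep_arith)

lemma monus_plus2: "a \<in> NN \<Longrightarrow> b \<in> NN \<Longrightarrow> b \<ominus> a = \<zero> \<Longrightarrow> b \<oplus> (a \<ominus> b) = a"
proof (rule cond_induct[where g = "\<lambda>a. b \<ominus> a" and h = "\<lambda>a. \<zero>" and g' = "\<lambda>a. b \<oplus> (a \<ominus> b)" and h' = "\<lambda>a. a"])
  fix n assume n: "n \<in> NN" "b \<in> NN" "b \<ominus> n = \<zero> \<Longrightarrow> b \<oplus> (n \<ominus> b) = n" "b \<ominus> S n = \<zero>"
  show "b \<oplus> (S n \<ominus> b) = S n"
  proof (rule nat_cases[of "b \<ominus> n"])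
    assume "b \<ominus> n = \<zero>"
    then have "S n = b \<oplus> S (n \<ominus> b)" using n by simp
    then show ?thesis using n by (metis S_in arith_in(4) plus_monus)
  next
    \<comment> \<open>The boundary case: \<open>b \<ominus> S n = \<zero>\<close> forces
      \<open>d = \<zero>\<close>, so \<open>b\<close> is exactly the successor of
      \<open>n\<close>.\<close>
    fix d assume d: "d \<in> NN" "b \<ominus> n = S d"
    then have "d = \<zero>" using n by simp
    then have "S n = b \<oplus> \<zero>" using monus_plus[of n b] d n by simp
    then show ?thesis using n by (metis Z_in plus_monus)
  qed (use n in simp)
qed (auto intro!: rep_const rep_arith)

lemma monus_zero_iff: "a \<in> NN \<Longrightarrow> b \<in> NN \<Longrightarrow> a \<ominus> b = \<zero> \<longleftrightarrow> (\<exists>d \<in> NN. b = a \<oplus> d)"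
proof
  assume a: "a \<in> NN" "b \<in> NN" "\<exists>d \<in> NN. b = a \<oplus> d"
  have "a \<ominus> (a \<oplus> d) = \<zero>" if "d \<in> NN" for d
    by (rule eq_induct[where g = "\<lambda>d. a \<ominus> (a \<oplus> d)" and h = "\<lambda>d. \<zero>"])
      (use plus_monus[of a \<zero>] a that in \<open>auto intro!: rep_const rep_arith\<close>)
  then show "a \<ominus> b = \<zero>" using a by blast
qed (use monus_plus2 arith_in in metis)

section \<open>The order of the numbers\<close>

lemma less_iff: "a \<in> NN \<Longrightarrow> b \<in> NN \<Longrightarrow> a \<prec> b \<longleftrightarrow> (\<exists>d \<in> NN. b = S (a \<oplus> d))"
  by (simp add: less_def monus_zero_iff)

lemma not_less_zero [simp]: "a \<in> NN \<Longrightarrow> \<not> a \<prec> \<zero>"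
  by (simp add: less_def)

lemma less_S_iff: "a \<in> NN \<Longrightarrow> b \<in> NN \<Longrightarrow> a \<prec> S b \<longleftrightarrow> a \<prec> b \<or> a = b"
proof -
  assume ab: "a \<in> NN" "b \<in> NN"
  have "(\<exists>d \<in> NN. b = a \<oplus> d) \<longleftrightarrow> (\<exists>d \<in> NN. b = S (a \<oplus> d)) \<or> a = b"
  proof
    assume "\<exists>d \<in> NN. b = a \<oplus> d"
    then obtain d where d: "d \<in> NN" "b = a \<oplus> d" by blast
    show "(\<exists>d \<in> NN. b = S (a \<oplus> d)) \<or> a = b"
      by (rule nat_cases[OF d(1)]) (use d ab in auto)
  next
    assume "(\<exists>d \<in> NN. b = S (a \<oplus> d)) \<or> a = b"
    then show "\<exists>d \<in> NN. b = a \<oplus> d" using ab S_in Z_in plus_rec by metis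
  qed
  then show ?thesis using ab by (auto simp: less_iff)
qed

lemma less_irrefl [simp]: "a \<in> NN \<Longrightarrow> \<not> a \<prec> a"
  using plus_left_cancel[of \<zero> "S _" a] by (auto simp: less_iff simp flip: plus_rec(2))

lemma less_linear: "a \<in> NN \<Longrightarrow> b \<in> NN \<Longrightarrow> a \<prec> b \<or> a = b \<or> b \<prec> a"
proof -
  assume ab: "a \<in> NN" "b \<in> NN"
  show ?thesis
  proof (rule nat_cases[of "b \<ominus> a"])
    assume z: "b \<ominus> a = \<zero>"
    show ?thesis
      by (rule nat_cases[of "a \<ominus> b"]) (use z monus_plus2[OF ab z] ab in \<open>auto simp: less_iff\<close>)
  next
    fix d assume d: "d \<in> NN" "b \<ominus> a = S d"
    then have "b = S (a \<oplus> d)" using monus_plus[OF ab] ab by simp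
    then show ?thesis using d ab by (auto simp: less_iff)
  qed (use ab in simp)
qed

lemma less_zero_S [simp]: "a \<in> NN \<Longrightarrow> \<zero> \<prec> S a"
  by (auto simp: less_iff)

section \<open>The pairing function\<close>

definition pair :: "'d \<Rightarrow> 'd \<Rightarrow> 'd" where "pair a b = (a \<oplus> b) \<otimes> (a \<oplus> b) \<oplus> a"

lemma pair_in [simp]: "a \<in> NN \<Longrightarrow> b \<in> NN \<Longrightarrow> pair a b \<in> NN"
  by (simp add: pair_def)

text \<open>With sum \<open>s\<close>, a code lies between \<open>s^2\<close> and
  \<open>s^2 + s\<close>, and these intervals are disjoint for different sums because
  \<open>(s + 1)^2 = s^2 + 2s + 1\<close>.\<close>

lemma square_plus_less:
  assumes "a \<in> NN" "b \<in> NN" "c \<in> NN" "d \<in> NN" "a \<oplus> b \<prec> c \<oplus> d"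
  shows "pair a b \<noteq> pair c d"
proof -
  define s where "s = a \<oplus> b"
  obtain k where k: "k \<in> NN" "c \<oplus> d = S (s \<oplus> k)" using assms by (auto simp: less_iff s_def)
  have s: "s \<in> NN" using assms s_def by simp
  \<comment> \<open>What is left of \<open>pair c d\<close> once \<open>s^2 + s + 1\<close> is taken
    away; the first component \<open>a\<close> is at most \<open>s\<close> and so cannot reach
    \<open>S (s \<oplus> r)\<close>.\<close>
  define r where "r = s \<otimes> k \<oplus> k \<otimes> (s \<oplus> k) \<oplus> (k \<oplus> (s \<oplus> k \<oplus> c))"
  have r: "r \<in> NN" using s k assms r_def by simp
  have "S (s \<oplus> k) \<otimes> S (s \<oplus> k) = s \<otimes> s \<oplus> (s \<otimes> k \<oplus> k \<otimes> (s \<oplus> k)) \<oplus> (s \<oplus> k) \<oplus> S (s \<oplus> k)"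
    using s k by (simp add: times_distrib_right times_distrib plus_assoc plus_comm plus_left_comm)
  then have "pair c d = s \<otimes> s \<oplus> S (s \<oplus> r)"
    using s k assms by (simp add: pair_def r_def plus_assoc plus_comm plus_left_comm)
  moreover have "pair a b = s \<otimes> s \<oplus> a" by (simp add: pair_def s_def)
  moreover have "a \<noteq> S (s \<oplus> r)"
  proof
    assume "a = S (s \<oplus> r)"
    then have "a \<oplus> \<zero> = a \<oplus> S (b \<oplus> r)" using assms r by (simp add: s_def plus_assoc)
    then show False using assms r by (simp del: plus_rec)
  qed
  ultimately show ?thesis
    using s r assms plus_left_cancel[of a "S (s \<oplus> r)" "s \<otimes> s"] by simp
qed

lemma pair_inject [simp]:
  assumes "a \<in> NN" "b \<in> NN" "c \<in> NN" "d \<in> NN"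
  shows "pair a b = pair c d \<longleftrightarrow> a = c \<and> b = d"
proof
  assume p: "pair a b = pair c d"
  then have s: "a \<oplus> b = c \<oplus> d"
    using square_plus_less[of a b c d] square_plus_less[of c d a b] less_linear[of "a \<oplus> b" "c \<oplus> d"] assms
    by auto
  then have "a = c" using p assms by (simp add: pair_def)
  then show "a = c \<and> b = d" using s assms by simp
qed simp

end

lemma internal_close [simp]: "internal (close k x A) = internal A"
  by (induction A arbitrary: k) auto

lemma internal_all [simp]: "internal (all x A) = internal A"
  by (simp add: all_def)

lemma internal_ex [simp]: "internal (ex x A) = internal A"
  by (simp add: ex_def)

lemma internal_eq [simp]: "internal (eq \<tau> s t)"
  by (induction \<tau> arbitrary: s t) (auto simp: lt_def le_def)

lemma fv_ex: "fv (ex x A) = fv A - {x}"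
  by (simp add: ex_def fv_close)

lemma has_ty_mem: "t \<Colon> \<sigma> \<Longrightarrow> s \<Colon> Seq \<sigma> \<Longrightarrow> wff (mem \<sigma> t s)"
  using has_ty_lift[of "[]" t \<sigma> N] has_ty_lift[of "[]" s "Seq \<sigma>" N]
  by (auto simp: mem_def intro!: wf_lt wf_eq)

text \<open>Truth is coded by 1 and falsity by 0, so subtracting from 1 turns "this number vanishes"
  into a truth value.\<close>

definition eqc :: "tm \<Rightarrow> tm \<Rightarrow> tm" where
  "eqc s t = monus_tm \<cdot> one \<cdot> (plus_tm \<cdot> (monus_tm \<cdot> s \<cdot> t) \<cdot> (monus_tm \<cdot> t \<cdot> s))"

definition ltc :: "tm \<Rightarrow> tm \<Rightarrow> tm" where
  "ltc s t = monus_tm \<cdot> one \<cdot> (monus_tm \<cdot> suc s \<cdot> t)"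

definition impc :: "tm \<Rightarrow> tm \<Rightarrow> tm" where
  "impc s t = monus_tm \<cdot> one \<cdot> (monus_tm \<cdot> s \<cdot> t)"

text \<open>Recursion with a constant step is case distinction: the value is \<open>a\<close> at
  zero and \<open>b\<close> at every successor.\<close>

definition condz :: "tm \<Rightarrow> tm \<Rightarrow> tm \<Rightarrow> tm" where
  "condz c a b = rec0 c a (Con (Comb_K (N \<Rrightarrow> N) N) \<cdot> (Con (Comb_K N N) \<cdot> b))"

lemma char_typed [simp]:
  "eqc s t \<Colon> \<tau> \<longleftrightarrow> \<tau> = N \<and> s \<Colon> N \<and> t \<Colon> N" "ltc s t \<Colon> \<tau> \<longleftrightarrow> \<tau> = N \<and> s \<Colon> N \<and> t \<Colon> N"
  "impc s t \<Colon> \<tau> \<longleftrightarrow> \<tau> = N \<and> s \<Colon> N \<and> t \<Colon> N"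
  "condz c s t \<Colon> \<tau> \<longleftrightarrow> \<tau> = N \<and> c \<Colon> N \<and> s \<Colon> N \<and> t \<Colon> N"
  by (auto simp: eqc_def ltc_def impc_def condz_def)

lemma char_fv [simp]:
  "fv_tm (eqc s t) = fv_tm s \<union> fv_tm t" "fv_tm (ltc s t) = fv_tm s \<union> fv_tm t"
  "fv_tm (impc s t) = fv_tm s \<union> fv_tm t" "fv_tm (condz c s t) = fv_tm c \<union> fv_tm s \<union> fv_tm t"
  by (auto simp: eqc_def ltc_def impc_def condz_def)

context nonstd_model
begin

abbreviation chi :: "bool \<Rightarrow> 'd" where "chi P \<equiv> if P then \<one> else \<zero>"

declare monus_rec(2) [simp del]

lemma monus_simps [simp]:
  assumes "a \<in> NN"
  shows "a \<ominus> a = \<zero>" "\<zero> \<ominus> a = \<zero>" "a \<noteq> \<zero> \<Longrightarrow> \<one> \<ominus> a = \<zero>"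
proof -
  show "a \<ominus> a = \<zero>" using assms monus_zero_iff[of a a] plus_rec(1) Z_in by metis
  have z: "\<zero> \<ominus> a = \<zero>" if "a \<in> NN" for a
    using that monus_zero_iff[of \<zero> a] plus_zero_left Z_in by metis
  then show "\<zero> \<ominus> a = \<zero>" using assms by blast
  show "\<one> \<ominus> a = \<zero>" if "a \<noteq> \<zero>"
    by (rule nat_cases[OF assms]) (use that z in auto)
qed

lemma less_trans:
  assumes "a \<in> NN" "b \<in> NN" "c \<in> NN" "a \<prec> b" "b \<prec> c"
  shows "a \<prec> c"
proof -
  obtain d d' where d: "d \<in> NN" "d' \<in> NN" "b = S (a \<oplus> d)" "c = S (b \<oplus> d')"
    using assms by (auto simp: less_iff)
  then have "c = S (a \<oplus> S (d \<oplus> d'))" using assms by (simp add: plus_assoc)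
  then show ?thesis using assms d by (auto simp: less_iff simp del: plus_rec)
qed

lemma less_asym: "a \<in> NN \<Longrightarrow> b \<in> NN \<Longrightarrow> a \<prec> b \<Longrightarrow> \<not> b \<prec> a"
  using less_trans less_irrefl by blast

lemma monus_zero_eq: "a \<in> NN \<Longrightarrow> b \<in> NN \<Longrightarrow> a \<ominus> b \<oplus> (b \<ominus> a) = \<zero> \<longleftrightarrow> a = b"
  using plus_eq_zero[of "a \<ominus> b" "b \<ominus> a"] monus_plus2[of a b] by auto

lemma val_char [simp]:
  assumes "s \<Colon> N" "t \<Colon> N" "env e"
  shows "val [] e (eqc s t) = chi (val [] e s = val [] e t)"
    "val [] e (ltc s t) = chi (val [] e s \<prec> val [] e t)"
    "c \<Colon> N \<Longrightarrow> val [] e (condz c s t) = (if val [] e c = \<zero> then val [] e s else val [] e t)"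
proof -
  have in_NN: "val [] e s \<in> NN" "val [] e t \<in> NN" using val_in assms by blast+
  show "val [] e (eqc s t) = chi (val [] e s = val [] e t)"
    using in_NN monus_zero_eq[OF in_NN] by (cases "val [] e s = val [] e t") (simp_all add: eqc_def)
  show "val [] e (ltc s t) = chi (val [] e s \<prec> val [] e t)"
    using in_NN by (cases "val [] e s \<prec> val [] e t") (simp_all add: ltc_def less_def)
  assume c: "c \<Colon> N"
  let ?f = "Con (Comb_K (N \<Rrightarrow> N) N) \<cdot> (Con (Comb_K N N) \<cdot> t)"
  let ?k = "Con (Comb_K N N) \<cdot> t"
  have k: "val [] e ?k \<in> U (N \<Rrightarrow> N)" "val [] e ?f \<in> U (N \<Rrightarrow> N \<Rrightarrow> N)"
    using assms by (auto intro!: val_in)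
  have f: "val [] e ?f \<odot> a \<odot> b = val [] e t" if "a \<in> NN" "b \<in> NN" for a b
    using k that in_NN by (simp add: val.simps K_eq)
  show "val [] e (condz c s t) = (if val [] e c = \<zero> then val [] e s else val [] e t)"
    by (rule nat_cases[OF val_in[OF c assms(3)]]) (use k(2) f in_NN in \<open>auto simp: condz_def\<close>)
qed

lemma val_impc: "val [] e s = chi P \<Longrightarrow> val [] e t = chi Q \<Longrightarrow> val [] e (impc s t) = chi (P \<longrightarrow> Q)"
  by (simp add: impc_def)

section \<open>Standard objects\<close>

lemma st_cst [simp]: "st (cst c)"
proof -
  have "sem [] e0 (St (Con c))" by (rule P0_valid) (auto intro: P0.st_closed)
  then show ?thesis by (simp add: val.simps)
qed

lemma st_ap:
  assumes "f \<in> U (\<sigma> \<Rrightarrow> \<tau>)" "a \<in> U \<sigma>" "st f" "st a"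
  shows "st (f \<odot> a)"
proof -
  let ?x = "(0, \<sigma> \<Rrightarrow> \<tau>)" and ?y = "(1, \<sigma>)"
  have "sem [] (e0(?x := f, ?y := a)) (St (Free ?x) \<^bold>\<and> St (Free ?y) \<^bold>\<longrightarrow> St (Free ?x \<cdot> Free ?y))"
    by (rule P0_valid, rule P0.st_app) (use assms in auto)
  then show ?thesis using assms by simp
qed

definition std :: "ty \<Rightarrow> 'd set" where "std \<tau> = {a \<in> U \<tau>. st a}"

abbreviation NS :: "'d set" where "NS \<equiv> std N"

lemma std_in: "a \<in> std \<tau> \<Longrightarrow> a \<in> U \<tau>"
  by (simp add: std_def)

lemma std_ap: "f \<in> std (\<sigma> \<Rrightarrow> \<tau>) \<Longrightarrow> a \<in> std \<sigma> \<Longrightarrow> f \<odot> a \<in> std \<tau>"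
  using st_ap ap_in by (auto simp: std_def)

lemma std_cst: "cst c \<in> std (con_ty c)"
  by (simp add: std_def cst_in)

lemma val_std:
  assumes "\<And>x. x \<in> fv_tm t \<Longrightarrow> e x \<in> std (snd x)"
  shows "t \<Colon> \<tau> \<Longrightarrow> val [] e t \<in> std \<tau>"
  using assms
proof (induction t arbitrary: \<tau>)
  case (Con c)
  then show ?case using std_cst[of c] by (simp add: val.simps)
next
  case (App s t)
  then obtain \<sigma> where "s \<Colon> \<sigma> \<Rrightarrow> \<tau>" "t \<Colon> \<sigma>" by auto
  then show ?case using App by (auto simp: val.simps intro!: std_ap)
qed auto

lemma std_arith [simp]: "\<zero> \<in> NS" "a \<in> NS \<Longrightarrow> S a \<in> NS"
  using std_cst[of Zero] std_cst[of Succ] std_ap by (auto simp: Z_def S_def)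

lemma TRANS:
  assumes "f \<in> std T1" "\<And>n. n \<in> NS \<Longrightarrow> f \<odot> n \<noteq> \<zero>" "n \<in> NN"
  shows "f \<odot> n \<noteq> \<zero>"
proof -
  have "sem [] e0 Pi01_TRANS"
    by (rule valid) (auto simp: Pi01_TRANS_def Let_def intro!: wff_all_st wff_all)
  then show ?thesis using assms by (simp add: Pi01_TRANS_def Let_def std_def)
qed

lemma STP:
  assumes "a \<in> U T1" "\<And>n. n \<in> NN \<Longrightarrow> a \<odot> n \<ominus> \<one> = \<zero>"
  obtains b where "b \<in> std T1" "\<And>n. n \<in> NN \<Longrightarrow> b \<odot> n \<ominus> \<one> = \<zero>" "\<And>n. n \<in> NS \<Longrightarrow> b \<odot> n = a \<odot> n"
proof -
  have w: "wff (le1 (Free (n, T1)))" for n by (auto simp: le1_def intro!: wf_le)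
  have "wff STP"
    by (auto simp: STP_def Let_def w intro!: wff_ex_st wff_all wff_all_st)
  then have "sem [] e0 STP" by (intro valid) auto
  then have "\<exists>b \<in> U T1. st b \<and> (\<forall>n \<in> NN. b \<odot> n \<ominus> \<one> = \<zero>) \<and> (\<forall>n \<in> NN. st n \<longrightarrow> a \<odot> n = b \<odot> n)"
    using assms w by (simp add: STP_def Let_def le1_def le_def)
  then show ?thesis using that by (auto simp: std_def)
qed

lemma le_one_iff: "a \<in> NN \<Longrightarrow> a \<ominus> \<one> = \<zero> \<longleftrightarrow> a = \<zero> \<or> a = \<one>"
proof (rule nat_cases[of a])
  fix b assume b: "b \<in> NN" "a = S b" "a \<in> NN"
  have "S b \<ominus> \<one> = b" using b S_monus_S[of b \<zero>] by (simp del: monus_rec(2))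
  then show ?thesis using b by simp
qed auto

text \<open>The induction step is known at standard numbers only. Written as a standard 0-1 function
  it transfers to all numbers, and then the internal induction axiom applies.\<close>

lemma std_induct:
  assumes f: "f \<in> std T1" and zero: "f \<odot> \<zero> = \<one>"
    and step: "\<And>n. n \<in> NS \<Longrightarrow> f \<odot> n = \<one> \<Longrightarrow> f \<odot> S n = \<one>" and n: "n \<in> NN"
  shows "f \<odot> n = \<one>"
proof -
  let ?f = "Free (0, T1)" and ?n = "Free (0, N)"
  let ?t = "impc (eqc (?f \<cdot> ?n) one) (eqc (?f \<cdot> suc ?n) one)"
  define e where "e = e0((0, T1) := f)"
  have e: "env e" using f by (simp add: e_def std_def)
  define g where "g = val [] e (lam (0, N) ?t)"
  have g: "g \<in> std T1" unfolding g_def by (rule val_std) (use f in \<open>auto simp: e_def\<close>)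
  have gn: "g \<odot> n = chi (f \<odot> n = \<one> \<longrightarrow> f \<odot> S n = \<one>)" if "n \<in> NN" for n
    unfolding g_def using that e f by (simp add: val_impc) (simp add: e_def)
  have "g \<odot> n \<noteq> \<zero>" if "n \<in> NN" for n
    by (rule TRANS[OF g]) (use step gn std_in that in auto)
  then have imp: "f \<odot> n = \<one> \<longrightarrow> f \<odot> S n = \<one>" if "n \<in> NN" for n using that gn by metis
  show ?thesis
    by (rule eq_induct[where g = "\<lambda>n. f \<odot> n" and h = "\<lambda>n. \<one>"])
      (use imp zero n std_in[OF f] in \<open>auto intro!: rep_const\<close>)
qed

text \<open>A binary \<open>\<alpha>\<close> marking the numbers below \<open>m\<close> is standard on standard arguments; by induction it
  cannot be constant there, so \<open>m\<close> is the successor of the standard number where it drops.\<close>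

lemma std_initial:
  assumes n: "n \<in> NS" and m: "m \<in> NN" "m \<prec> n"
  shows "m \<in> NS"
proof (rule ccontr)
  assume not: "m \<notin> NS"
  let ?t = "ltc (Free (0, N)) (Free (1, N))"
  define a where "a = val [] (e0((1, N) := m)) (lam (0, N) ?t)"
  have a: "a \<in> U T1" unfolding a_def by (rule val_in) (use m in auto)
  have an: "a \<odot> k = chi (k \<prec> m)" if "k \<in> NN" for k unfolding a_def using that m by simp
  obtain b where b: "b \<in> std T1" "\<And>k. k \<in> NS \<Longrightarrow> b \<odot> k = a \<odot> k"
    using STP[OF a] an le_one_iff by (metis Z_in S_in)
  have "b \<odot> n = \<one>"
  proof (rule std_induct[OF b(1)])
    have "\<zero> \<prec> m" by (rule nat_cases[OF m(1)]) (use not in auto)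
    then show "b \<odot> \<zero> = \<one>" using b(2)[of \<zero>] an by simp
  next
    fix k assume k: "k \<in> NS" "b \<odot> k = \<one>"
    then have kN: "k \<in> NN" "k \<prec> m" using b(2)[of k] an[of k] std_in[of k N]
      by (auto split: if_splits)
    have "S k \<noteq> m" using k not std_arith(2) by blast
    then have "S k \<prec> m"
      using less_linear[of "S k" m] kN m less_S_iff[of m k] less_asym[of k m] by auto
    then show "b \<odot> S k = \<one>" using b(2)[of "S k"] an k kN by simp
  qed (use n std_in in blast)
  then have "n \<prec> m" using b(2)[OF n] an std_in[OF n] by (auto split: if_splits)
  then show False using less_asym m std_in[OF n] by blast
qed

section \<open>The search functional\<close>

definition L :: "ty \<Rightarrow> 'd \<Rightarrow> 'd" where "L \<sigma> s = cst (Len \<sigma>) \<odot> s"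
definition En :: "ty \<Rightarrow> 'd \<Rightarrow> 'd \<Rightarrow> 'd" where "En \<sigma> s i = cst (Entry \<sigma>) \<odot> s \<odot> i"

lemma val_seq [simp]:
  "val bs e (len \<sigma> s) = L \<sigma> (val bs e s)" "val bs e (entry \<sigma> s i) = En \<sigma> (val bs e s) (val bs e i)"
  by (simp_all add: L_def En_def val.simps)

lemma L_in: "s \<in> U (Seq \<sigma>) \<Longrightarrow> L \<sigma> s \<in> NN"
  unfolding L_def using ap_in[OF cst_in[of "Len \<sigma>", simplified]] .

lemma En_in: "s \<in> U (Seq \<sigma>) \<Longrightarrow> i \<in> NN \<Longrightarrow> En \<sigma> s i \<in> U \<sigma>"
  unfolding En_def using ap_in[OF ap_in[OF cst_in[of "Entry \<sigma>", simplified]]] .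

lemma L_std: "s \<in> std (Seq \<sigma>) \<Longrightarrow> L \<sigma> s \<in> NS"
  unfolding L_def using std_ap[OF std_cst[of "Len \<sigma>", simplified]] .

lemma En_std: "s \<in> std (Seq \<sigma>) \<Longrightarrow> i \<in> NS \<Longrightarrow> En \<sigma> s i \<in> std \<sigma>"
  unfolding En_def using std_ap[OF std_ap[OF std_cst[of "Entry \<sigma>", simplified]]] .

text \<open>\<open>eq_val\<close> concerns terms without dangling indices, whereas the equation
  inside \<open>mem\<close> refers to a bound position. Moving both values to fresh names makes it
  applicable, and the equation becomes an identity.\<close>

lemma sem_mem:
  assumes "env e" "t \<Colon> \<sigma>" "s \<Colon> Seq \<sigma>" "sem [] e (mem \<sigma> t s)"
  obtains i where "i \<in> NN" "i \<prec> L \<sigma> (val [] e s)" "val [] e t = En \<sigma> (val [] e s) i"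
proof -
  obtain i where i: "i \<in> NN" "i \<prec> L \<sigma> (val [] e s)"
    "sem [i] e (eq \<sigma> (lift t) (entry \<sigma> (lift s) (Bnd 0)))"
    using assms by (auto simp: mem_def val_lift)
  let ?x = "(0, \<sigma>)" and ?y = "(1, \<sigma>)"
  let ?e = "e(?x := val [] e t, ?y := En \<sigma> (val [] e s) i)"
  have "En \<sigma> (val [] e s) i \<in> U \<sigma>" "val [] e t \<in> U \<sigma>"
    using En_in i val_in assms by blast+
  then have "env ?e" using assms by simp
  moreover have "sem [] ?e (eq \<sigma> (Free ?x) (Free ?y))"
    using i(3) by (subst sem_eq_cong[of _ _ _ "[i]" e "lift t" _ "entry \<sigma> (lift s) (Bnd 0)"])
      (simp_all add: val_lift)
  ultimately have "val [] e t = En \<sigma> (val [] e s) i"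
    using eq_val[of ?e "Free ?x" \<sigma> "Free ?y"] by simp
  then show ?thesis using that i by blast
qed

lemma rep_recur: "rep \<sigma> N g \<Longrightarrow> a \<in> NN \<Longrightarrow> f \<in> U (N \<Rrightarrow> N \<Rrightarrow> N) \<Longrightarrow> rep \<sigma> N (\<lambda>k. recur (g k) a f)"
  unfolding recur_def using cst_in[of Rec0]
  by (auto intro!: rep_app[of \<sigma> "N \<Rrightarrow> N \<Rrightarrow> N" N] rep_app[of \<sigma> N "(N \<Rrightarrow> N \<Rrightarrow> N) \<Rrightarrow> N"]
      rep_app[of \<sigma> N "N \<Rrightarrow> (N \<Rrightarrow> N \<Rrightarrow> N) \<Rrightarrow> N"] rep_const)

text \<open>Conditional induction with the premise \<open>i \<prec> k\<close> written as the
  equation \<open>S i \<ominus> k = \<zero>\<close>. At a successor, either position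
  \<open>i\<close> was passed earlier or it is the one just passed.\<close>

lemma less_induct:
  assumes "rep N N g" "rep N N h" "i \<in> NN"
    and "\<And>k. k \<in> NN \<Longrightarrow> (i \<prec> k \<Longrightarrow> g k = h k) \<Longrightarrow> i \<prec> k \<or> i = k \<Longrightarrow> g (S k) = h (S k)"
    and "k \<in> NN" "i \<prec> k"
  shows "g k = h k"
  by (rule cond_induct[where g = "\<lambda>k. S i \<ominus> k" and h = "\<lambda>k. \<zero>" and g' = g and h' = h])
    (use assms less_S_iff[of i] in \<open>auto simp del: S_monus_S simp flip: less_def intro!: rep_const rep_arith\<close>)

text \<open>\<open>HAC_int\<close> accepts only internal formulas and needs a standard witness for
  every standard \<open>f\<close>. The implication "if \<open>f\<close> has a zero at all, then
  \<open>n\<close> is one" meets both demands: by transfer a standard \<open>f\<close> with a zero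
  has a standard zero, and otherwise any number will do.\<close>

lemma witness_candidates:
  obtains \<Phi> where "\<Phi> \<in> std (T1 \<Rrightarrow> Seq N)"
    "\<And>f n. f \<in> std T1 \<Longrightarrow> n \<in> NN \<Longrightarrow> f \<odot> n = \<zero> \<Longrightarrow>
      \<exists>i \<in> NN. i \<prec> L N (\<Phi> \<odot> f) \<and> f \<odot> En N (\<Phi> \<odot> f) i = \<zero>"
proof -
  let ?f = "(0, T1)" and ?n = "(0, N)" and ?m = "(1, N)" and ?F = "(0, T1 \<Rrightarrow> Seq N)"
  let ?B = "Eq (Free ?f \<cdot> Free ?m) zero"
  \<comment> \<open>The existential premise is not relativised to the standard numbers, which keeps
    the formula internal.\<close>
  let ?A = "ex ?m ?B \<^bold>\<longrightarrow> Eq (Free ?f \<cdot> Free ?n) zero"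
  let ?M = "mem N (Free ?n) (Free ?F \<cdot> Free ?f)"
  have wB: "wff ?B" by simp
  have wA: "wff ?A" using wff_ex[OF wB] by simp
  have wM: "wff ?M" by (rule has_ty_mem) auto
  have wMA: "wff (?M \<^bold>\<and> ?A)" using wM wA by simp
  have ax: "(all_st ?f (ex_st ?n ?A) \<^bold>\<longrightarrow> ex_st ?F (all_st ?f (ex ?n (?M \<^bold>\<and> ?A)))) \<in> P0"
    by (rule P0.hac_int) (use wA in \<open>auto simp: fv_ex\<close>)
  have "wff (all_st ?f (ex_st ?n ?A) \<^bold>\<longrightarrow> ex_st ?F (all_st ?f (ex ?n (?M \<^bold>\<and> ?A))))"
    using wff_all_st[OF wff_ex_st[OF wA]] wff_ex_st[OF wff_all_st[OF wff_ex[OF wMA]]]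
    by (simp only: wf_fm.simps)
  note imp = P0_valid[OF ax this env_e0, unfolded sem.simps]
  have A: "sem [] e ?A \<longleftrightarrow> ((\<exists>d \<in> NN. e ?f \<odot> d = \<zero>) \<longrightarrow> e ?f \<odot> e ?n = \<zero>)" for e
    using wB by simp
  have "\<exists>n \<in> NN. st n \<and> ((\<exists>d \<in> NN. f \<odot> d = \<zero>) \<longrightarrow> f \<odot> n = \<zero>)" if "f \<in> std T1" for f
  proof (cases "\<exists>d \<in> NN. f \<odot> d = \<zero>")
    case True
    then have "\<exists>n \<in> NS. f \<odot> n = \<zero>" using TRANS[OF that] by blast
    then show ?thesis by (auto simp: std_def)
  next
    case False
    then show ?thesis using std_arith(1) by (auto simp: std_def)
  qed
  then have "sem [] e0 (all_st ?f (ex_st ?n ?A))"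
    unfolding sem_all_st[OF wff_ex_st[OF wA]] sem_ex_st[OF wA] A by (simp add: std_def)
  then have "sem [] e0 (ex_st ?F (all_st ?f (ex ?n (?M \<^bold>\<and> ?A))))" using imp by blast
  then have "\<exists>\<Phi> \<in> U (T1 \<Rrightarrow> Seq N). st \<Phi> \<and> (\<forall>f \<in> U T1. st f \<longrightarrow> (\<exists>n \<in> NN.
      sem [] (e0(?F := \<Phi>, ?f := f, ?n := n)) ?M \<and> ((\<forall>d \<in> NN. f \<odot> d \<noteq> \<zero>) \<or> f \<odot> n = \<zero>)))"
    unfolding sem_ex_st[OF wff_all_st[OF wff_ex[OF wMA]]] sem_all_st[OF wff_ex[OF wMA]]
      sem_ex[OF wMA] by (simp add: wM)
  then obtain \<Phi> where \<Phi>: "\<Phi> \<in> std (T1 \<Rrightarrow> Seq N)" "\<And>f. f \<in> std T1 \<Longrightarrow>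
     \<exists>n \<in> NN. sem [] (e0(?F := \<Phi>, ?f := f, ?n := n)) ?M \<and>
       ((\<exists>d \<in> NN. f \<odot> d = \<zero>) \<longrightarrow> f \<odot> n = \<zero>)"
    unfolding std_def by blast
  show ?thesis
  proof (rule that[OF \<Phi>(1)])
    fix f n assume f: "f \<in> std T1" "n \<in> NN" "f \<odot> n = \<zero>"
    then obtain m where m: "m \<in> NN" "sem [] (e0(?F := \<Phi>, ?f := f, ?n := m)) ?M" "f \<odot> m = \<zero>"
      using \<Phi>(2) by blast
    let ?e = "e0(?F := \<Phi>, ?f := f, ?n := m)"
    have "env ?e" using \<Phi>(1) f(1) m(1) by (simp add: std_def)
    from sem_mem[OF this _ _ m(2)] show "\<exists>i \<in> NN. i \<prec> L N (\<Phi> \<odot> f) \<and> f \<odot> En N (\<Phi> \<odot> f) i = \<zero>"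
      using m(3) by auto
  qed
qed

text \<open>Choice returns only a finite list of candidates. The recursor runs through it and keeps
  the latest entry at which \<open>f\<close> vanishes, starting from zero; once a zero has been met,
  the kept value remains one.\<close>

lemma search:
  obtains \<mu> where "\<mu> \<in> std (T1 \<Rrightarrow> N)"
    "\<And>f n. f \<in> std T1 \<Longrightarrow> n \<in> NN \<Longrightarrow> f \<odot> n = \<zero> \<Longrightarrow> f \<odot> (\<mu> \<odot> f) = \<zero>"
proof -
  obtain \<Phi> where \<Phi>: "\<Phi> \<in> std (T1 \<Rrightarrow> Seq N)"
    "\<And>f n. f \<in> std T1 \<Longrightarrow> n \<in> NN \<Longrightarrow> f \<odot> n = \<zero> \<Longrightarrow>
      \<exists>i \<in> NN. i \<prec> L N (\<Phi> \<odot> f) \<and> f \<odot> En N (\<Phi> \<odot> f) i = \<zero>"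
    using witness_candidates by blast
  let ?f = "(0, T1)" and ?v = "(0, N)" and ?i = "(1, N)" and ?F = "(0, T1 \<Rrightarrow> Seq N)"
  let ?E = "entry N (Free ?F \<cdot> Free ?f) (Free ?i)"
  let ?step = "lam ?v (lam ?i (condz (Free ?f \<cdot> ?E) ?E (Free ?v)))"
  let ?t = "lam ?f (rec0 (len N (Free ?F \<cdot> Free ?f)) zero ?step)"
  define e where "e = e0(?F := \<Phi>)"
  define \<mu> where "\<mu> = val [] e ?t"
  have \<mu>: "\<mu> \<in> std (T1 \<Rrightarrow> N)" unfolding \<mu>_def by (rule val_std) (use \<Phi>(1) e_def in auto)
  show ?thesis
  proof (rule that[OF \<mu>])
    fix f n assume f: "f \<in> std T1" "n \<in> NN" "f \<odot> n = \<zero>"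
    then obtain i where i: "i \<in> NN" "i \<prec> L N (\<Phi> \<odot> f)" "f \<odot> En N (\<Phi> \<odot> f) i = \<zero>"
      using \<Phi>(2) by blast
    have in_U: "f \<in> U T1" "\<Phi> \<in> U (T1 \<Rrightarrow> Seq N)" using std_in f \<Phi>(1) by blast+
    then have seq: "\<Phi> \<odot> f \<in> U (Seq N)" by (rule ap_in[rotated])
    define s where "s = val [] (e(?f := f)) ?step"
    have e: "env (e(?f := f))" using in_U e_def by simp
    have s: "s \<in> U (N \<Rrightarrow> N \<Rrightarrow> N)" unfolding s_def by (rule val_in) (use e in auto)
    have s_eq: "s \<odot> v \<odot> k = (if f \<odot> En N (\<Phi> \<odot> f) k = \<zero> then En N (\<Phi> \<odot> f) k else v)"
      if "v \<in> NN" "k \<in> NN" for v k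
      unfolding s_def using that e by (simp add: e_def)
    have "f \<odot> recur (L N (\<Phi> \<odot> f)) \<zero> s = \<zero>"
      by (rule less_induct[where i = i and g = "\<lambda>k. f \<odot> recur k \<zero> s" and h = "\<lambda>k. \<zero>"])
        (use i s s_eq in_U seq L_in in \<open>auto intro!: rep_const rep_recur rep_fun\<close>)
    moreover have "\<mu> \<odot> f = recur (L N (\<Phi> \<odot> f)) \<zero> s"
      unfolding \<mu>_def using in_U by (simp add: e_def) (simp add: s_def e_def)
    ultimately show "f \<odot> (\<mu> \<odot> f) = \<zero>" by simp
  qed
qed

end

section \<open>The second-order structure of standard sets\<close>

lemma nt_tm_typed [simp]: "nt_tm t \<Colon> \<tau> \<longleftrightarrow> \<tau> = N"
  by (induction t) auto

lemma fv_nt_tm: "fv_tm (nt_tm t) = (\<lambda>x. (x, N)) ` vars_nt t"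
  by (induction t) auto

lemma wff_le1_st: "wff (le1_st (Free (X, T1)))"
  by (auto simp: le1_st_def intro!: wf_le)

lemma wff_rel_st [simp]: "wff (rel_st A)"
proof (induction A)
  case (LBAll x t A)
  then show ?case
    using wf_close[of "[]" "rel_st A" "(x, N)"] has_ty_closed[of "nt_tm t" N "[N]"] by simp
qed (auto simp: wff_le1_st)

text \<open>The variable \<open>(0, T1 \<Rrightarrow> N)\<close> is reserved for a functional \<open>\<mu>\<close> that finds zeros: with \<open>f\<close> the
  characteristic function of \<open>A\<close>, the formula \<open>\<forall>x A\<close> has the truth value \<open>f (\<mu> f)\<close>.\<close>

primrec chr :: "l2 \<Rightarrow> tm" where
  "chr (LEq s t) = eqc (nt_tm s) (nt_tm t)"
| "chr (LLt s t) = ltc (nt_tm s) (nt_tm t)"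
| "chr (LMem t X) = eqc (Free (X, T1) \<cdot> nt_tm t) one"
| "chr LFls = zero"
| "chr (LImp A B) = impc (chr A) (chr B)"
| "chr (LBAll x t A) =
    (let f = (0, T1); b = (0, N); y = (1, N); \<mu> = Free (0, T1 \<Rrightarrow> N);
       g = lam y (impc (ltc (Free y) (Free b)) (Free f \<cdot> Free y))
     in lam b (lam f (g \<cdot> (\<mu> \<cdot> g))) \<cdot> nt_tm t \<cdot> lam (x, N) (chr A))"
| "chr (LAllN x A) = lam (x, N) (chr A) \<cdot> (Free (0, T1 \<Rrightarrow> N) \<cdot> lam (x, N) (chr A))"
| "chr (LAllS X A) = zero"

lemma chr_typed [simp]: "chr A \<Colon> \<tau> \<longleftrightarrow> \<tau> = N"
  by (induction A arbitrary: \<tau>) (auto simp: Let_def)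

context nonstd_model
begin

primrec nval :: "(nat \<Rightarrow> 'd) \<Rightarrow> nt \<Rightarrow> 'd" where
  "nval e (NVar x) = e x"
| "nval e NZero = \<zero>"
| "nval e NOne = \<one>"
| "nval e (NAdd s t) = nval e s \<oplus> nval e t"
| "nval e (NMul s t) = nval e s \<otimes> nval e t"

text \<open>Boundedness is required at standard arguments only, in agreement with
  \<open>le1_st\<close> in the relativised set quantifier.\<close>

definition SS :: "'d set" where "SS = {X \<in> std T1. \<forall>n \<in> NS. X \<odot> n = \<zero> \<or> X \<odot> n = \<one>}"

primrec sat :: "(nat \<Rightarrow> 'd) \<Rightarrow> (nat \<Rightarrow> 'd) \<Rightarrow> l2 \<Rightarrow> bool" where
  "sat e s (LEq t u) \<longleftrightarrow> nval e t = nval e u"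
| "sat e s (LLt t u) \<longleftrightarrow> nval e t \<prec> nval e u"
| "sat e s (LMem t X) \<longleftrightarrow> s X \<odot> nval e t = \<one>"
| "sat e s LFls \<longleftrightarrow> False"
| "sat e s (LImp A B) \<longleftrightarrow> (sat e s A \<longrightarrow> sat e s B)"
| "sat e s (LBAll x t A) \<longleftrightarrow> (\<forall>a \<in> NN. a \<prec> nval e t \<longrightarrow> sat (e(x := a)) s A)"
| "sat e s (LAllN x A) \<longleftrightarrow> (\<forall>a \<in> NS. sat (e(x := a)) s A)"
| "sat e s (LAllS X A) \<longleftrightarrow> (\<forall>W \<in> SS. sat e (s(X := W)) A)"

lemma nval_cong: "(\<And>x. x \<in> vars_nt t \<Longrightarrow> e x = e' x) \<Longrightarrow> nval e t = nval e' t"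
  by (induction t) auto

lemma sat_cong:
  "(\<And>x. x \<in> free_num A \<Longrightarrow> e x = e' x) \<Longrightarrow> (\<And>X. X \<in> free_set A \<Longrightarrow> s X = s' X) \<Longrightarrow>
   sat e s A = sat e' s' A"
proof (induction A arbitrary: e e' s s')
  case (LEq t u)
  then show ?case using nval_cong[of t e e'] nval_cong[of u e e'] by simp
next
  case (LLt t u)
  then show ?case using nval_cong[of t e e'] nval_cong[of u e e'] by simp
next
  case (LMem t X)
  then show ?case using nval_cong[of t e e'] by simp
next
  case (LImp A B)
  have "sat e s A = sat e' s' A" "sat e s B = sat e' s' B"
    by (rule LImp.IH; use LImp.prems in simp)+
  then show ?case by simp
next
  case (LBAll x t A)
  have "sat (e(x := a)) s A = sat (e'(x := a)) s' A" for a
    by (rule LBAll.IH) (use LBAll.prems in auto)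
  then show ?case using nval_cong[of t e e'] LBAll.prems by simp
next
  case (LAllN x A)
  have "sat (e(x := a)) s A = sat (e'(x := a)) s' A" for a
    by (rule LAllN.IH) (use LAllN.prems in auto)
  then show ?case by simp
next
  case (LAllS X A)
  have "sat e (s(X := a)) A = sat e' (s'(X := a)) A" for a
    by (rule LAllS.IH) (use LAllS.prems in auto)
  then show ?case by simp
qed simp

lemma val_nt_tm: "val [] e (nt_tm t) = nval (\<lambda>x. e (x, N)) t"
  by (induction t) auto

lemma sem_le1_st: "s \<in> U T1 \<Longrightarrow> sem [] (e((X, T1) := s)) (le1_st (Free (X, T1))) \<longleftrightarrow>
   (\<forall>n \<in> NS. s \<odot> n = \<zero> \<or> s \<odot> n = \<one>)"
  using le_one_iff[OF ap_in[of s N N]] by (auto simp: le1_st_def le_def std_def)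

lemma sem_rel_st:
  "env e \<Longrightarrow> sem [] e (rel_st A) \<longleftrightarrow> sat (\<lambda>x. e (x, N)) (\<lambda>X. e (X, T1)) A"
proof (induction A arbitrary: e)
  case (LMem t X)
  then show ?case by (simp add: val_nt_tm)
next
  case (LBAll x t A)
  have "sem [d] e (close 0 (x, N) (rel_st A)) \<longleftrightarrow>
      sat ((\<lambda>x. e (x, N))(x := d)) (\<lambda>X. e (X, T1)) A" if "d \<in> NN" for d
  proof -
    have "sem [d] e (close 0 (x, N) (rel_st A)) = sem [] (e((x, N) := d)) (rel_st A)"
      using sem_close[of "[]" "rel_st A" "[]" d e "(x, N)"] by simp
    moreover have "sem [] (e((x, N) := d)) (rel_st A) \<longleftrightarrow>
        sat (\<lambda>y. (e((x, N) := d)) (y, N)) (\<lambda>X. (e((x, N) := d)) (X, T1)) A"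
      using LBAll.prems that by (intro LBAll.IH[of "e((x, N) := d)"] env_upd) simp_all
    moreover have "(\<lambda>y. (e((x, N) := d)) (y, N)) = (\<lambda>x. e (x, N))(x := d)" by auto
    ultimately show ?thesis by simp
  qed
  moreover have "val [d] e (nt_tm t) = nval (\<lambda>x. e (x, N)) t" for d
    using val_closed[of "nt_tm t" N] val_nt_tm by simp
  ultimately show ?case by simp
next
  case (LAllN x A)
  have "sem [] (e((x, N) := d)) (rel_st A) \<longleftrightarrow>
      sat ((\<lambda>x. e (x, N))(x := d)) (\<lambda>X. e (X, T1)) A" if "d \<in> NN" for d
  proof -
    have "sem [] (e((x, N) := d)) (rel_st A) \<longleftrightarrow>
        sat (\<lambda>y. (e((x, N) := d)) (y, N)) (\<lambda>X. (e((x, N) := d)) (X, T1)) A"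
      using LAllN.prems that by (intro LAllN.IH[of "e((x, N) := d)"] env_upd) simp_all
    moreover have "(\<lambda>y. (e((x, N) := d)) (y, N)) = (\<lambda>x. e (x, N))(x := d)" by auto
    ultimately show ?thesis by simp
  qed
  then show ?case by (auto simp: std_def)
next
  case (LAllS X A)
  have "sem [] (e((X, T1) := d)) (rel_st A) \<longleftrightarrow>
      sat (\<lambda>x. e (x, N)) ((\<lambda>x. e (x, T1))(X := d)) A" if "d \<in> U T1" for d
  proof -
    have "sem [] (e((X, T1) := d)) (rel_st A) \<longleftrightarrow>
        sat (\<lambda>y. (e((X, T1) := d)) (y, N)) (\<lambda>Y. (e((X, T1) := d)) (Y, T1)) A"
      using LAllS.prems that by (intro LAllS.IH[of "e((X, T1) := d)"] env_upd) simp_all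
    moreover have "(\<lambda>y. (e((X, T1) := d)) (y, T1)) = (\<lambda>x. e (x, T1))(X := d)" by auto
    ultimately show ?thesis by simp
  qed
  then show ?case using wff_le1_st[of X] sem_le1_st[of _ e X] by (auto simp: std_def SS_def)
qed (simp_all add: val_nt_tm)

definition search_fun :: 'd ("\<mu>") where
  "\<mu> = (SOME m. m \<in> std (T1 \<Rrightarrow> N) \<and>
    (\<forall>f \<in> std T1. \<forall>n \<in> NN. f \<odot> n = \<zero> \<longrightarrow> f \<odot> (m \<odot> f) = \<zero>))"

lemma search_fun: "\<mu> \<in> std (T1 \<Rrightarrow> N)"
  "f \<in> std T1 \<Longrightarrow> n \<in> NN \<Longrightarrow> f \<odot> n = \<zero> \<Longrightarrow> f \<odot> (\<mu> \<odot> f) = \<zero>"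
proof -
  obtain m where "m \<in> std (T1 \<Rrightarrow> N) \<and>
    (\<forall>f \<in> std T1. \<forall>n \<in> NN. f \<odot> n = \<zero> \<longrightarrow> f \<odot> (m \<odot> f) = \<zero>)"
    using search by metis
  then have "\<mu> \<in> std (T1 \<Rrightarrow> N) \<and> (\<forall>f \<in> std T1. \<forall>n \<in> NN. f \<odot> n = \<zero> \<longrightarrow> f \<odot> (\<mu> \<odot> f) = \<zero>)"
    unfolding search_fun_def by (rule someI)
  then show "\<mu> \<in> std (T1 \<Rrightarrow> N)" "f \<in> std T1 \<Longrightarrow> n \<in> NN \<Longrightarrow> f \<odot> n = \<zero> \<Longrightarrow> f \<odot> (\<mu> \<odot> f) = \<zero>"
    by blast+
qed

text \<open>The position \<open>\<mu> \<odot> f\<close> is itself standard, so if \<open>P\<close>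
  holds at all standard numbers it holds there as well; if \<open>P\<close> fails somewhere, the
  search ends at a zero.\<close>

lemma search_chi:
  assumes "f \<in> std T1" "\<And>a. a \<in> NS \<Longrightarrow> f \<odot> a = chi (P a)"
  shows "f \<odot> (\<mu> \<odot> f) = chi (\<forall>a \<in> NS. P a)"
proof -
  have m: "\<mu> \<odot> f \<in> NS" using std_ap search_fun(1) assms(1) by blast
  show ?thesis
  proof (cases "\<forall>a \<in> NS. P a")
    case True
    then show ?thesis using assms(2)[OF m] m by simp
  next
    case False
    then obtain a where a: "a \<in> NS" "\<not> P a" by blast
    then have "f \<odot> a = \<zero>" using assms(2) by simp
    then have "f \<odot> (\<mu> \<odot> f) = \<zero>" by (rule search_fun(2)[OF assms(1) std_in[OF a(1)]])
    then show ?thesis using False by simp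
  qed
qed

definition senv :: "(var \<Rightarrow> 'd) \<Rightarrow> bool" where
  "senv e \<longleftrightarrow> (\<forall>x. e x \<in> std (snd x)) \<and> e (0, T1 \<Rrightarrow> N) = \<mu>"

lemma senv_env: "senv e \<Longrightarrow> env e"
  using std_in by (auto simp: senv_def env_def)

lemma senv_upd [simp]: "senv e \<Longrightarrow> x \<noteq> (0, T1 \<Rrightarrow> N) \<Longrightarrow> d \<in> std (snd x) \<Longrightarrow> senv (e(x := d))"
  unfolding senv_def by auto

lemma senv_val: "senv e \<Longrightarrow> t \<Colon> \<tau> \<Longrightarrow> val [] e t \<in> std \<tau>"
  by (rule val_std) (auto simp: senv_def)

lemma nval_std: "(\<And>x. e x \<in> NS) \<Longrightarrow> nval e t \<in> NS"
  using val_std[of "nt_tm t" "\<lambda>x. e (fst x)" N] fv_nt_tm[of t] val_nt_tm[of "\<lambda>x. e (fst x)" t]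
  by (auto simp: image_iff)

text \<open>In the bounded case the bound and the characteristic function are passed as arguments to
  an abstraction. Substituting them directly would allow the search variable \<open>(1, N)\<close>
  to capture variables of the formula.\<close>

lemma val_chr:
  "arithmetical A \<Longrightarrow> senv e \<Longrightarrow>
   val [] e (chr A) = chi (sat (\<lambda>x. e (x, N)) (\<lambda>X. e (X, T1)) A)"
proof (induction A arbitrary: e)
  case (LEq s t)
  then show ?case by (simp add: senv_env val_nt_tm)
next
  case (LLt s t)
  then show ?case by (simp add: senv_env val_nt_tm)
next
  case (LMem t X)
  then show ?case by (simp add: senv_env val_nt_tm)
next
  case (LImp A B)
  then show ?case by (simp add: val_impc)
next
  case (LBAll x t A)
  let ?P = "\<lambda>a. sat ((\<lambda>x. e (x, N))(x := a)) (\<lambda>X. e (X, T1)) A"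
  let ?b = "nval (\<lambda>x. e (x, N)) t" and ?f = "val [] e (lam (x, N) (chr A))"
  let ?g = "lam (1, N) (impc (ltc (Free (1, N)) (Free (0, N))) (Free (0, T1) \<cdot> Free (1, N)))"
  have f: "?f \<in> std T1" by (rule senv_val) (use LBAll in auto)
  have "?f \<odot> a = chi (?P a)" if "a \<in> NS" for a
  proof -
    have "(\<lambda>y. (e((x, N) := a)) (y, N)) = (\<lambda>x. e (x, N))(x := a)" by auto
    then show ?thesis using LBAll that std_in[OF that] by (simp add: senv_env)
  qed
  moreover have b: "?b \<in> NS" using LBAll by (intro nval_std) (auto simp: senv_def)
  moreover define e' where "e' = e((0, N) := ?b, (0, T1) := ?f)"
  have e': "senv e'" using LBAll f b by (simp add: e'_def)
  ultimately have fa: "e' (0, T1) \<odot> a = chi (?P a)" if "a \<in> NS" for a using that by (simp add: e'_def)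
  have "val [] e' ?g \<odot> a = chi (a \<prec> ?b \<longrightarrow> ?P a)" if "a \<in> NS" for a
  proof -
    have "val [] (e'((1, N) := a)) (impc (ltc (Free (1, N)) (Free (0, N))) (Free (0, T1) \<cdot> Free (1, N)))
        = chi (a \<prec> ?b \<longrightarrow> ?P a)"
      by (rule val_impc)
        (use that std_in[OF that] senv_env[OF e'] fa[OF that] in \<open>simp_all add: e'_def\<close>)
    then show ?thesis using that std_in[OF that] senv_env[OF e'] by simp
  qed
  then have "val [] e' (?g \<cdot> (Free (0, T1 \<Rrightarrow> N) \<cdot> ?g)) = chi (\<forall>a \<in> NS. a \<prec> ?b \<longrightarrow> ?P a)"
    using search_chi[OF senv_val[OF e', of ?g]] e' by (simp add: val.simps senv_def)
  then have "val [] e (chr (LBAll x t A)) = chi (\<forall>a \<in> NS. a \<prec> ?b \<longrightarrow> ?P a)"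
    using LBAll f b std_in by (simp add: Let_def val_App senv_env val_nt_tm e'_def)
  \<comment> \<open>The search decides the quantifier over standard numbers below the bound; the
    bounded quantifier ranges over all of them. The two agree because numbers below a standard
    number are standard.\<close>
  then show ?case using std_initial[OF b] std_in by auto
next
  case (LAllN x A)
  let ?f = "val [] e (lam (x, N) (chr A))"
  have f: "?f \<in> std T1" by (rule senv_val) (use LAllN in auto)
  have "?f \<odot> a = chi (sat ((\<lambda>x. e (x, N))(x := a)) (\<lambda>X. e (X, T1)) A)" if "a \<in> NS" for a
  proof -
    have "(\<lambda>y. (e((x, N) := a)) (y, N)) = (\<lambda>x. e (x, N))(x := a)" by auto
    then show ?thesis using LAllN that std_in[OF that] by (simp add: senv_env)
  qed
  from search_chi[OF f this] show ?case
    using LAllN.prems by (simp add: senv_def)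
qed auto

section \<open>Comprehension and extensionality for standard sets\<close>

definition mk_env :: "(nat \<Rightarrow> 'd) \<Rightarrow> (nat \<Rightarrow> 'd) \<Rightarrow> var \<Rightarrow> 'd" where
  "mk_env e s = (\<lambda>(x, \<tau>). if \<tau> = N then e x else if \<tau> = T1 then s x
     else if \<tau> = T1 \<Rrightarrow> N then \<mu> else e0 (x, \<tau>))"

lemma e0_std: "e0 x \<in> std (snd x)"
proof -
  have "fv_tm (zero_tm \<tau>) = {}" for \<tau> by (induction \<tau>) auto
  then show ?thesis unfolding e0_def by (intro val_std zero_tm_typed) auto
qed

lemma mk_env [simp]: "mk_env e s (x, N) = e x" "mk_env e s (X, T1) = s X"
  by (simp_all add: mk_env_def)

lemma senv_mk_env: "(\<And>x. e x \<in> NS) \<Longrightarrow> (\<And>X. s X \<in> std T1) \<Longrightarrow> senv (mk_env e s)"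
  using search_fun(1) e0_std by (auto simp: senv_def mk_env_def)

lemma SS_std: "X \<in> SS \<Longrightarrow> X \<in> std T1" "X \<in> SS \<Longrightarrow> X \<in> U T1"
  using std_in by (auto simp: SS_def)

text \<open>Abstracting the set variable as well makes the characteristic function uniform in a set.
  A property of arbitrary standard sets thereby becomes a term, which can be used inside an internal
  formula.\<close>

lemma comprehension_functional:
  assumes A: "arithmetical A" and es: "\<And>x. e x \<in> NS" "\<And>X. s X \<in> std T1"
  obtains G where "G \<in> std (T1 \<Rrightarrow> N \<Rrightarrow> N)"
    "\<And>W a. W \<in> std T1 \<Longrightarrow> a \<in> NS \<Longrightarrow> G \<odot> W \<odot> a = chi (sat (e(n := a)) (s(Y := W)) A)"
proof
  let ?t = "lam (Y, T1) (lam (n, N) (chr A))" and ?e = "mk_env e s"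
  have e: "senv ?e" using es by (rule senv_mk_env)
  show "val [] ?e ?t \<in> std (T1 \<Rrightarrow> N \<Rrightarrow> N)" by (rule senv_val[OF e]) simp
  fix W a assume W: "W \<in> std T1" "a \<in> NS"
  let ?e' = "?e((Y, T1) := W, (n, N) := a)"
  have "(\<lambda>x. ?e' (x, N)) = e(n := a)" "(\<lambda>X. ?e' (X, T1)) = s(Y := W)" by auto
  moreover have "senv ?e'" using e W by simp
  ultimately show "val [] ?e ?t \<odot> W \<odot> a = chi (sat (e(n := a)) (s(Y := W)) A)"
    using W std_in[OF W(1)] std_in[OF W(2)] val_chr[OF A, of ?e'] senv_env[OF e] by simp
qed

lemma comprehension:
  assumes A: "arithmetical A" and es: "\<And>x. e x \<in> NS" "\<And>X. s X \<in> SS"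
  shows "\<exists>W \<in> SS. \<forall>a \<in> NS. W \<odot> a = \<one> \<longleftrightarrow> sat (e(n := a)) s A"
proof -
  obtain G where G: "G \<in> std (T1 \<Rrightarrow> N \<Rrightarrow> N)"
    "\<And>W a. W \<in> std T1 \<Longrightarrow> a \<in> NS \<Longrightarrow> G \<odot> W \<odot> a = chi (sat (e(n := a)) (s(0 := W)) A)"
    by (rule comprehension_functional[OF A, where e = e and s = s and n = n and Y = 0]) (use es SS_std in auto)
  \<comment> \<open>The functional is applied to the current value of set variable 0, so singling
    out this variable changes nothing.\<close>
  have s: "s(0 := s 0) = s" by simp
  have "G \<odot> s 0 \<in> std T1" using std_ap[OF G(1)] SS_std(1)[OF es(2)] by blast
  moreover have "G \<odot> s 0 \<odot> a = chi (sat (e(n := a)) s A)" if "a \<in> NS" for a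
    using G(2)[OF SS_std(1)[OF es(2)] that, of 0] s by simp
  ultimately show ?thesis by (intro bexI[of _ "G \<odot> s 0"]) (auto simp: SS_def)
qed

text \<open>Agreement at standard numbers transfers to all numbers, and equality at type 1 is
  identity in the model. Standard sets with the same standard members are therefore one
  object.\<close>

lemma SS_eqI:
  assumes "X \<in> SS" "Y \<in> SS" "\<And>a. a \<in> NS \<Longrightarrow> X \<odot> a = \<one> \<longleftrightarrow> Y \<odot> a = \<one>"
  shows "X = Y"
proof -
  let ?t = "eqc (Free (0, T1) \<cdot> Free (0, N)) (Free (1, T1) \<cdot> Free (0, N))"
  let ?e = "e0((0, T1) := X, (1, T1) := Y)"
  define f where "f = val [] ?e (lam (0, N) ?t)"
  have f: "f \<in> std T1" unfolding f_def by (rule val_std) (use assms SS_std in auto)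
  have e: "env ?e" using assms SS_std by simp
  have fn: "f \<odot> a = chi (X \<odot> a = Y \<odot> a)" if "a \<in> NN" for a
    unfolding f_def using e that by simp
  have "f \<odot> a \<noteq> \<zero>" if "a \<in> NN" for a
  proof (rule TRANS[OF f _ that])
    fix n assume n: "n \<in> NS"
    then have "X \<odot> n = \<zero> \<or> X \<odot> n = \<one>" "Y \<odot> n = \<zero> \<or> Y \<odot> n = \<one>"
      using assms(1,2) unfolding SS_def by blast+
    then have "X \<odot> n = Y \<odot> n" using assms(3)[OF n] by auto
    then show "f \<odot> n \<noteq> \<zero>" using fn std_in[OF n] by simp
  qed
  then have "\<forall>a \<in> NN. X \<odot> a = Y \<odot> a" using fn by metis
  then show ?thesis
    using eq_val[of ?e "Free (0, T1)" T1 "Free (1, T1)"] e by (simp add: val.simps)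
qed

end

section \<open>Well-orderings\<close>

definition pairc :: "tm \<Rightarrow> tm \<Rightarrow> tm" where
  "pairc s t = plus_tm \<cdot> (times_tm \<cdot> (plus_tm \<cdot> s \<cdot> t) \<cdot> (plus_tm \<cdot> s \<cdot> t)) \<cdot> s"

lemma pairc [simp]: "pairc s t \<Colon> \<tau> \<longleftrightarrow> \<tau> = N \<and> s \<Colon> N \<and> t \<Colon> N"
  "fv_tm (pairc s t) = fv_tm s \<union> fv_tm t"
  by (auto simp: pairc_def)

context nonstd_model
begin

lemma val_pairc [simp]: "val bs e (pairc s t) = pair (val bs e s) (val bs e t)"
  by (simp add: pairc_def pair_def)

lemma nval_npair [simp]: "nval e (npair s t) = pair (nval e s) (nval e t)"
  by (simp add: npair_def pair_def)

lemma pair_std [simp]: "a \<in> NS \<Longrightarrow> b \<in> NS \<Longrightarrow> pair a b \<in> NS"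
  using nval_std[of "\<lambda>x. if x = 0 then a else b" "npair (NVar 0) (NVar 1)"] by simp

abbreviation is_mem :: "'d \<Rightarrow> 'd \<Rightarrow> bool" (infix "\<epsilon>" 50) where "a \<epsilon> Y \<equiv> Y \<odot> a = \<one>"
abbreviation ole :: "'d \<Rightarrow> 'd \<Rightarrow> 'd \<Rightarrow> bool" where "ole R i j \<equiv> pair i j \<epsilon> R"
abbreviation olt :: "'d \<Rightarrow> 'd \<Rightarrow> 'd \<Rightarrow> bool" where "olt R i j \<equiv> ole R i j \<and> \<not> ole R j i"

text \<open>The characteristic function of the negated formula vanishes exactly at the standard
  witnesses, so the search functional finds one whenever there is one.\<close>

lemma choice:
  assumes A: "arithmetical A" and es: "\<And>x. e x \<in> NS" "\<And>X. s X \<in> SS" and "n \<noteq> m"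
  shows "\<exists>D \<in> std T1. \<forall>a \<in> NS. \<forall>b \<in> NS.
    sat (e(n := a, m := b)) s A \<longrightarrow> sat (e(n := a, m := D \<odot> a)) s A"
proof -
  let ?h = "lam (m, N) (impc (chr A) zero)" and ?e = "mk_env e s"
  let ?D = "lam (n, N) (Free (0, T1 \<Rrightarrow> N) \<cdot> ?h)"
  have e: "senv ?e" using senv_mk_env es SS_std by blast
  have D: "val [] ?e ?D \<in> std T1" by (rule senv_val[OF e]) simp
  have "sat (e(n := a, m := val [] ?e ?D \<odot> a)) s A"
    if ab: "a \<in> NS" "b \<in> NS" "sat (e(n := a, m := b)) s A" for a b
  proof -
    let ?ea = "?e((n, N) := a)"
    have ea: "senv ?ea" using e ab by simp
    have h: "val [] ?ea ?h \<in> std T1" by (rule senv_val[OF ea]) simp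
    have hc: "val [] ?ea ?h \<odot> c = chi (\<not> sat (e(n := a, m := c)) s A)" if c: "c \<in> NS" for c
    proof -
      let ?ec = "?ea((m, N) := c)"
      have "senv ?ec" using ea c by simp
      moreover have "(\<lambda>x. ?ec (x, N)) = e(n := a, m := c)" "(\<lambda>X. ?ec (X, T1)) = s" by auto
      ultimately have "val [] ?ec (impc (chr A) zero) = chi (sat (e(n := a, m := c)) s A \<longrightarrow> False)"
        by (intro val_impc) (simp_all add: val_chr[OF A])
      then show ?thesis using senv_env[OF ea] std_in[OF c] by simp
    qed
    have "val [] ?e ?D \<odot> a = \<mu> \<odot> val [] ?ea ?h"
      using senv_env[OF e] std_in[OF ab(1)] ea by (simp add: senv_def)
    moreover have "\<mu> \<odot> val [] ?ea ?h \<in> NS" using std_ap[OF search_fun(1) h] .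
    moreover have "val [] ?ea ?h \<odot> (\<mu> \<odot> val [] ?ea ?h) = \<zero>"
      by (rule search_fun(2)[OF h std_in[OF ab(2)]]) (use hc[OF ab(2)] ab(3) in simp)
    ultimately show "sat (e(n := a, m := val [] ?e ?D \<odot> a)) s A"
      using hc by (metis S_nonzero(1) Z_in)
  qed
  then show ?thesis using D by blast
qed

text \<open>\<open>WO\<close> speaks of sequences as sets of pairs, so a sequence of type 1 has to
  be turned into a set before it can contradict a well-ordering.\<close>

lemma graph:
  assumes g: "g \<in> std T1"
  obtains F where "F \<in> SS" "\<And>k. k \<in> NS \<Longrightarrow> k \<epsilon> F \<longleftrightarrow> (\<exists>n \<in> NS. k = pair n (g \<odot> n))"
proof -
  \<comment> \<open>An existential quantifier as a negated universal one: \<open>?h\<close> tests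
    that \<open>k\<close> is not the pair at \<open>n\<close>, and its value at the searched
    position is 0 iff some \<open>n\<close> fits.\<close>
  let ?h = "lam (1, N) (impc (eqc (Free (0, N)) (pairc (Free (1, N)) (Free (0, T1) \<cdot> Free (1, N)))) zero)"
  let ?F = "lam (0, N) (eqc (?h \<cdot> (Free (0, T1 \<Rrightarrow> N) \<cdot> ?h)) zero)"
  let ?e = "mk_env (\<lambda>_. \<zero>) (\<lambda>_. g)"
  have e: "senv ?e" using senv_mk_env g by simp
  have F: "val [] ?e ?F \<in> std T1" by (rule senv_val[OF e]) simp
  have "val [] ?e ?F \<odot> k = chi (\<exists>n \<in> NS. k = pair n (g \<odot> n))" if k: "k \<in> NS" for k
  proof -
    let ?ek = "?e((0, N) := k)"
    have ek: "senv ?ek" using e k by simp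
    have h: "val [] ?ek ?h \<in> std T1" by (rule senv_val[OF ek]) simp
    have "val [] ?ek ?h \<odot> n = chi (k \<noteq> pair n (g \<odot> n))" if n: "n \<in> NS" for n
    proof -
      let ?en = "?ek((1, N) := n)"
      have en: "senv ?en" using ek n by simp
      have "val [] ?en (impc (eqc (Free (0, N)) (pairc (Free (1, N)) (Free (0, T1) \<cdot> Free (1, N)))) zero)
          = chi (k = pair n (g \<odot> n) \<longrightarrow> False)"
        by (rule val_impc) (use senv_env[OF en] in simp_all)
      then show ?thesis using senv_env[OF ek] std_in[OF n] by simp
    qed
    from search_chi[OF h this]
    have "val [] ?ek ?h \<odot> (\<mu> \<odot> val [] ?ek ?h) = chi (\<forall>n \<in> NS. k \<noteq> pair n (g \<odot> n))" .
    then show ?thesis using senv_env[OF e] senv_env[OF ek] std_in[OF k] ek by (simp add: senv_def)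
  qed
  then show ?thesis using F by (intro that[of "val [] ?e ?F"]) (auto simp: SS_def)
qed

lemma iterate:
  assumes D: "D \<in> std T1" and c: "c \<in> NS"
  obtains g where "g \<in> std T1" "g \<odot> \<zero> = c" "\<And>n. n \<in> NN \<Longrightarrow> g \<odot> S n = D \<odot> (g \<odot> n)"
proof -
  let ?s = "lam (0, N) (lam (1, N) (Free (0, T1) \<cdot> Free (0, N)))"
  let ?g = "lam (0, N) (rec0 (Free (0, N)) (Free (2, N)) ?s)"
  let ?e = "mk_env (\<lambda>_. c) (\<lambda>_. D)"
  have e: "senv ?e" using senv_mk_env D c by simp
  have g: "val [] ?e ?g \<in> std T1" by (rule senv_val[OF e]) simp
  have s: "val [] ?e ?s \<in> U (N \<Rrightarrow> N \<Rrightarrow> N)" by (rule val_in[OF _ senv_env[OF e]]) simp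
  have gn: "val [] ?e ?g \<odot> n = recur n c (val [] ?e ?s)" if "n \<in> NN" for n
  proof -
    have "val [] (?e((0, N) := n)) ?s = val [] ?e ?s" by (rule val_cong) auto
    then show ?thesis using that senv_env[OF e] by simp
  qed
  show ?thesis
    by (rule that[OF g]) (use s gn std_in[OF c] senv_env[OF e] in simp_all)
qed

section \<open>Well-orderings: least elements and initial parts\<close>

definition linear :: "'d \<Rightarrow> bool" where
  "linear R \<longleftrightarrow> (\<forall>i \<in> NS. \<forall>j \<in> NS. \<forall>k \<in> NS. (ole R i j \<longrightarrow> ole R i i \<and> ole R j j) \<and>
     (ole R i j \<and> ole R j k \<longrightarrow> ole R i k) \<and> (ole R i j \<and> ole R j i \<longrightarrow> i = j) \<and>
     (ole R i i \<and> ole R j j \<longrightarrow> ole R i j \<or> ole R j i))"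

lemma sat_le [simp]: "sat e s (le_rel X t u) \<longleftrightarrow> ole (s X) (nval e t) (nval e u)"
  by (simp add: le_rel_def)

lemma sat_lt [simp]: "sat e s (lt_rel X t u) \<longleftrightarrow> olt (s X) (nval e t) (nval e u)"
  by (simp add: lt_rel_def)

lemma sat_in_field [simp]: "sat e s (in_field X t) \<longleftrightarrow> ole (s X) (nval e t) (nval e t)"
  by (simp add: in_field_def)

lemma arithmetical_rel [simp]: "arithmetical (le_rel X t u)" "arithmetical (lt_rel X t u)"
  "arithmetical (in_field X t)"
  by (simp_all add: in_field_def lt_rel_def le_rel_def)

lemma sat_LO: "sat e s (LO X) \<longleftrightarrow> linear (s X)"
  by (simp add: LO_def Let_def linear_def) blast

definition descending :: "'d \<Rightarrow> 'd \<Rightarrow> bool" where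
  "descending R F \<longleftrightarrow> (\<forall>k \<in> NS. k \<epsilon> F \<longrightarrow> (\<exists>n \<in> NS. \<exists>a \<in> NS. k = pair n a \<and> ole R a a)) \<and>
     (\<forall>n \<in> NS. \<exists>a \<in> NS. pair n a \<epsilon> F) \<and>
     (\<forall>n \<in> NS. \<forall>a \<in> NS. \<forall>b \<in> NS. pair n a \<epsilon> F \<and> pair n b \<epsilon> F \<longrightarrow> a = b) \<and>
     (\<forall>n \<in> NS. \<forall>a \<in> NS. \<forall>b \<in> NS. pair n a \<epsilon> F \<and> pair (S n) b \<epsilon> F \<longrightarrow> olt R b a)"

lemma sat_LAnd: "sat e s (LAnd A B) \<longleftrightarrow> sat e s A \<and> sat e s B"
  and sat_LNot: "sat e s (LNot A) \<longleftrightarrow> \<not> sat e s A"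
  and sat_LExN: "sat e s (LExN x A) \<longleftrightarrow> (\<exists>a \<in> NS. sat (e(x := a)) s A)"
  and sat_LExS: "sat e s (LExS X A) \<longleftrightarrow> (\<exists>W \<in> SS. sat e (s(X := W)) A)"
  by auto

lemma sat_WO: "sat e s (WO X) \<longleftrightarrow> linear (s X) \<and> \<not> (\<exists>F \<in> SS. descending (s X) F)"
proof -
  have S: "n \<in> NS \<Longrightarrow> n \<oplus> \<one> = S n" for n using std_in[of n] by simp
  show ?thesis
    unfolding WO_def fun_into_field_def Let_def sat_LAnd sat_LO sat_LNot sat_LExS sat_LExN
      sat.simps(5,7) descending_def
    by (simp add: S)
qed

lemma WO_no_descent:
  assumes WO: "sat e s (WO X)" and g: "g \<in> std T1"
    and fld: "\<And>n. n \<in> NS \<Longrightarrow> ole (s X) (g \<odot> n) (g \<odot> n)"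
    and desc: "\<And>n. n \<in> NS \<Longrightarrow> olt (s X) (g \<odot> S n) (g \<odot> n)"
  shows False
proof -
  obtain F where F: "F \<in> SS" "\<And>k. k \<in> NS \<Longrightarrow> k \<epsilon> F \<longleftrightarrow> (\<exists>n \<in> NS. k = pair n (g \<odot> n))"
    using graph[OF g] by blast
  have gN: "n \<in> NS \<Longrightarrow> g \<odot> n \<in> NS" for n using std_ap[OF g] .
  have pF: "pair n a \<epsilon> F \<longleftrightarrow> a = g \<odot> n" if "n \<in> NS" "a \<in> NS" for n a
    using F(2)[of "pair n a"] that gN std_in by auto
  have "descending (s X) F"
    unfolding descending_def
  proof (intro conjI)
    show "\<forall>k \<in> NS. k \<epsilon> F \<longrightarrow> (\<exists>n \<in> NS. \<exists>a \<in> NS. k = pair n a \<and> ole (s X) a a)"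
      using F(2) gN fld by blast
    show "\<forall>n \<in> NS. \<exists>a \<in> NS. pair n a \<epsilon> F" using pF gN by blast
    show "\<forall>n \<in> NS. \<forall>a \<in> NS. \<forall>b \<in> NS. pair n a \<epsilon> F \<and> pair n b \<epsilon> F \<longrightarrow> a = b" using pF by blast
    have "pair n a \<epsilon> F \<and> pair (S n) b \<epsilon> F \<longrightarrow> olt (s X) b a" if "n \<in> NS" "a \<in> NS" "b \<in> NS" for n a b
      using pF[OF that(1,2)] pF[OF std_arith(2)[OF that(1)] that(3)] desc[OF that(1)] by simp
    then show "\<forall>n \<in> NS. \<forall>a \<in> NS. \<forall>b \<in> NS. pair n a \<epsilon> F \<and> pair (S n) b \<epsilon> F \<longrightarrow> olt (s X) b a"
      by blast
  qed
  then show False using WO F(1) sat_WO by blast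
qed

text \<open>Well-foundedness excludes only descending sequences that are standard. In a
  \<open>C\<close> without least element such a sequence is built inside the system: number choice
  selects a smaller member, and type-0 recursion iterates the selection.\<close>

lemma WO_least:
  assumes WO: "sat e s (WO X)" and s: "s X \<in> SS" and C: "C \<in> SS"
    and fld: "\<And>a. a \<in> NS \<Longrightarrow> a \<epsilon> C \<Longrightarrow> ole (s X) a a" and c: "c \<in> NS" "c \<epsilon> C"
  obtains a where "a \<in> NS" "a \<epsilon> C" "\<And>b. b \<in> NS \<Longrightarrow> b \<epsilon> C \<Longrightarrow> ole (s X) a b"
proof (rule ccontr)
  assume "\<not> thesis"
  with that have no: "\<And>a. a \<in> NS \<Longrightarrow> a \<epsilon> C \<Longrightarrow> \<exists>b \<in> NS. b \<epsilon> C \<and> \<not> ole (s X) a b" by blast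
  have lin: "linear (s X)" using WO sat_WO by blast
  have smaller: "\<exists>b \<in> NS. b \<epsilon> C \<and> olt (s X) b a" if a: "a \<in> NS" "a \<epsilon> C" for a
    using no[OF a] fld a lin unfolding linear_def by blast
  let ?A = "LAnd (LMem (NVar 1) 1) (lt_rel 0 (NVar 1) (NVar 0))"
  let ?s = "(\<lambda>_. s X)(1 := C)"
  have A: "sat ((\<lambda>_. \<zero>)(0 := a, 1 := b)) ?s ?A \<longleftrightarrow> b \<epsilon> C \<and> olt (s X) b a" for a b
    by simp
  have "\<exists>D \<in> std T1. \<forall>a \<in> NS. \<forall>b \<in> NS. sat ((\<lambda>_. \<zero>)(0 := a, 1 := b)) ?s ?A \<longrightarrow>
      sat ((\<lambda>_. \<zero>)(0 := a, 1 := D \<odot> a)) ?s ?A"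
    by (rule choice) (use s C in auto)
  then obtain D where D: "D \<in> std T1" "\<forall>a \<in> NS. \<forall>b \<in> NS. b \<epsilon> C \<and> olt (s X) b a \<longrightarrow>
      D \<odot> a \<epsilon> C \<and> olt (s X) (D \<odot> a) a"
    unfolding A by blast
  have Da: "D \<odot> a \<epsilon> C \<and> olt (s X) (D \<odot> a) a" if "a \<in> NS" "a \<epsilon> C" for a
    using smaller[OF that] D(2) that(1) by blast
  obtain g where g: "g \<in> std T1" "g \<odot> \<zero> = c" "\<And>n. n \<in> NN \<Longrightarrow> g \<odot> S n = D \<odot> (g \<odot> n)"
    using iterate[OF D(1) c(1)] by blast
  have gN: "n \<in> NS \<Longrightarrow> g \<odot> n \<in> NS" for n using std_ap[OF g(1)] .
  \<comment> \<open>Membership of the sequence in \<open>C\<close> is coded as a standard 0-1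
    function, since induction along the standard numbers is available only for such
    functions.\<close>
  let ?t = "eqc (Free (0, T1) \<cdot> (Free (1, T1) \<cdot> Free (0, N))) one"
  let ?e = "mk_env (\<lambda>_. \<zero>) ((\<lambda>_. C)(1 := g))"
  have e: "senv ?e" using senv_mk_env SS_std(1)[OF C] g by simp
  have f: "val [] ?e (lam (0, N) ?t) \<in> std T1" by (rule senv_val[OF e]) simp
  have fn: "val [] ?e (lam (0, N) ?t) \<odot> n = chi (g \<odot> n \<epsilon> C)" if "n \<in> NN" for n
    using that senv_env[OF e] by simp
  have in_C: "g \<odot> n \<epsilon> C" if n: "n \<in> NS" for n
  proof -
    have "val [] ?e (lam (0, N) ?t) \<odot> n = \<one>"
    proof (rule std_induct[OF f _ _ std_in[OF n]])
      show "val [] ?e (lam (0, N) ?t) \<odot> \<zero> = \<one>" using fn[of \<zero>] g(2) c by simp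
      fix k assume k: "k \<in> NS" "val [] ?e (lam (0, N) ?t) \<odot> k = \<one>"
      then have "g \<odot> k \<epsilon> C" using fn[OF std_in[OF k(1)]] by (auto split: if_splits)
      then show "val [] ?e (lam (0, N) ?t) \<odot> S k = \<one>"
        using fn[of "S k"] k(1) g(3) Da gN std_in[OF k(1)] by simp
    qed
    then show ?thesis using fn[OF std_in[OF n]] by (auto split: if_splits)
  qed
  show False
    by (rule WO_no_descent[OF WO g(1)]) (use in_C gN fld Da g(3) std_in in simp_all)
qed

text \<open>The description is legitimate because members of \<open>SS\<close> are determined by
  their standard elements. With an object instead of a formula, agreement of two initial parts
  becomes an identity that can be substituted into any property.\<close>

definition below :: "'d \<Rightarrow> 'd \<Rightarrow> 'd \<Rightarrow> 'd" where
  "below R Y j = (THE W. W \<in> SS \<and>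
     (\<forall>k \<in> NS. k \<epsilon> W \<longleftrightarrow> k \<epsilon> Y \<and> (\<exists>m \<in> NS. \<exists>i \<in> NS. k = pair m i \<and> olt R i j)))"

lemma below:
  assumes "R \<in> SS" "Y \<in> SS" "j \<in> NS"
  shows "below R Y j \<in> SS"
    "k \<in> NS \<Longrightarrow> k \<epsilon> below R Y j \<longleftrightarrow> k \<epsilon> Y \<and> (\<exists>m \<in> NS. \<exists>i \<in> NS. k = pair m i \<and> olt R i j)"
proof -
  let ?A = "LAnd (LMem (NVar 0) 1)
    (LExN 1 (LExN 2 (LAnd (LEq (NVar 0) (npair (NVar 1) (NVar 2))) (lt_rel 0 (NVar 2) (NVar 3)))))"
  have A: "sat ((\<lambda>_. j)(0 := k)) ((\<lambda>_. R)(1 := Y)) ?A \<longleftrightarrow>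
      k \<epsilon> Y \<and> (\<exists>m \<in> NS. \<exists>i \<in> NS. k = pair m i \<and> olt R i j)" for k
    unfolding sat_LAnd sat_LExN by simp
  have "\<exists>W \<in> SS. \<forall>k \<in> NS. k \<epsilon> W \<longleftrightarrow> sat ((\<lambda>_. j)(0 := k)) ((\<lambda>_. R)(1 := Y)) ?A"
    by (rule comprehension) (use assms in auto)
  then obtain W where W: "W \<in> SS"
    "\<forall>k \<in> NS. k \<epsilon> W \<longleftrightarrow> k \<epsilon> Y \<and> (\<exists>m \<in> NS. \<exists>i \<in> NS. k = pair m i \<and> olt R i j)"
    unfolding A by blast
  have "below R Y j = W"
    unfolding below_def
  proof (rule the_equality)
    fix V assume V: "V \<in> SS \<and>
      (\<forall>k \<in> NS. k \<epsilon> V \<longleftrightarrow> k \<epsilon> Y \<and> (\<exists>m \<in> NS. \<exists>i \<in> NS. k = pair m i \<and> olt R i j))"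
    show "V = W" by (rule SS_eqI) (use V W in \<open>simp_all only:\<close>)
  qed (use W in blast)
  then show "below R Y j \<in> SS"
    "k \<in> NS \<Longrightarrow> k \<epsilon> below R Y j \<longleftrightarrow> k \<epsilon> Y \<and> (\<exists>m \<in> NS. \<exists>i \<in> NS. k = pair m i \<and> olt R i j)"
    using W by blast+
qed

end

section \<open>Transfinite recursion\<close>

text \<open>Here the formula becomes a predicate of numbers and set objects; its being arithmetical
  enters only through \<open>theta\<close> and \<open>hier_char\<close>. The latter asks for a
  functional of \<open>Y\<close> because \<open>hier\<close> speaks of standard numbers and could
  not occur in an instance of idealisation, whereas an equation with a functional can.\<close>

locale recursion = nonstd_model +
  fixes r :: 'a and \<theta> :: "'a \<Rightarrow> 'a \<Rightarrow> bool" and hier :: "'a \<Rightarrow> 'a \<Rightarrow> bool"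
  defines hier_def: "hier Y j \<equiv>
      \<forall>n \<in> NS. \<forall>i \<in> NS. ole r i j \<longrightarrow> (pair n i \<epsilon> Y \<longleftrightarrow> \<theta> n (below r Y i))"
  assumes r: "r \<in> SS" and linear: "linear r"
    and least: "\<And>C c. C \<in> SS \<Longrightarrow> (\<And>a. a \<in> NS \<Longrightarrow> a \<epsilon> C \<Longrightarrow> ole r a a) \<Longrightarrow> c \<in> NS \<Longrightarrow> c \<epsilon> C \<Longrightarrow>
      \<exists>a \<in> NS. a \<epsilon> C \<and> (\<forall>b \<in> NS. b \<epsilon> C \<longrightarrow> ole r a b)"
    and theta: "\<And>Y. Y \<in> SS \<Longrightarrow>
      \<exists>T \<in> SS. \<forall>n \<in> NS. \<forall>i \<in> NS. pair n i \<epsilon> T \<longleftrightarrow> \<theta> n (below r Y i)"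
    and hier_char: "\<exists>G \<in> std (T1 \<Rrightarrow> N \<Rrightarrow> N). \<forall>Y \<in> SS. \<forall>j \<in> NS. G \<odot> Y \<odot> j = chi (ole r j j \<and> hier Y j)"
begin

lemma field: "i \<in> NS \<Longrightarrow> j \<in> NS \<Longrightarrow> ole r i j \<Longrightarrow> ole r i i \<and> ole r j j"
  and le_trans: "i \<in> NS \<Longrightarrow> j \<in> NS \<Longrightarrow> k \<in> NS \<Longrightarrow> ole r i j \<Longrightarrow> ole r j k \<Longrightarrow> ole r i k"
  and antisym: "i \<in> NS \<Longrightarrow> j \<in> NS \<Longrightarrow> ole r i j \<Longrightarrow> ole r j i \<Longrightarrow> i = j"
  using linear unfolding linear_def by blast+

lemma below_eqI:
  assumes "Y \<in> SS" "Y' \<in> SS" "j \<in> NS"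
    and "\<And>m i. m \<in> NS \<Longrightarrow> i \<in> NS \<Longrightarrow> olt r i j \<Longrightarrow> pair m i \<epsilon> Y \<longleftrightarrow> pair m i \<epsilon> Y'"
  shows "below r Y j = below r Y' j"
proof (rule SS_eqI)
  fix a assume a: "a \<in> NS"
  show "a \<epsilon> below r Y j \<longleftrightarrow> a \<epsilon> below r Y' j"
    unfolding below(2)[OF r assms(1,3) a] below(2)[OF r assms(2,3) a] using assms(4) by blast
qed (use below(1) r assms in blast)+

lemma hier_mono: "hier Y j \<Longrightarrow> ole r i j \<Longrightarrow> i \<in> NS \<Longrightarrow> j \<in> NS \<Longrightarrow> hier Y i"
  unfolding hier_def using le_trans by blast

text \<open>At the least index up to \<open>j\<close> where the two sets differ, their initial parts
  coincide, so \<open>\<theta>\<close> prescribes the same members there. The set of such indices is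
  arithmetical, which is what \<open>least\<close> requires.\<close>

lemma hier_unique:
  assumes Y: "Y \<in> SS" "Y' \<in> SS" and j: "j \<in> NS" and h: "hier Y j" "hier Y' j"
    and "n \<in> NS" "i \<in> NS" "ole r i j"
  shows "pair n i \<epsilon> Y \<longleftrightarrow> pair n i \<epsilon> Y'"
proof (rule ccontr)
  assume neq: "\<not> ?thesis"
  let ?A = "LAnd (le_rel 0 (NVar 0) (NVar 1)) (LExN 2
    (LNot (LIff (LMem (npair (NVar 2) (NVar 0)) 1) (LMem (npair (NVar 2) (NVar 0)) 2))))"
  let ?s = "(\<lambda>_. r)(1 := Y, 2 := Y')"
  have A: "sat ((\<lambda>_. j)(0 := a)) ?s ?A \<longleftrightarrow>
      ole r a j \<and> (\<exists>m \<in> NS. \<not> (pair m a \<epsilon> Y \<longleftrightarrow> pair m a \<epsilon> Y'))" for a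
    unfolding sat_LAnd sat_LExN sat_LNot by (simp add: sat_LAnd) blast
  have "\<exists>C \<in> SS. \<forall>a \<in> NS. a \<epsilon> C \<longleftrightarrow> sat ((\<lambda>_. j)(0 := a)) ?s ?A"
    by (rule comprehension) (use r Y j in auto)
  then obtain C where C: "C \<in> SS" "\<forall>a \<in> NS. a \<epsilon> C \<longleftrightarrow>
      ole r a j \<and> (\<exists>m \<in> NS. \<not> (pair m a \<epsilon> Y \<longleftrightarrow> pair m a \<epsilon> Y'))"
    unfolding A by blast
  have "i \<epsilon> C" using C(2) assms neq by blast
  then obtain a where a: "a \<in> NS" "a \<epsilon> C" "\<forall>b \<in> NS. b \<epsilon> C \<longrightarrow> ole r a b"
    using least[OF C(1)] C(2) field j assms(7) by metis
  have aj: "ole r a j" using a C(2) by blast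
  have "below r Y a = below r Y' a"
  proof (rule below_eqI[OF Y a(1)])
    fix m b assume b: "m \<in> NS" "b \<in> NS" "olt r b a"
    then have "\<not> b \<epsilon> C" using a(3) by blast
    then show "pair m b \<epsilon> Y \<longleftrightarrow> pair m b \<epsilon> Y'"
      using C(2) b le_trans[OF b(2) a(1) j _ aj] by blast
  qed
  then have "\<forall>m \<in> NS. pair m a \<epsilon> Y \<longleftrightarrow> pair m a \<epsilon> Y'"
    using h a(1) aj unfolding hier_def by simp
  then show False using a C(2) by blast
qed

end

context nonstd_model
begin

section \<open>Idealisation over standard finite lists\<close>

lemma chi_monus [simp]:
  "\<one> \<ominus> (chi P \<ominus> chi Q) = chi (P \<longrightarrow> Q)" "\<one> \<ominus> chi P = chi (\<not> P)"
  by simp_all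

text \<open>Free of premises, unlike \<open>val_impc\<close>, so that the simplifier evaluates
  nested implications with the help of \<open>chi_monus\<close>; a negation is an implication of
  zero.\<close>

lemma val_impc_monus: "val bs e (impc s t) = \<one> \<ominus> (val bs e s \<ominus> val bs e t)"
  by (simp add: impc_def)

text \<open>Idealisation in the form used below: the internal relation is an equation for a
  functional \<open>G\<close>, and membership in the list is replaced by indices.\<close>

lemma idealise:
  assumes G: "G \<in> U (T1 \<Rrightarrow> T1 \<Rrightarrow> N)"
    and fin: "\<And>s. s \<in> std (Seq T1) \<Longrightarrow>
      \<exists>y \<in> U T1. \<forall>i \<in> NN. i \<prec> L T1 s \<longrightarrow> G \<odot> En T1 s i \<odot> y = \<one>"
  obtains y where "y \<in> U T1" "\<And>z. z \<in> std T1 \<Longrightarrow> G \<odot> z \<odot> y = \<one>"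
proof -
  let ?z = "(0, T1)" and ?y = "(1, T1)" and ?x = "(0, Seq T1)" and ?G = "(0, T1 \<Rrightarrow> T1 \<Rrightarrow> N)"
  let ?A = "Eq (Free ?G \<cdot> Free ?z \<cdot> Free ?y) one"
  let ?M = "mem T1 (Free ?z) (Free ?x)"
  let ?e = "e0(?G := G)"
  have e: "env ?e" using G by simp
  have wA: "wff ?A" by simp
  have wM: "wff ?M" by (rule has_ty_mem) auto
  have wMA: "wff (?M \<^bold>\<longrightarrow> ?A)" using wM wA by simp
  note w1 = wff_all[OF wMA, of ?z]
  note w2 = wff_ex[OF w1, of ?y]
  note w3 = wff_all_st[OF w2, of ?x]
  note w4 = wff_all_st[OF wA, of ?z]
  note w5 = wff_ex[OF w4, of ?y]
  have ax: "(all_st ?x (ex ?y (all ?z (?M \<^bold>\<longrightarrow> ?A))) \<^bold>\<longrightarrow> ex ?y (all_st ?z ?A)) \<in> P0"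
    by (rule P0.idealisation) auto
  have "wff (all_st ?x (ex ?y (all ?z (?M \<^bold>\<longrightarrow> ?A))) \<^bold>\<longrightarrow> ex ?y (all_st ?z ?A))"
    using w3 w5 by (simp only: wf_fm.simps)
  note imp = P0_valid[OF ax this e, unfolded sem.simps(4)]
  have "\<exists>y \<in> U T1. \<forall>z \<in> U T1. sem [] (?e(?x := s, ?y := y, ?z := z)) (?M \<^bold>\<longrightarrow> ?A)"
    if s: "s \<in> std (Seq T1)" for s
  proof -
    obtain y where y: "y \<in> U T1" "\<forall>i \<in> NN. i \<prec> L T1 s \<longrightarrow> G \<odot> En T1 s i \<odot> y = \<one>"
      using fin[OF s] by blast
    have "sem [] (?e(?x := s, ?y := y, ?z := z)) (?M \<^bold>\<longrightarrow> ?A)" if z: "z \<in> U T1" for z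
      unfolding sem.simps(4)
    proof
      let ?e' = "?e(?x := s, ?y := y, ?z := z)"
      assume m: "sem [] ?e' ?M"
      have "env ?e'" using e y(1) z std_in[OF s] by simp
      from sem_mem[OF this _ _ m] obtain i where "i \<in> NN" "i \<prec> L T1 s" "z = En T1 s i" by auto
      then show "sem [] ?e' ?A" using y(2) by simp
    qed
    then show ?thesis using y(1) by blast
  qed
  then have "sem [] ?e (all_st ?x (ex ?y (all ?z (?M \<^bold>\<longrightarrow> ?A))))"
    unfolding sem_all_st[OF w2] sem_ex[OF w1] sem_all[OF wMA] by (simp add: std_def del: sem.simps(4))
  then have "sem [] ?e (ex ?y (all_st ?z ?A))" using imp by blast
  then obtain y where "y \<in> U T1" "\<forall>z \<in> U T1. st z \<longrightarrow> G \<odot> z \<odot> y = \<one>"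
    unfolding sem_ex[OF w4] sem_all_st[OF wA] by auto
  then show ?thesis using that by (simp add: std_def)
qed

text \<open>"Some entry of the list satisfies \<open>Q\<close>" quantifies over the positions of a
  list that is finite only in the sense of the model; a recursion on its length turns it into a 0-1
  function of \<open>p\<close>.\<close>

lemma bounded_search:
  assumes Q: "Q \<in> U (T1 \<Rrightarrow> N \<Rrightarrow> N)" and s: "s \<in> U (Seq T1)"
  obtains y where "y \<in> U T1"
    "\<And>p i. p \<in> NN \<Longrightarrow> i \<in> NN \<Longrightarrow> i \<prec> L T1 s \<Longrightarrow> Q \<odot> En T1 s i \<odot> p \<noteq> \<zero> \<Longrightarrow> y \<odot> p = \<one>"
    "\<And>p. p \<in> NN \<Longrightarrow> (\<And>i. i \<in> NN \<Longrightarrow> i \<prec> L T1 s \<Longrightarrow> Q \<odot> En T1 s i \<odot> p = \<zero>) \<Longrightarrow> y \<odot> p = \<zero>"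
proof -
  let ?Q = "(0, T1 \<Rrightarrow> N \<Rrightarrow> N)" and ?s = "(0, Seq T1)"
  let ?step = "lam (1, N) (lam (2, N)
    (condz (Free ?Q \<cdot> entry T1 (Free ?s) (Free (2, N)) \<cdot> Free (0, N)) (Free (1, N)) one))"
  let ?t = "lam (0, N) (rec0 (len T1 (Free ?s)) zero ?step)"
  let ?e = "e0(?Q := Q, ?s := s)"
  have e: "env ?e" using Q s by simp
  define y where "y = val [] ?e ?t"
  have y: "y \<in> U T1" unfolding y_def by (rule val_in) (use e in auto)
  define F where "F p = val [] (?e((0, N) := p)) ?step" for p
  have F: "F p \<in> U (N \<Rrightarrow> N \<Rrightarrow> N)" if "p \<in> NN" for p
    unfolding F_def by (rule val_in) (use e that in auto)
  have F_eq: "F p \<odot> v \<odot> i = (if Q \<odot> En T1 s i \<odot> p = \<zero> then v else \<one>)"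
    if "p \<in> NN" "v \<in> NN" "i \<in> NN" for p v i
    unfolding F_def using e that by simp
  have yp: "y \<odot> p = recur (L T1 s) \<zero> (F p)" if "p \<in> NN" for p
    unfolding y_def F_def using e that by simp
  show ?thesis
  proof (rule that[OF y])
    fix p i assume p: "p \<in> NN" "i \<in> NN" "i \<prec> L T1 s" "Q \<odot> En T1 s i \<odot> p \<noteq> \<zero>"
    have "recur (L T1 s) \<zero> (F p) = \<one>"
    proof (rule less_induct[where i = i and g = "\<lambda>k. recur k \<zero> (F p)" and h = "\<lambda>k. \<one>"])
      fix k assume k: "k \<in> NN" "i \<prec> k \<Longrightarrow> recur k \<zero> (F p) = \<one>" "i \<prec> k \<or> i = k"
      have "recur (S k) \<zero> (F p) = (if Q \<odot> En T1 s k \<odot> p = \<zero> then recur k \<zero> (F p) else \<one>)"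
        using recur_eqs(2)[OF Z_in F[OF p(1)] k(1)]
          F_eq[OF p(1) recur_in[OF k(1) Z_in F[OF p(1)]] k(1)] by (simp only:)
      then show "recur (S k) \<zero> (F p) = \<one>" using k(2,3) p(4) by auto
    qed (use p F L_in[OF s] in \<open>auto intro!: rep_const rep_recur\<close>)
    then show "y \<odot> p = \<one>" using yp p by simp
  next
    fix p assume p: "p \<in> NN" "\<And>i. i \<in> NN \<Longrightarrow> i \<prec> L T1 s \<Longrightarrow> Q \<odot> En T1 s i \<odot> p = \<zero>"
    have le: "k \<ominus> L T1 s = \<zero>" if k: "k \<in> NN" "S k \<ominus> L T1 s = \<zero>" for k
    proof -
      obtain d where "d \<in> NN" "L T1 s = S k \<oplus> d"
        using monus_zero_iff[of "S k" "L T1 s"] k L_in[OF s] by auto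
      then have "L T1 s = k \<oplus> S d" "S d \<in> NN" using k by simp_all
      then show ?thesis using monus_zero_iff[OF k(1) L_in[OF s]] by blast
    qed
    \<comment> \<open>The invariant is stated only up to the length of the list: positions beyond it
      hold a default entry about which nothing is assumed.\<close>
    have "recur (L T1 s) \<zero> (F p) = \<zero>"
    proof (rule cond_induct[where g = "\<lambda>k. k \<ominus> L T1 s" and h = "\<lambda>k. \<zero>"
            and g' = "\<lambda>k. recur k \<zero> (F p)" and h' = "\<lambda>k. \<zero>"])
      fix k assume k: "k \<in> NN" "k \<ominus> L T1 s = \<zero> \<Longrightarrow> recur k \<zero> (F p) = \<zero>" "S k \<ominus> L T1 s = \<zero>"
      have "Q \<odot> En T1 s k \<odot> p = \<zero>" using p(2) k(1,3) by (simp add: less_def)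
      then show "recur (S k) \<zero> (F p) = \<zero>"
        using recur_eqs(2)[OF Z_in F[OF p(1)] k(1)] k(2)[OF le[OF k(1,3)]]
          F_eq[OF p(1) recur_in[OF k(1) Z_in F[OF p(1)]] k(1)] by simp
    qed (use p(1) F L_in[OF s] in \<open>auto intro!: rep_const rep_recur rep_arith\<close>)
    then show "y \<odot> p = \<zero>" using yp p by simp
  qed
qed

text \<open>A standard \<open>z\<close> of type 1 codes the indices \<open>z 0\<close>, \<open>z 1\<close> and the set \<open>{k. z (k + 2) = 1}\<close>.\<close>

lemma decode:
  obtains V where "V \<in> std (T1 \<Rrightarrow> T1)" "\<And>z. z \<in> std T1 \<Longrightarrow> V \<odot> z \<in> SS"
    "\<And>Y j n. Y \<in> SS \<Longrightarrow> j \<in> NS \<Longrightarrow> n \<in> NS \<Longrightarrow>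
       \<exists>z \<in> std T1. z \<odot> \<zero> = j \<and> z \<odot> \<one> = n \<and> V \<odot> z = Y"
proof -
  \<comment> \<open>Testing the value against one makes \<open>V \<odot> z\<close> a set for every
    standard \<open>z\<close>, as is needed when idealisation ranges over all of them.\<close>
  let ?V = "lam (0, T1) (lam (0, N) (eqc (Free (0, T1) \<cdot> suc (suc (Free (0, N)))) one))"
  define V where "V = val [] e0 ?V"
  have V: "V \<in> std (T1 \<Rrightarrow> T1)" unfolding V_def by (rule val_std) auto
  have Vz: "V \<odot> z \<odot> k = chi (z \<odot> S (S k) = \<one>)" if "z \<in> U T1" "k \<in> NN" for z k
    unfolding V_def using that by simp
  have VS: "V \<odot> z \<in> SS" if "z \<in> std T1" for z
    using std_ap[OF V that] Vz[OF std_in[OF that]] std_in by (auto simp: SS_def)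
  show ?thesis
  proof (rule that[OF V VS])
    fix Y j n assume Y: "Y \<in> SS" "j \<in> NS" "n \<in> NS"
    \<comment> \<open>Two nested recursors act as case distinctions: their step functions ignore the
      previous value and use only the predecessor. Hence 0 goes to \<open>j\<close>, 1 to
      \<open>n\<close>, and \<open>a + 2\<close> to \<open>Y \<odot> a\<close>.\<close>
    let ?inner = "rec0 (Free (1, N)) (Free (5, N)) (lam (2, N) (lam (3, N) (Free (0, T1) \<cdot> Free (3, N))))"
    let ?z = "lam (4, N) (rec0 (Free (4, N)) (Free (6, N)) (lam (0, N) (lam (1, N) ?inner)))"
    let ?e = "e0((0, T1) := Y, (5, N) := n, (6, N) := j)"
    have e: "env ?e" using Y SS_std std_in by simp
    define z where "z = val [] ?e ?z"
    have z: "z \<in> std T1" unfolding z_def by (rule val_std) (use Y SS_std in auto)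
    let ?f = "val [] ?e (lam (2, N) (lam (3, N) (Free (0, T1) \<cdot> Free (3, N))))"
    have f: "?f \<in> U (N \<Rrightarrow> N \<Rrightarrow> N)" by (rule val_in) (use e in auto)
    have fc: "val [] (?e((4, N) := a, (0, N) := b, (1, N) := c))
        (lam (2, N) (lam (3, N) (Free (0, T1) \<cdot> Free (3, N)))) = ?f" for a b c
      by (rule val_cong) auto
    let ?g = "\<lambda>e. val [] e (lam (0, N) (lam (1, N) ?inner))"
    have g: "?g (?e((4, N) := a)) \<in> U (N \<Rrightarrow> N \<Rrightarrow> N)" if "a \<in> NN" for a
      by (rule val_in) (use e that in auto)
    have g_eq: "?g (?e((4, N) := a)) \<odot> b \<odot> c = recur c n ?f" if "a \<in> NN" "b \<in> NN" "c \<in> NN" for a b c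
      using that e fc by simp
    have NN: "n \<in> NN" "j \<in> NN" using Y std_in by blast+
    have z_eq: "z \<odot> a = recur a j (?g (?e((4, N) := a)))" if "a \<in> NN" for a
      unfolding z_def using that e by simp
    have "z \<odot> \<zero> = j" using z_eq[of \<zero>] g[of \<zero>] NN by simp
    moreover have zS: "z \<odot> S a = recur a n ?f" if "a \<in> NN" for a
      using z_eq[of "S a"] g[of "S a"] g_eq[of "S a"] that NN by simp
    then have "z \<odot> \<one> = n" using f NN by simp
    moreover have zSS: "z \<odot> S (S a) = Y \<odot> a" if "a \<in> NN" for a
      using zS[of "S a"] that f NN e by simp
    have "V \<odot> z = Y"
      by (rule SS_eqI[OF VS[OF z] Y(1)]) (use Vz zSS std_in z in auto)
    ultimately show "\<exists>z \<in> std T1. z \<odot> \<zero> = j \<and> z \<odot> \<one> = n \<and> V \<odot> z = Y" using z by blast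
  qed
qed

end

context recursion
begin

text \<open>The hierarchies vote on the pairs \<open>(n, j)\<close>. Finitely many votes never
  conflict, by uniqueness; idealisation then meets all standard votes with one object, and
  \<open>STP\<close> makes it standard.\<close>

lemma separating_set:
  obtains W where "W \<in> SS" "\<And>Y j n. Y \<in> SS \<Longrightarrow> j \<in> NS \<Longrightarrow> n \<in> NS \<Longrightarrow> ole r j j \<Longrightarrow> hier Y j \<Longrightarrow>
    pair n j \<epsilon> W \<longleftrightarrow> pair n j \<epsilon> Y"
proof -
  obtain G where G: "G \<in> std (T1 \<Rrightarrow> N \<Rrightarrow> N)"
    "\<And>Y j. Y \<in> SS \<Longrightarrow> j \<in> NS \<Longrightarrow> G \<odot> Y \<odot> j = chi (ole r j j \<and> hier Y j)"
    using hier_char by blast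
  obtain V where V: "V \<in> std (T1 \<Rrightarrow> T1)" "\<And>z. z \<in> std T1 \<Longrightarrow> V \<odot> z \<in> SS"
    "\<And>Y j n. Y \<in> SS \<Longrightarrow> j \<in> NS \<Longrightarrow> n \<in> NS \<Longrightarrow>
       \<exists>z \<in> std T1. z \<odot> \<zero> = j \<and> z \<odot> \<one> = n \<and> V \<odot> z = Y"
    using decode by blast
  let ?G = "(0, T1 \<Rrightarrow> N \<Rrightarrow> N)" and ?V = "(1, T1 \<Rrightarrow> T1)" and ?z = "(0, T1)"
    and ?y = "(1, T1)" and ?p = "(0, N)"
  let ?e = "e0(?G := G, ?V := V)"
  have in_U: "G \<in> U (T1 \<Rrightarrow> N \<Rrightarrow> N)" "V \<in> U (T1 \<Rrightarrow> T1)"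
    using std_in G(1) V(1) by blast+
  then have e: "env ?e" by simp
  define h where "h z = G \<odot> (V \<odot> z) \<odot> (z \<odot> \<zero>)" for z
  define q where "q z = pair (z \<odot> \<one>) (z \<odot> \<zero>)" for z
  let ?h = "eqc (Free ?G \<cdot> (Free ?V \<cdot> Free ?z) \<cdot> (Free ?z \<cdot> zero)) one"
  let ?q = "pairc (Free ?z \<cdot> one) (Free ?z \<cdot> zero)"
  \<comment> \<open>A code \<open>z\<close> with \<open>h z = \<one>\<close> is valid: its set is a
    hierarchy up to its index. \<open>?C\<close> says that \<open>y\<close> agrees with a valid code
    at the pair \<open>q z\<close>, and \<open>?Q\<close> that a valid code for the pair
    \<open>p\<close> accepts it.\<close>
  let ?C = "impc ?h (eqc (eqc (Free ?y \<cdot> ?q) one) (eqc (Free ?V \<cdot> Free ?z \<cdot> ?q) one))"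
  let ?Q = "impc (impc ?h (impc (eqc (Free ?p) ?q)
    (impc (eqc (Free ?V \<cdot> Free ?z \<cdot> Free ?p) one) zero))) zero"
  define C where "C = val [] ?e (lam ?z (lam ?y ?C))"
  define Q where "Q = val [] ?e (lam ?z (lam ?p ?Q))"
  have C: "C \<in> U (T1 \<Rrightarrow> T1 \<Rrightarrow> N)" and Q: "Q \<in> U (T1 \<Rrightarrow> N \<Rrightarrow> N)"
    unfolding C_def Q_def by (rule val_in; use e in auto)+
  have C_eq: "C \<odot> z \<odot> y = chi (h z = \<one> \<longrightarrow> (q z \<epsilon> y \<longleftrightarrow> q z \<epsilon> V \<odot> z))"
    if "z \<in> U T1" "y \<in> U T1" for z y
    unfolding C_def h_def q_def using that e by (simp add: val_impc_monus)
  have Q_eq: "Q \<odot> z \<odot> p = chi (h z = \<one> \<and> p = q z \<and> p \<epsilon> V \<odot> z)" if "z \<in> U T1" "p \<in> NN" for z p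
    unfolding Q_def h_def q_def using that e by (simp add: val_impc_monus)
  have zN: "z \<odot> \<zero> \<in> NS" "z \<odot> \<one> \<in> NS" if "z \<in> std T1" for z
    using std_ap[OF that] by simp_all
  have qN: "q z \<in> NS" if "z \<in> std T1" for z
    unfolding q_def using zN[OF that] by simp
  have h_iff: "h z = \<one> \<longleftrightarrow> ole r (z \<odot> \<zero>) (z \<odot> \<zero>) \<and> hier (V \<odot> z) (z \<odot> \<zero>)" if "z \<in> std T1" for z
    using G(2)[OF V(2)[OF that] zN(1)[OF that]] unfolding h_def by simp
  have "\<exists>y \<in> U T1. \<forall>i \<in> NN. i \<prec> L T1 s \<longrightarrow> C \<odot> En T1 s i \<odot> y = \<one>" if s: "s \<in> std (Seq T1)" for s
  proof -
    \<comment> \<open>For a single list, \<open>y\<close> consists of the pairs that some valid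
      entry accepts; that rejections are respected as well remains to be shown.\<close>
    obtain y where y: "y \<in> U T1"
      "\<And>p i. p \<in> NN \<Longrightarrow> i \<in> NN \<Longrightarrow> i \<prec> L T1 s \<Longrightarrow> Q \<odot> En T1 s i \<odot> p \<noteq> \<zero> \<Longrightarrow> y \<odot> p = \<one>"
      "\<And>p. p \<in> NN \<Longrightarrow> (\<And>i. i \<in> NN \<Longrightarrow> i \<prec> L T1 s \<Longrightarrow> Q \<odot> En T1 s i \<odot> p = \<zero>) \<Longrightarrow> y \<odot> p = \<zero>"
      using bounded_search[OF Q std_in[OF s]] by blast
    \<comment> \<open>The length of a standard list is standard, so the positions below it are
      standard and so are the entries. Only for these is \<open>h\<close> known to mean what it
      should.\<close>
    have entry_std: "En T1 s i \<in> std T1" if "i \<in> NN" "i \<prec> L T1 s" for i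
      using En_std[OF s] std_initial[OF L_std[OF s]] that by blast
    have "C \<odot> En T1 s i \<odot> y = \<one>" if i: "i \<in> NN" "i \<prec> L T1 s" for i
    proof -
      let ?z = "En T1 s i"
      have z: "?z \<in> std T1" using entry_std i by blast
      have "q ?z \<epsilon> y \<longleftrightarrow> q ?z \<epsilon> V \<odot> ?z" if hz: "h ?z = \<one>"
      proof (cases "q ?z \<epsilon> V \<odot> ?z")
        case True
        then have "Q \<odot> ?z \<odot> q ?z \<noteq> \<zero>" using Q_eq[OF std_in[OF z] std_in[OF qN[OF z]]] hz by simp
        then show ?thesis using y(2)[OF std_in[OF qN[OF z]] i] True by simp
      next
        case False
        \<comment> \<open>An entry accepting a pair that \<open>?z\<close> rejects would be a
          hierarchy up to the same index and contradict uniqueness.\<close>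
        have "Q \<odot> En T1 s k \<odot> q ?z = \<zero>" if k: "k \<in> NN" "k \<prec> L T1 s" for k
        proof (rule ccontr)
          let ?w = "En T1 s k"
          have w: "?w \<in> std T1" using entry_std k by blast
          assume "Q \<odot> ?w \<odot> q ?z \<noteq> \<zero>"
          then have Qw: "h ?w = \<one>" "q ?z = q ?w" "q ?z \<epsilon> V \<odot> ?w"
            using Q_eq[OF std_in[OF w] std_in[OF qN[OF z]]] by (auto split: if_splits)
          have "?z \<odot> \<zero> = ?w \<odot> \<zero>"
            using Qw(2) pair_inject zN[OF z] zN[OF w] std_in unfolding q_def by blast
          then show False
            using hier_unique[OF V(2)[OF z] V(2)[OF w] zN(1)[OF z], of "?z \<odot> \<one>" "?z \<odot> \<zero>"]
              Qw(1,3) hz h_iff[OF z] h_iff[OF w] zN[OF z] False unfolding q_def by simp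
        qed
        then have "y \<odot> q ?z = \<zero>" using y(3)[OF std_in[OF qN[OF z]]] by blast
        then show ?thesis using False by simp
      qed
      then show ?thesis using C_eq[OF std_in[OF z] y(1)] by simp
    qed
    then show ?thesis using y(1) by blast
  qed
  then obtain y where y: "y \<in> U T1" "\<And>z. z \<in> std T1 \<Longrightarrow> C \<odot> z \<odot> y = \<one>"
    using idealise[OF C] by blast
  \<comment> \<open>\<open>y\<close> need be neither binary nor standard. This makes it binary, as
    \<open>STP\<close> demands; passing to the standard \<open>W\<close> keeps all constraints
    because they concern standard pairs only.\<close>
  let ?a = "lam ?p (eqc (Free ?y \<cdot> Free ?p) one)"
  define a where "a = val [] (e0(?y := y)) ?a"
  have a: "a \<in> U T1" unfolding a_def by (rule val_in) (use y in auto)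
  have ap: "a \<odot> p = chi (p \<epsilon> y)" if "p \<in> NN" for p
    unfolding a_def using y(1) that by simp
  obtain W where W: "W \<in> std T1" "\<And>p. p \<in> NS \<Longrightarrow> W \<odot> p = a \<odot> p"
    using STP[OF a] ap le_one_iff by (metis Z_in S_in)
  have W_mem: "W \<odot> p = chi (p \<epsilon> y)" if "p \<in> NS" for p
    using W(2)[OF that] ap[OF std_in[OF that]] by simp
  show ?thesis
  proof (rule that)
    show "W \<in> SS" using W(1) W_mem by (auto simp: SS_def)
    fix Y j n assume Y: "Y \<in> SS" "j \<in> NS" "n \<in> NS" "ole r j j" "hier Y j"
    obtain z where z: "z \<in> std T1" "z \<odot> \<zero> = j" "z \<odot> \<one> = n" "V \<odot> z = Y"
      using V(3)[OF Y(1,2,3)] by blast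
    have "C \<odot> z \<odot> y = \<one>" using y(2) z(1) by blast
    then have "q z \<epsilon> y \<longleftrightarrow> q z \<epsilon> Y"
      using C_eq[OF std_in[OF z(1)] y(1)] h_iff[OF z(1)] z Y(4,5) by (auto split: if_splits)
    then show "pair n j \<epsilon> W \<longleftrightarrow> pair n j \<epsilon> Y"
      using W_mem[of "pair n j"] Y(2,3) z unfolding q_def by simp
  qed
qed

lemma hierarchy:
  "\<exists>Y \<in> SS. \<forall>k \<in> NS. k \<epsilon> Y \<longleftrightarrow>
     (\<exists>n \<in> NS. \<exists>j \<in> NS. k = pair n j \<and> ole r j j \<and> \<theta> n (below r Y j))"
proof -
  obtain W where W: "W \<in> SS" "\<And>Y j n. Y \<in> SS \<Longrightarrow> j \<in> NS \<Longrightarrow> n \<in> NS \<Longrightarrow> ole r j j \<Longrightarrow> hier Y j \<Longrightarrow>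
    pair n j \<epsilon> W \<longleftrightarrow> pair n j \<epsilon> Y"
    using separating_set by blast
  \<comment> \<open>One application of \<open>\<theta>\<close> to the initial parts of
    \<open>W\<close>. Being a hierarchy up to \<open>j\<close> now means that \<open>W\<close> and
    \<open>T\<close> agree up to \<open>j\<close>, which is arithmetical in two set
    parameters.\<close>
  obtain T where T: "T \<in> SS"
    "\<And>n i. n \<in> NS \<Longrightarrow> i \<in> NS \<Longrightarrow> pair n i \<epsilon> T \<longleftrightarrow> \<theta> n (below r W i)"
    using theta[OF W(1)] by blast
  \<comment> \<open>A hierarchy up to \<open>j\<close> is one up to every smaller index, so
    \<open>W\<close> agrees with it on all of the part up to \<open>j\<close> and not only at
    \<open>j\<close>; the initial parts then coincide as well.\<close>
  have hier_W: "hier W j" if Y: "Y \<in> SS" and j: "j \<in> NS" and h: "hier Y j" for Y j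
  proof -
    have WY: "pair m i \<epsilon> W \<longleftrightarrow> pair m i \<epsilon> Y" if "m \<in> NS" "i \<in> NS" "ole r i j" for m i
      using W(2)[OF Y that(2,1) _ hier_mono[OF h that(3,2) j]] field[OF that(2) j that(3)] by blast
    have "below r W i = below r Y i" if i: "i \<in> NS" "ole r i j" for i
      by (rule below_eqI[OF W(1) Y i(1)]) (use WY le_trans[OF _ i(1) j _ i(2)] in blast)
    then show ?thesis using h WY unfolding hier_def by simp
  qed
  have all: "hier W j" if j: "j \<in> NS" "ole r j j" for j
  proof (rule ccontr)
    assume nj: "\<not> hier W j"
    let ?A = "LAnd (in_field 0 (NVar 0)) (LExN 1 (LExN 2 (LAnd (le_rel 0 (NVar 2) (NVar 0))
      (LNot (LIff (LMem (npair (NVar 1) (NVar 2)) 1) (LMem (npair (NVar 1) (NVar 2)) 2))))))"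
    let ?s = "(\<lambda>_. r)(1 := W, 2 := T)"
    have A: "sat ((\<lambda>_. \<zero>)(0 := a)) ?s ?A \<longleftrightarrow> ole r a a \<and>
      (\<exists>n \<in> NS. \<exists>i \<in> NS. ole r i a \<and> \<not> (pair n i \<epsilon> W \<longleftrightarrow> pair n i \<epsilon> T))" for a
      unfolding sat_LAnd sat_LExN sat_LNot by (simp add: sat_LAnd) blast
    have "\<exists>C \<in> SS. \<forall>a \<in> NS. a \<epsilon> C \<longleftrightarrow> sat ((\<lambda>_. \<zero>)(0 := a)) ?s ?A"
      by (rule comprehension) (use r W T in auto)
    then obtain C where C: "C \<in> SS" "\<forall>a \<in> NS. a \<epsilon> C \<longleftrightarrow> ole r a a \<and>
      (\<exists>n \<in> NS. \<exists>i \<in> NS. ole r i a \<and> \<not> (pair n i \<epsilon> W \<longleftrightarrow> pair n i \<epsilon> T))"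
      unfolding A by blast
    have C': "a \<epsilon> C \<longleftrightarrow> ole r a a \<and> \<not> hier W a" if "a \<in> NS" for a
      using C(2) T(2) that unfolding hier_def by blast
    then obtain a where a: "a \<in> NS" "a \<epsilon> C" "\<forall>b \<in> NS. b \<epsilon> C \<longrightarrow> ole r a b"
      using least[OF C(1), of j] j nj by blast
    have below_a: "hier W b" if "b \<in> NS" "olt r b a" for b
      using a C' that field[OF that(1) a(1)] by blast
    \<comment> \<open>The hierarchy one step beyond what \<open>W\<close> achieves: it copies
      \<open>W\<close> strictly below \<open>a\<close> and takes the prescribed values, those of
      \<open>T\<close>, at \<open>a\<close> itself.\<close>
    let ?B = "LExN 1 (LExN 2 (LAnd (LEq (NVar 0) (npair (NVar 1) (NVar 2)))
      (LOr (LAnd (lt_rel 0 (NVar 2) (NVar 3)) (LMem (NVar 0) 1))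
           (LAnd (LEq (NVar 2) (NVar 3)) (LMem (NVar 0) 2)))))"
    have B: "sat ((\<lambda>_. a)(0 := k)) ?s ?B \<longleftrightarrow> (\<exists>n \<in> NS. \<exists>i \<in> NS. k = pair n i \<and>
      (olt r i a \<and> k \<epsilon> W \<or> i = a \<and> k \<epsilon> T))" for k
      unfolding sat_LAnd sat_LExN sat_LNot by (simp add: sat_LAnd) blast
    have "\<exists>Y \<in> SS. \<forall>k \<in> NS. k \<epsilon> Y \<longleftrightarrow> sat ((\<lambda>_. a)(0 := k)) ?s ?B"
      by (rule comprehension) (use r W T a in auto)
    then obtain Y where Y: "Y \<in> SS" "\<forall>k \<in> NS. k \<epsilon> Y \<longleftrightarrow> (\<exists>n \<in> NS. \<exists>i \<in> NS. k = pair n i \<and>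
      (olt r i a \<and> k \<epsilon> W \<or> i = a \<and> k \<epsilon> T))"
      unfolding B by blast
    have pY: "pair n i \<epsilon> Y \<longleftrightarrow> olt r i a \<and> pair n i \<epsilon> W \<or> i = a \<and> pair n i \<epsilon> T"
      if "n \<in> NS" "i \<in> NS" for n i
    proof -
      have "pair n i \<epsilon> Y \<longleftrightarrow> (\<exists>n' \<in> NS. \<exists>i' \<in> NS. pair n i = pair n' i' \<and>
        (olt r i' a \<and> pair n i \<epsilon> W \<or> i' = a \<and> pair n i \<epsilon> T))"
        using Y(2) pair_std[OF that] by blast
      moreover have "pair n i = pair n' i' \<longleftrightarrow> n = n' \<and> i = i'" if "n' \<in> NS" "i' \<in> NS" for n' i'
        using pair_inject std_in that \<open>n \<in> NS\<close> \<open>i \<in> NS\<close> by blast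
      ultimately show ?thesis using that by blast
    qed
    have bY: "below r Y i = below r W i" if i: "i \<in> NS" "ole r i a" for i
    proof (rule below_eqI[OF Y(1) W(1) i(1)])
      fix m b assume b: "m \<in> NS" "b \<in> NS" "olt r b i"
      have "olt r b a"
        using b i a(1) le_trans[OF b(2) i(1) a(1)] le_trans[OF i(1) a(1) b(2)] by blast
      then show "pair m b \<epsilon> Y \<longleftrightarrow> pair m b \<epsilon> W" using pY[OF b(1,2)] a(1) by blast
    qed
    have "hier Y a"
      unfolding hier_def
    proof (intro ballI HOL.impI)
      fix n i assume i: "n \<in> NS" "i \<in> NS" "ole r i a"
      show "pair n i \<epsilon> Y \<longleftrightarrow> \<theta> n (below r Y i)"
      proof (cases "i = a")
        case True
        then show ?thesis using pY[OF i(1,2)] T(2)[OF i(1,2)] bY[OF i(2,3)] by auto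
      next
        case False
        then have lt: "olt r i a" using antisym i a(1) by blast
        have "pair n i \<epsilon> W \<longleftrightarrow> \<theta> n (below r W i)"
          using below_a[OF i(2) lt] field[OF i(2) a(1) i(3)] i unfolding hier_def by blast
        then show ?thesis using pY[OF i(1,2)] lt False bY[OF i(2,3)] by simp
      qed
    qed
    then have "hier W a" using hier_W Y(1) a(1) by blast
    then show False using C' a by blast
  qed
  \<comment> \<open>Outside the pairs with second component in the field, \<open>W\<close> is
    arbitrary, whereas \<open>H\<close> forbids all further members; they are cut away here.\<close>
  let ?A = "LExN 1 (LExN 2 (LAnd (LEq (NVar 0) (npair (NVar 1) (NVar 2)))
    (LAnd (in_field 0 (NVar 2)) (LMem (NVar 0) 1))))"
  let ?s = "(\<lambda>_. r)(1 := W)"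
  have A: "sat ((\<lambda>_. \<zero>)(0 := k)) ?s ?A \<longleftrightarrow>
    (\<exists>n \<in> NS. \<exists>j \<in> NS. k = pair n j \<and> ole r j j \<and> k \<epsilon> W)" for k
    unfolding sat_LAnd sat_LExN by simp
  have "\<exists>Y \<in> SS. \<forall>k \<in> NS. k \<epsilon> Y \<longleftrightarrow> sat ((\<lambda>_. \<zero>)(0 := k)) ?s ?A"
    by (rule comprehension) (use r W in auto)
  then obtain Y where Y: "Y \<in> SS" "\<forall>k \<in> NS. k \<epsilon> Y \<longleftrightarrow>
    (\<exists>n \<in> NS. \<exists>j \<in> NS. k = pair n j \<and> ole r j j \<and> k \<epsilon> W)"
    unfolding A by blast
  have bY: "below r Y j = below r W j" if j: "j \<in> NS" for j
  proof (rule below_eqI[OF Y(1) W(1) j])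
    fix m b assume b: "m \<in> NS" "b \<in> NS" "olt r b j"
    then show "pair m b \<epsilon> Y \<longleftrightarrow> pair m b \<epsilon> W"
      using Y(2) pair_std[OF b(1,2)] field[OF b(2) j] by blast
  qed
  have W_mem: "pair n j \<epsilon> W \<longleftrightarrow> \<theta> n (below r Y j)" if "n \<in> NS" "j \<in> NS" "ole r j j" for n j
    using all[OF that(2,3)] that bY[OF that(2)] unfolding hier_def by simp
  show ?thesis
  proof (intro bexI[OF _ Y(1)] ballI)
    fix k assume "k \<in> NS"
    then have "k \<epsilon> Y \<longleftrightarrow> (\<exists>n \<in> NS. \<exists>j \<in> NS. k = pair n j \<and> ole r j j \<and> k \<epsilon> W)" using Y(2) by blast
    also have "\<dots> \<longleftrightarrow> (\<exists>n \<in> NS. \<exists>j \<in> NS. k = pair n j \<and> ole r j j \<and> \<theta> n (below r Y j))"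
      using W_mem by (intro bex_cong refl) auto
    finally show "k \<epsilon> Y \<longleftrightarrow> (\<exists>n \<in> NS. \<exists>j \<in> NS. k = pair n j \<and> ole r j j \<and> \<theta> n (below r Y j))" .
  qed
qed

end

section \<open>The axioms of arithmetical transfinite recursion\<close>

lemma free_num_subset: "free_num A \<subseteq> num_vars A"
  by (induction A) auto

lemma arithmetical_subst_set:
  "arithmetical A \<Longrightarrow> (\<And>t. arithmetical (P t)) \<Longrightarrow> arithmetical (subst_set Z0 P A)"
  by (induction A) auto

lemma arithmetical_mem_below: "arithmetical (mem_below X Y j m i t)"
  by (simp add: mem_below_def lt_rel_def le_rel_def)

context nonstd_model
begin

lemma sat_LIff: "sat e s (LIff A B) \<longleftrightarrow> (sat e s A \<longleftrightarrow> sat e s B)"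
  and sat_LOr: "sat e s (LOr A B) \<longleftrightarrow> sat e s A \<or> sat e s B"
  by auto

lemma sat_mem_below:
  assumes "s X \<in> SS" "s Y \<in> SS" "\<And>x. e x \<in> NS"
    and "m \<noteq> i" "j \<noteq> m" "j \<noteq> i" "m \<notin> vars_nt t" "i \<notin> vars_nt t"
  shows "sat e s (mem_below X Y j m i t) \<longleftrightarrow> nval e t \<epsilon> below (s X) (s Y) (e j)"
proof -
  have "nval (e(m := a, i := b)) t = nval e t" for a b
    by (rule nval_cong) (use assms in auto)
  then have "sat e s (mem_below X Y j m i t) \<longleftrightarrow> nval e t \<epsilon> s Y \<and>
      (\<exists>a \<in> NS. \<exists>b \<in> NS. nval e t = pair a b \<and> olt (s X) b (e j))"
    unfolding mem_below_def sat_LAnd sat_LExN using assms(4-6) by simp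
  then show ?thesis using below(2)[OF assms(1-3) nval_std[of e t]] assms(3) by simp
qed

text \<open>\<open>subst_set\<close> renames no bound variables. This is harmless because all
  variables of \<open>A\<close>, bound ones included, lie in \<open>V\<close>, while the parameters
  of \<open>P\<close> may lie outside it and keep the values fixed by \<open>b\<close> under every
  quantifier.\<close>

lemma sat_subst_set:
  assumes P: "\<And>e t. (\<And>x. e x \<in> NS) \<Longrightarrow> (\<And>x. x \<notin> V \<Longrightarrow> e x = b x) \<Longrightarrow> vars_nt t \<subseteq> V \<Longrightarrow>
      sat e s (P t) \<longleftrightarrow> nval e t \<epsilon> W"
  shows "arithmetical A \<Longrightarrow> num_vars A \<subseteq> V \<Longrightarrow> (\<And>x. e x \<in> NS) \<Longrightarrow> (\<And>x. x \<notin> V \<Longrightarrow> e x = b x) \<Longrightarrow>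
      sat e s (subst_set Z0 P A) = sat e (s(Z0 := W)) A"
proof (induction A arbitrary: e)
  case (LMem t X)
  then show ?case using P[of e t] by simp
next
  case (LBAll x t A)
  have "sat (e(x := a)) s (subst_set Z0 P A) = sat (e(x := a)) (s(Z0 := W)) A" if "a \<in> NS" for a
    by (rule LBAll.IH) (use LBAll.prems that in auto)
  moreover have "nval e t \<in> NS" using nval_std LBAll.prems(3) by blast
  ultimately have "\<forall>a \<in> NN. a \<prec> nval e t \<longrightarrow>
      sat (e(x := a)) s (subst_set Z0 P A) = sat (e(x := a)) (s(Z0 := W)) A"
    using std_initial by blast
  then show ?case unfolding subst_set.simps sat.simps by blast
next
  case (LAllN x A)
  have "sat (e(x := a)) s (subst_set Z0 P A) = sat (e(x := a)) (s(Z0 := W)) A" if "a \<in> NS" for a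
    by (rule LAllN.IH) (use LAllN.prems that in auto)
  then show ?case unfolding subst_set.simps sat.simps by blast
qed auto

lemma sat_recursion:
  assumes \<theta>: "arithmetical \<theta>" and XY: "X \<noteq> Y" and Y: "Y \<notin> free_set \<theta>"
    and dist: "distinct [n, k, j, m, i]" and vars: "{k, j, m, i} \<inter> num_vars \<theta> = {}"
    and e: "\<And>x. e x \<in> NS" and s: "\<And>X. s X \<in> SS"
  shows "sat e s (LAllS X (LImp (WO X) (LExS Y (H \<theta> n Z0 k j m i X Y))))"
  unfolding sat.simps(8)[of e s X "LImp (WO X) (LExS Y (H \<theta> n Z0 k j m i X Y))"]
    sat.simps(5)[of _ _ "WO X"] sat_LExS
proof (intro ballI HOL.impI)
  fix R assume R: "R \<in> SS" and WO: "sat e (s(X := R)) (WO X)"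
  define s1 where "s1 = s(X := R)"
  have s1: "s1 X' \<in> SS" for X' using s R by (simp add: s1_def)
  have s1X: "s1 X = R" by (simp add: s1_def)
  let ?\<theta> = "subst_set Z0 (mem_below X Y j m i) \<theta>"
  \<comment> \<open>\<open>\<theta>\<close> as a predicate of its number and set argument; all other
    parameters stay frozen at \<open>e\<close> and \<open>s1\<close>.\<close>
  define \<Theta> where "\<Theta> b W = sat (e(n := b)) (s1(Z0 := W)) \<theta>" for b W
  have sat_\<theta>: "sat (e'(n := b, j := c)) (s1(Y := B)) ?\<theta> \<longleftrightarrow> \<Theta> b (below R B c)"
    if "B \<in> SS" "b \<in> NS" "c \<in> NS" "\<And>x. e' x \<in> NS" "\<And>x. x \<in> num_vars \<theta> \<Longrightarrow> e' x = e x" for e' b c B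
  proof -
    let ?e = "e'(n := b, j := c)"
    have "sat ?e (s1(Y := B)) ?\<theta> = sat ?e (s1(Y := B, Z0 := below R B c)) \<theta>"
    proof (rule sat_subst_set[where V = "num_vars \<theta>" and b = ?e])
      fix e'' t
      assume e'': "\<And>x. e'' x \<in> NS" "\<And>x. x \<notin> num_vars \<theta> \<Longrightarrow> e'' x = ?e x" "vars_nt t \<subseteq> num_vars \<theta>"
      then have "e'' j = c" using vars by simp
      then show "sat e'' (s1(Y := B)) (mem_below X Y j m i t) \<longleftrightarrow> nval e'' t \<epsilon> below R B c"
        using sat_mem_below[of "s1(Y := B)" X Y e'' m i j t] XY s1X R that(1) e'' vars dist by auto
    qed (use \<theta> that in auto)
    also have "\<dots> = \<Theta> b (below R B c)"
      unfolding \<Theta>_def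
    proof (rule sat_cong)
      fix x assume "x \<in> free_num \<theta>"
      then have "x \<in> num_vars \<theta>" using free_num_subset by blast
      then show "?e x = (e(n := b)) x" using vars that(5) by auto
    qed (use Y in auto)
    finally show ?thesis .
  qed
  have arith: "arithmetical ?\<theta>" using arithmetical_subst_set[OF \<theta> arithmetical_mem_below] .
  have dist': "n \<noteq> k" "n \<noteq> j" "j \<noteq> k" using dist by auto
  have ek: "x \<in> num_vars \<theta> \<Longrightarrow> (e(k := a)) x = e x" for x a using vars by auto
  interpret recursion U ap cst st R \<Theta>
    "\<lambda>Y j. \<forall>n \<in> NS. \<forall>i \<in> NS. ole R i j \<longrightarrow> (pair n i \<epsilon> Y \<longleftrightarrow> \<Theta> n (below R Y i))"
  proof unfold_locales
    show "R \<in> SS" by fact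
    show "linear R" using WO sat_WO[of e "s(X := R)" X] by simp
    show "\<exists>a \<in> NS. a \<epsilon> C \<and> (\<forall>b \<in> NS. b \<epsilon> C \<longrightarrow> ole R a b)"
      if C: "C \<in> SS" "\<And>a. a \<in> NS \<Longrightarrow> a \<epsilon> C \<Longrightarrow> ole R a a" "c \<in> NS" "c \<epsilon> C" for C c
    proof -
      have "(s(X := R)) X = R" by simp
      then show ?thesis using WO_least[OF WO _ C(1), of c] C(2-4) R by metis
    qed
    show "\<exists>T \<in> SS. \<forall>n \<in> NS. \<forall>i \<in> NS. pair n i \<epsilon> T \<longleftrightarrow> \<Theta> n (below R B i)" if B: "B \<in> SS" for B
    proof -
      let ?A = "LExN n (LExN j (LAnd (LEq (NVar k) (npair (NVar n) (NVar j))) ?\<theta>))"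
      have A: "sat (e(k := a)) (s1(Y := B)) ?A \<longleftrightarrow>
          (\<exists>b \<in> NS. \<exists>c \<in> NS. a = pair b c \<and> \<Theta> b (below R B c))" if a: "a \<in> NS" for a
        unfolding sat_LExN sat_LAnd
        using sat_\<theta>[OF B, of _ _ "e(k := a)"] e a ek dist' by simp
      have "\<exists>T \<in> SS. \<forall>a \<in> NS. a \<epsilon> T \<longleftrightarrow> sat (e(k := a)) (s1(Y := B)) ?A"
        by (rule comprehension) (use arith e s1 B in auto)
      then obtain T where T: "T \<in> SS"
        "\<forall>a \<in> NS. a \<epsilon> T \<longleftrightarrow> (\<exists>b \<in> NS. \<exists>c \<in> NS. a = pair b c \<and> \<Theta> b (below R B c))"
        using A by blast
      have "pair b c \<epsilon> T \<longleftrightarrow> \<Theta> b (below R B c)" if "b \<in> NS" "c \<in> NS" for b c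
      proof -
        have "pair b c = pair b' c' \<longleftrightarrow> b = b' \<and> c = c'" if "b' \<in> NS" "c' \<in> NS" for b' c'
          using pair_inject std_in that \<open>b \<in> NS\<close> \<open>c \<in> NS\<close> by blast
        then show ?thesis using T(2) pair_std[OF that] that by blast
      qed
      then show ?thesis using T(1) by blast
    qed
    show "\<exists>G \<in> std (T1 \<Rrightarrow> N \<Rrightarrow> N). \<forall>Y \<in> SS. \<forall>j \<in> NS. G \<odot> Y \<odot> j = chi (ole R j j \<and>
      (\<forall>n \<in> NS. \<forall>i \<in> NS. ole R i j \<longrightarrow> (pair n i \<epsilon> Y \<longleftrightarrow> \<Theta> n (below R Y i))))"
    proof -
      \<comment> \<open>The formula is turned into a functional of the set \<open>Y\<close>, and not
        into one set for each \<open>Y\<close>, because \<open>hier_char\<close> demands a single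
        functional.\<close>
      let ?A = "LAnd (in_field X (NVar k)) (LAllN n (LAllN j (LImp (le_rel X (NVar j) (NVar k))
        (LIff (LMem (npair (NVar n) (NVar j)) Y) ?\<theta>))))"
      have A: "sat (e(k := a)) (s1(Y := B)) ?A \<longleftrightarrow> ole R a a \<and>
          (\<forall>b \<in> NS. \<forall>c \<in> NS. ole R c a \<longrightarrow> (pair b c \<epsilon> B \<longleftrightarrow> \<Theta> b (below R B c)))"
        if "a \<in> NS" "B \<in> SS" for a B
      proof -
        have "sat (e(k := a, n := b, j := c)) (s1(Y := B)) ?\<theta> \<longleftrightarrow> \<Theta> b (below R B c)"
          if "b \<in> NS" "c \<in> NS" for b c
          by (rule sat_\<theta>) (use e that ek \<open>a \<in> NS\<close> \<open>B \<in> SS\<close> in auto)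
        then show ?thesis using dist' s1X XY by (simp, blast)
      qed
      have "arithmetical ?A" using arith by simp
      then obtain G where G: "G \<in> std (T1 \<Rrightarrow> N \<Rrightarrow> N)"
        "\<And>W a. W \<in> std T1 \<Longrightarrow> a \<in> NS \<Longrightarrow> G \<odot> W \<odot> a = chi (sat (e(k := a)) (s1(Y := W)) ?A)"
        using comprehension_functional[of ?A e s1 k Y] e SS_std(1)[OF s1] by blast
      then show ?thesis using A SS_std(1) by (intro bexI[OF _ G(1)]) simp
    qed
  qed
  obtain B where B: "B \<in> SS" "\<forall>a \<in> NS. a \<epsilon> B \<longleftrightarrow>
     (\<exists>b \<in> NS. \<exists>c \<in> NS. a = pair b c \<and> ole R c c \<and> \<Theta> b (below R B c))"
    using hierarchy by blast
  let ?A = "LExN n (LExN j (LAnd (LEq (NVar k) (npair (NVar n) (NVar j)))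
    (LAnd (in_field X (NVar j)) ?\<theta>)))"
  have "sat (e(k := a)) (s1(Y := B)) (LIff (LMem (NVar k) Y) ?A)" if a: "a \<in> NS" for a
  proof -
    have "sat (e(k := a)) (s1(Y := B)) ?A \<longleftrightarrow>
        (\<exists>b \<in> NS. \<exists>c \<in> NS. a = pair b c \<and> ole R c c \<and> \<Theta> b (below R B c))"
      unfolding sat_LExN sat_LAnd
      using sat_\<theta>[OF B(1), of _ _ "e(k := a)"] e a ek dist' s1X XY by simp
    then show ?thesis unfolding sat_LIff using B(2) a by simp
  qed
  then have "sat e (s1(Y := B)) (H \<theta> n Z0 k j m i X Y)"
    unfolding H_def sat.simps(7)[of e "s1(Y := B)"] by blast
  then show "\<exists>B \<in> SS. sat e (s(X := R, Y := B)) (H \<theta> n Z0 k j m i X Y)"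
    using B(1) s1_def by blast
qed

lemma sat_ACA0:
  assumes "A \<in> ACA0_axioms" and e: "\<And>x. e x \<in> NS" and s: "\<And>X. s X \<in> SS"
  shows "sat e s A"
proof -
  have eN: "e x \<in> NN" for x using e std_in by blast
  from assms(1) show ?thesis
  proof cases
    case induction
    have "a \<epsilon> s 0" if "\<zero> \<epsilon> s 0" "\<forall>a \<in> NS. a \<epsilon> s 0 \<longrightarrow> a \<oplus> \<one> \<epsilon> s 0" "a \<in> NS" for a
    proof (rule std_induct[OF SS_std(1)[OF s] that(1) _ std_in[OF that(3)]])
      fix n assume n: "n \<in> NS" "n \<epsilon> s 0"
      have "n \<oplus> \<one> = S n" using std_in[OF n(1)] by simp
      then show "S n \<epsilon> s 0" using that(2) n by metis
    qed
    moreover have "sat e s A \<longleftrightarrow> (\<zero> \<epsilon> s 0 \<and> (\<forall>a \<in> NS. a \<epsilon> s 0 \<longrightarrow> a \<oplus> \<one> \<epsilon> s 0) \<longrightarrow>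
        (\<forall>a \<in> NS. a \<epsilon> s 0))"
      unfolding induction by simp
    ultimately show ?thesis by blast
  next
    case (comprehension A X n)
    have "sat (e(n := a)) (s(X := W)) A = sat (e(n := a)) s A" for a W
      by (rule sat_cong) (use comprehension in auto)
    moreover obtain W where "W \<in> SS" "\<forall>a \<in> NS. a \<epsilon> W \<longleftrightarrow> sat (e(n := a)) s A"
      using nonstd_model.comprehension[OF nonstd_model_axioms comprehension(2), of e s n] e s by blast
    ultimately show ?thesis unfolding comprehension(1) sat_LExS sat.simps(7) sat_LIff by auto
  qed (use eN less_S_iff in \<open>auto simp: sat_LIff sat_LOr\<close>)
qed

lemma sat_ATR0_axioms:
  assumes "A \<in> ATR0_axioms" "\<And>x. e x \<in> NS" "\<And>X. s X \<in> SS"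
  shows "sat e s A"
  using assms(1)
proof cases
  case aca0
  then show ?thesis using sat_ACA0 assms(2,3) by blast
next
  case (recursion \<theta> X Y n k j m i Z0)
  show ?thesis unfolding recursion(1) by (rule sat_recursion[OF recursion(2-6) assms(2,3)])
qed

text \<open>\<open>D\<close> collects the variables to which outer quantifiers of the prefix have
  already given standard values.\<close>

lemma sat_foldr_LAllN:
  "(\<And>e. \<forall>x \<in> D \<union> set ns. e x \<in> NS \<Longrightarrow> sat e s A) \<Longrightarrow> \<forall>x \<in> D. e x \<in> NS \<Longrightarrow>
   sat e s (foldr LAllN ns A)"
proof (induction ns arbitrary: D e)
  case (Cons x ns)
  have "sat (e(x := a)) s (foldr LAllN ns A)" if "a \<in> NS" for a
    by (rule Cons.IH[of "insert x D"]) (use Cons.prems that in auto)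
  then show ?case by simp
qed simp

lemma sat_foldr_LAllS:
  "(\<And>s. \<forall>X \<in> D \<union> set Xs. s X \<in> SS \<Longrightarrow> sat e s A) \<Longrightarrow> \<forall>X \<in> D. s X \<in> SS \<Longrightarrow>
   sat e s (foldr LAllS Xs A)"
proof (induction Xs arbitrary: D s)
  case (Cons X Xs)
  have "sat e (s(X := W)) (foldr LAllS Xs A)" if "W \<in> SS" for W
    by (rule Cons.IH[of "insert X D"]) (use Cons.prems that in auto)
  then show ?case by simp
qed simp

lemma sat_ATR0:
  assumes "A \<in> ATR0"
  shows "sat e s A"
proof -
  obtain ns Xs B where B: "A = foldr LAllN ns (foldr LAllS Xs B)" "B \<in> ATR0_axioms"
    "free_num B \<subseteq> set ns" "free_set B \<subseteq> set Xs"
    using assms unfolding ATR0_def by blast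
  \<comment> \<open>The constant zero function, i.e. the empty set, is the default value for set
    variables outside \<open>Xs\<close>.\<close>
  have "val [] e0 (Con (Comb_K N N) \<cdot> zero) \<in> std T1" by (rule val_std) auto
  moreover have "val [] e0 (Con (Comb_K N N) \<cdot> zero) \<odot> a = \<zero>" if "a \<in> NN" for a
    using that by (simp add: val.simps K_eq flip: Z_def)
  ultimately obtain W where W: "W \<in> SS" using std_in by (auto simp: SS_def)
  show ?thesis unfolding B(1)
  proof (rule sat_foldr_LAllN[of "{}"]; (rule sat_foldr_LAllS[of "{}"])?)
    fix e s assume es: "\<forall>x \<in> {} \<union> set ns. e x \<in> NS" "\<forall>X \<in> {} \<union> set Xs. s X \<in> SS"
    \<comment> \<open>The axioms were verified for valuations that are standard everywhere, so the
      variables that do not occur free in \<open>B\<close> are reset to standard defaults.\<close>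
    have "sat e s B = sat (\<lambda>x. if x \<in> set ns then e x else \<zero>) (\<lambda>X. if X \<in> set Xs then s X else W) B"
      by (rule sat_cong) (use B in auto)
    also have \<dots> by (rule sat_ATR0_axioms[OF B(2)]) (use es W in auto)
    finally show "sat e s B" .
  qed auto
qed

end

theorem theorem6p4:
  shows "\<forall>A \<in> ATR0_st. P0 \<union> {Pi01_TRANS, STP} \<turnstile> A"
proof
  fix A assume "A \<in> ATR0_st"
  then obtain B where B: "B \<in> ATR0" "A = rel_st B" unfolding ATR0_st_def by blast
  show "P0 \<union> {Pi01_TRANS, STP} \<turnstile> A"
  proof (rule completeness)
    fix U ap cst and st :: "tm set \<Rightarrow> bool" and e
    assume "model U ap cst st (P0 \<union> {Pi01_TRANS, STP})" and e: "frame.env U e"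
    then interpret nonstd_model U ap cst st by (simp add: nonstd_model_def)
    show "frame.sem U ap cst st [] e A" using sem_rel_st[OF e] sat_ATR0[OF B(1)] B(2) by blast
  qed (use B in auto)
qed

end
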